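(* Let $N\ge 3$, $\frac{2N}{N+2}<p<\frac N2$ with $p>1$, $p^\ast=\frac{Np}{N-p}$, let $\alpha,\beta>1$ with $\alpha+\beta=p^\ast$ and $\alpha,\beta<p$, let $\mu_1,\mu_2>0$, and let $\gamma>0$. Let $I$, $\mathcal{N}$ and $A=\inf_{(u,v)\in\mathcal{N}}I(u,v)$ be as defined in the context. Then $A$ is attained by some $(U,V)\in\mathcal{N}$, where $U$ and $V$ are positive, radially symmetric, and decreasing.
   Context: $D^{1,p}(\mathbb{R}^N)=\{u\in L^{p^\ast}(\mathbb{R}^N):|\nabla u|\in L^p(\mathbb{R}^N)\}$ with norm $\|u\|_{D^{1,p}}=\big(\int_{\mathbb{R}^N}|\nabla u|^p\,dx\big)^{1/p}$, and $D=D^{1,p}(\mathbb{R}^N)\times D^{1,p}(\mathbb{R}^N)$. For $(u,v)\in D$, $$I(u,v)=\frac1p\int_{\mathbb{R}^N}\big(|\nabla u|^p+|\nabla v|^p\big)\,dx-\frac{1}{p^\ast}\int_{\mathbb{R}^N}\big(\mu_1|u|^{p^\ast}+\mu_2|v|^{p^\ast}+\gamma|u|^\alpha|v|^\beta\big)\,dx.$$ $\mathcal{N}$ is the set of $(u,v)\in D$ with $u\neq0$, $v\neq 0$ such that $$\int_{\mathbb{R}^N}|\nabla u|^p=\int_{\mathbb{R}^N}\Big(\mu_1|u|^{p^\ast}+\frac{\alpha\gamma}{p^\ast}|u|^\alpha|v|^\beta\Big),\qquad \int_{\mathbb{R}^N}|\nabla v|^p=\int_{\mathbb{R}^N}\Big(\mu_2|v|^{p^\ast}+\frac{\beta\gamma}{p^\ast}|u|^\alpha|v|^\beta\Big).$$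 "$A$ is attained by $(U,V)$" means $(U,V)\in\mathcal{N}$ and $I(U,V)=A$. *)

theory Defs
  imports "HOL-Analysis.Analysis"
begin

text \<open>Elements of the function spaces below are functions, not classes modulo null sets. All the
  quantities involved depend only on the class, and \<open>u \<noteq> 0\<close> is read as: \<open>u\<close> does not vanish
  almost everywhere.\<close>

primrec C_k :: "nat \<Rightarrow> ('a::euclidean_space \<Rightarrow> real) \<Rightarrow> bool" where
  "C_k 0 f \<longleftrightarrow> continuous_on UNIV f"
| "C_k (Suc k) f \<longleftrightarrow> (\<forall>x. f differentiable (at x)) \<and>
     (\<forall>b\<in>Basis. C_k k (\<lambda>x. frechet_derivative f (at x) b))"

definition test_function :: "('a::euclidean_space \<Rightarrow> real) \<Rightarrow> bool" where
  "test_function \<phi> \<longleftrightarrow> (\<forall>k. C_k k \<phi>) \<and> compact (closure {x. \<phi> x \<noteq> 0})"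

definition locally_integrable :: "('a::euclidean_space \<Rightarrow> 'b::euclidean_space) \<Rightarrow> bool" where
  "locally_integrable f \<longleftrightarrow> f \<in> borel_measurable lebesgue \<and>
     (\<forall>K. compact K \<longrightarrow> set_integrable lebesgue K f)"

definition has_weak_gradient ::
    "('a::euclidean_space \<Rightarrow> real) \<Rightarrow> ('a \<Rightarrow> 'a) \<Rightarrow> bool" where
  "has_weak_gradient u g \<longleftrightarrow> locally_integrable u \<and> locally_integrable g \<and>
     (\<forall>\<phi>. test_function \<phi> \<longrightarrow> (\<forall>b\<in>Basis.
        (\<integral>x. u x * frechet_derivative \<phi> (at x) b \<partial>lebesgue) =
        - (\<integral>x. (g x \<bullet> b) * \<phi> x \<partial>lebesgue)))"

text \<open>A weak gradient is unique up to a null set, so the choice below is immaterial inside integrals.\<close>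

definition weak_grad :: "('a::euclidean_space \<Rightarrow> real) \<Rightarrow> 'a \<Rightarrow> 'a" where
  "weak_grad u = (SOME g. has_weak_gradient u g)"

definition Lp :: "real \<Rightarrow> ('a::euclidean_space \<Rightarrow> 'b::euclidean_space) set" where
  "Lp q = {f. f \<in> borel_measurable lebesgue \<and> integrable lebesgue (\<lambda>x. norm (f x) powr q)}"

definition crit_exp :: "nat \<Rightarrow> real \<Rightarrow> real" where
  "crit_exp N p = real N * p / (real N - p)"

definition D1p :: "real \<Rightarrow> ('a::euclidean_space \<Rightarrow> real) set" where
  "D1p p = {u. u \<in> Lp (crit_exp DIM('a) p) \<and> has_weak_gradient u (weak_grad u) \<and>
     weak_grad u \<in> Lp p}"

definition energy :: "real \<Rightarrow> real \<Rightarrow> real \<Rightarrow> real \<Rightarrow> real \<Rightarrow> real \<Rightarrow>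
    ('a::euclidean_space \<Rightarrow> real) \<times> ('a \<Rightarrow> real) \<Rightarrow> real" where
  "energy p \<alpha> \<beta> \<mu>1 \<mu>2 \<gamma> = (\<lambda>(u, v). let ps = crit_exp DIM('a) p in
     1 / p * (\<integral>x. norm (weak_grad u x) powr p + norm (weak_grad v x) powr p \<partial>lebesgue)
     - 1 / ps * (\<integral>x. \<mu>1 * \<bar>u x\<bar> powr ps + \<mu>2 * \<bar>v x\<bar> powr ps
                      + \<gamma> * \<bar>u x\<bar> powr \<alpha> * \<bar>v x\<bar> powr \<beta> \<partial>lebesgue))"

definition nehari :: "real \<Rightarrow> real \<Rightarrow> real \<Rightarrow> real \<Rightarrow> real \<Rightarrow> real \<Rightarrow>
    (('a::euclidean_space \<Rightarrow> real) \<times> ('a \<Rightarrow> real)) set" where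
  "nehari p \<alpha> \<beta> \<mu>1 \<mu>2 \<gamma> = (let ps = crit_exp DIM('a) p in
     {(u, v). u \<in> D1p p \<and> v \<in> D1p p \<and>
        \<not> (AE x in lebesgue. u x = 0) \<and> \<not> (AE x in lebesgue. v x = 0) \<and>
        (\<integral>x. norm (weak_grad u x) powr p \<partial>lebesgue) =
          (\<integral>x. \<mu>1 * \<bar>u x\<bar> powr ps + \<alpha> * \<gamma> / ps * \<bar>u x\<bar> powr \<alpha> * \<bar>v x\<bar> powr \<beta> \<partial>lebesgue) \<and>
        (\<integral>x. norm (weak_grad v x) powr p \<partial>lebesgue) =
          (\<integral>x. \<mu>2 * \<bar>v x\<bar> powr ps + \<beta> * \<gamma> / ps * \<bar>u x\<bar> powr \<alpha> * \<bar>v x\<bar> powr \<beta> \<partial>lebesgue)})"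

text \<open>For \<open>\<alpha> + \<beta> = p\<^sup>*\<close>, the energy of \<open>(u, v)\<close> in \<open>nehari\<close> is \<open>1/N\<close> times the integral of
  \<open>|\<nabla>u|\<^sup>p + |\<nabla>v|\<^sup>p\<close>, hence bounded below; so this real infimum is the genuine one.\<close>

definition ground_level :: "'a::euclidean_space itself \<Rightarrow>
    real \<Rightarrow> real \<Rightarrow> real \<Rightarrow> real \<Rightarrow> real \<Rightarrow> real \<Rightarrow> real" where
  "ground_level _ p \<alpha> \<beta> \<mu>1 \<mu>2 \<gamma> =
     (INF w \<in> (nehari p \<alpha> \<beta> \<mu>1 \<mu>2 \<gamma> :: (('a \<Rightarrow> real) \<times> ('a \<Rightarrow> real)) set).
        energy p \<alpha> \<beta> \<mu>1 \<mu>2 \<gamma> w)"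

definition radially_symmetric :: "('a::euclidean_space \<Rightarrow> real) \<Rightarrow> bool" where
  "radially_symmetric f \<longleftrightarrow> (\<forall>x y. norm x = norm y \<longrightarrow> f x = f y)"

text \<open>Decreasing is taken in the strict sense.\<close>

definition radially_decreasing :: "('a::euclidean_space \<Rightarrow> real) \<Rightarrow> bool" where
  "radially_decreasing f \<longleftrightarrow> (\<forall>x y. norm x < norm y \<longrightarrow> f y < f x)"

end

theory Submission
  imports Defs
begin

text \<open>Write \<open>p'\<close> for the conjugate exponent of \<open>p\<close>, \<open>r = p\<^sup>*/p\<close>, and \<open>B\<close> for the Aubin--Talenti bubble
  \<open>(1 + |x|\<^sup>p\<^sup>')\<close> to the power \<open>-(N - p)/p\<close>. Adding the two constraints of the Nehari set and applying
  Hoelder and the sharp Sobolev inequality, the energy of a pair is bounded below in terms of the Sobolev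
  constant and the maximum of \<open>\<mu>1 x\<^sup>r + \<mu>2 y\<^sup>r + \<gamma> x\<^bsup>\<alpha>/p\<^esup> y\<^bsup>\<beta>/p\<^esup>\<close> on the simplex \<open>x + y = 1\<close>. Since \<open>\<alpha>, \<beta> < p\<close>,
  this maximum is attained at an interior point \<open>(k, l)\<close>, whose Euler--Lagrange equations say precisely that
  a suitable common multiple of \<open>(k\<^bsup>1/p\<^esup> B, l\<^bsup>1/p\<^esup> B)\<close> satisfies both constraints; it attains the bound.

  The sharp Sobolev inequality comes from the mass transport argument of Cordero-Erausquin, Nazaret and
  Villani, with the Knothe map on a box in place of the Brenier map. The map \<open>T\<close> is triangular and
  increasing, so its Jacobian is the product of the diagonal derivatives \<open>\<partial>\<^sub>i T\<^sub>i\<close>. Only these enter the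
  AM--GM step, and one-dimensional integration by parts suffices. For a general function one first smooths
  the modulus and truncates, then mollifies. That the bubble is extremal follows from an
  integration by parts, done here by scaling and Fatou's lemma.\<close>

section \<open>Monotone transport on an interval\<close>

text \<open>The source density is proportional to \<open>(f + \<delta>) powr ps\<close> and the
  target density to \<open>G\<close>, the \<open>ps\<close>-th power of the bubble, both restricted
  to the cube of half side \<open>R\<close>. The lift by \<open>\<delta>\<close> keeps the source
  positive, which makes each one-dimensional map differentiable; it costs a boundary term of order
  \<open>\<delta> powr r\<close>, removed at fixed \<open>R\<close> before the cube grows. With A, E
  the integrals of \<open>f powr ps\<close> and of the p-th power of the gradient, and M, J, I those
  of \<open>G\<close>, \<open>G powr (1 - 1 / N)\<close> and \<open>G y * norm y powr q\<close>, the
  outcome is N J (A/M)^(1/ps) <= r E^(1/p) I^(1/q). To read off the constant given by the bubble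
  itself, only (N - 1) q I <= N J is needed, one half of the identity from integrating by parts;
  this is why Fatou's lemma suffices. For a Nehari pair with total gradient energy e the estimates
  give e <= K e^(ps/p) with ps > p, hence a lower bound for e. Since the competitor is explicit,
  neither rearrangement nor compactness of minimising sequences enters; radial symmetry is read off
  its formula.\<close>

definition slab :: "real \<Rightarrow> real measure" where
  "slab R = density lborel (indicator {-R..R})"

lemma sets_slab [simp, measurable_cong]: "sets (slab R) = sets borel"
  by (simp add: slab_def)

lemma space_slab [simp]: "space (slab R) = UNIV"
  by (simp add: slab_def)

lemma nn_integral_slab:
  assumes [measurable]: "f \<in> borel_measurable borel"
  shows "(\<integral>\<^sup>+x. f x \<partial>slab R) = (\<integral>\<^sup>+x. f x * indicator {-R..R} x \<partial>lborel)"
  by (simp add: slab_def nn_integral_density mult.commute)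

lemma emeasure_slab: "R \<ge> 0 \<Longrightarrow> emeasure (slab R) UNIV = ennreal (2 * R)"
  using nn_integral_slab[of "\<lambda>_. 1" R] by simp

lemma finite_measure_slab: "finite_measure (slab R)"
proof
  show "emeasure (slab R) (space (slab R)) \<noteq> \<infinity>"
    using nn_integral_slab[of "\<lambda>_. 1" R] by (cases "R \<ge> 0") auto
qed

text \<open>The measure lives on the whole line rather than on a restricted space, so facts on the
  interval enter as almost-everywhere facts, and products keep the Borel sigma-algebra.\<close>

lemma AE_slab: "AE x in slab R. x \<in> {-R..R}"
  unfolding slab_def by (subst AE_density) (auto simp: indicator_def intro!: AE_I2)

lemma integral_slab:
  fixes f :: "real \<Rightarrow> real"
  assumes [measurable]: "f \<in> borel_measurable borel"
  shows "(\<integral>x. f x \<partial>slab R) = (\<integral>x. indicator {-R..R} x * f x \<partial>lborel)"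
proof -
  have "slab R = density lborel (\<lambda>x. ennreal (indicator {-R..R} x))"
    by (auto simp: slab_def indicator_def intro!: density_cong)
  then show ?thesis
    by (simp add: integral_density)
qed

lemma integrable_slab_bounded:
  fixes f :: "real \<Rightarrow> real"
  assumes [measurable]: "f \<in> borel_measurable borel" and "\<And>x. x \<in> {-R..R} \<Longrightarrow> \<bar>f x\<bar> \<le> C"
  shows "integrable (slab R) f"
proof -
  interpret finite_measure "slab R" by (rule finite_measure_slab)
  show ?thesis
    by (rule integrable_const_bound[where B = C]) (use AE_slab[of R] assms in auto)
qed

lemma integrable_slab_continuous:
  fixes f :: "real \<Rightarrow> real"
  assumes "continuous_on UNIV f"
  shows "integrable (slab R) f"
proof -
  have "compact (f ` {-R..R})"
    using assms by (intro compact_continuous_image) (auto intro: continuous_on_subset)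
  then have "bounded (f ` {-R..R})" by (rule compact_imp_bounded)
  then obtain C where "\<forall>y \<in> f ` {-R..R}. norm y \<le> C" unfolding bounded_iff by blast
  then have "\<bar>f x\<bar> \<le> C" if "x \<in> {-R..R}" for x using that by auto
  then show ?thesis
    using assms by (intro integrable_slab_bounded) (auto intro: borel_measurable_continuous_onI)
qed

lemma slab_integral_pos:
  fixes f :: "real \<Rightarrow> real"
  assumes f: "f \<in> borel_measurable borel" "integrable (slab R) f" and pos: "\<And>x. 0 < f x" and "R > 0"
  shows "(\<integral>x. f x \<partial>slab R) > 0"
proof -
  have "\<not> (AE x in slab R. f x = 0)"
  proof
    assume "AE x in slab R. f x = 0"
    then have "AE x in slab R. False"
      by eventually_elim (use pos in \<open>auto simp: less_le\<close>)
    then have "emeasure (slab R) UNIV = 0"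
      by (simp add: AE_iff_measurable[OF _ refl])
    then show False using emeasure_slab[of R] \<open>R > 0\<close> by (simp add: ennreal_eq_0_iff)
  qed
  moreover have "(\<integral>x. f x \<partial>slab R) \<ge> 0"
    using pos by (intro integral_nonneg_AE) (auto simp: less_imp_le)
  ultimately show ?thesis
    using integral_nonneg_eq_0_iff_AE[OF f(2)] pos by (auto simp: less_le)
qed

text \<open>Dividing by the total mass makes the distribution functions of two densities of
  different mass comparable: both run from 0 to 1.\<close>

definition cdf_slab :: "real \<Rightarrow> (real \<Rightarrow> real) \<Rightarrow> real \<Rightarrow> real" where
  "cdf_slab R f s = (\<integral>y. (if y \<le> s then f y else 0) \<partial>slab R) / (\<integral>y. f y \<partial>slab R)"

lemma borel_measurable_cdf_slab [measurable]:
  assumes [measurable]: "f \<in> borel_measurable borel"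
  shows "cdf_slab R f \<in> borel_measurable borel"
proof -
  interpret finite_measure "slab R" by (rule finite_measure_slab)
  have "(\<lambda>s. \<integral>y. (if y \<le> s then f y else 0) \<partial>slab R) \<in> borel_measurable borel"
    by measurable
  then show ?thesis unfolding cdf_slab_def by measurable
qed

text \<open>The inverse of the distribution function of \<open>g\<close> is written as the measure of a sublevel set, so that
  measurability in parameters is an instance of Fubini's theorem.\<close>

definition mono_transport :: "real \<Rightarrow> (real \<Rightarrow> real) \<Rightarrow> (real \<Rightarrow> real) \<Rightarrow> real \<Rightarrow> real" where
  "mono_transport R f g s =
     (\<integral>t. (if cdf_slab R g t < cdf_slab R f s then 1 else 0) \<partial>slab R) - R"

text \<open>At the endpoints \<open>cdf_slab\<close> has a kink, because the measure stops there.
  The function \<open>A\<close> continues it as an honest antiderivative, so that it has two-sided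
  derivatives on the closed interval, as the substitution rule asks.\<close>

lemma cdf_slab_antiderivative:
  assumes "continuous_on UNIV f" "\<And>x. 0 < f x" "R > 0"
  obtains A where "\<And>s. s \<in> {-R..R} \<Longrightarrow> A s = cdf_slab R f s"
    "\<And>s. s \<in> {-R..R} \<Longrightarrow> (A has_real_derivative f s / (\<integral>y. f y \<partial>slab R)) (at s)"
    "A (-R) = 0" "A R = 1" "strict_mono_on {-R..R} A" "continuous_on {-R..R} A"
proof -
  define m where "m = (\<integral>y. f y \<partial>slab R)"
  have bf [measurable]: "f \<in> borel_measurable borel"
    using assms(1) by (rule borel_measurable_continuous_onI)
  have m: "m > 0" unfolding m_def using assms
    by (intro slab_integral_pos integrable_slab_continuous bf)
  \<comment> \<open>Starting the integrals at -R-1 makes -R an interior point of the domain of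
    integration.\<close>
  define A where "A s = (integral {-R-1..s} f - integral {-R-1..-R} f) / m" for s
  have cf: "continuous_on S f" for S using assms(1) continuous_on_subset by blast
  have int: "f integrable_on {a..b}" for a b by (rule integrable_continuous_real[OF cf])
  have Aeq: "A s = integral {-R..s} f / m" if "s \<in> {-R..R}" for s
    using Henstock_Kurzweil_Integration.integral_combine[of "-R-1" "-R" s f] that int by (simp add: A_def)
  have leb: "integral {-R..s} f = (\<integral>y. indicator {-R..s} y * f y \<partial>lborel)" for s
    using set_borel_integral_eq_integral(2)[of "{-R..s}" f] borel_integrable_atLeastAtMost'[OF cf]
    by (simp add: set_lebesgue_integral_def)
  have 1: "A s = cdf_slab R f s" if "s \<in> {-R..R}" for s
  proof -
    have "(\<integral>y. (if y \<le> s then f y else 0) \<partial>slab R) = (\<integral>y. indicator {-R..s} y * f y \<partial>lborel)"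
      by (subst integral_slab) (use that in \<open>auto intro!: Bochner_Integration.integral_cong split: split_indicator\<close>)
    then show ?thesis using Aeq[OF that] leb[of s] by (simp add: cdf_slab_def m_def)
  qed
  have 2: "(A has_real_derivative f s / m) (at s)" if "s \<in> {-R..R}" for s
  proof -
    have "((\<lambda>x. integral {-R-1..x} f) has_real_derivative f s) (at s within {-R-1..R+1})"
      using that by (intro integral_has_real_derivative cf) auto
    moreover have "at s within {-R-1..R+1} = at s"
      using that by (intro at_within_Icc_at) auto
    ultimately show ?thesis unfolding A_def using m by (auto intro!: derivative_eq_intros)
  qed
  have 3: "A (-R) = 0" by (simp add: A_def)
  have 4: "A R = 1"
    using Aeq[of R] leb[of R] \<open>R > 0\<close> m integral_slab[OF bf, of R] by (simp add: m_def)
  have 5: "strict_mono_on {-R..R} A"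
  proof (rule strict_mono_onI)
    fix r s assume "r \<in> {-R..R}" "s \<in> {-R..R}" "r < s"
    then show "A r < A s"
      by (intro DERIV_pos_imp_increasing[of r s A]) (auto intro!: exI 2 divide_pos_pos assms m)
  qed
  have 6: "continuous_on {-R..R} A"
    using 2 by (meson DERIV_continuous continuous_at_imp_continuous_on)
  show ?thesis using that[of A] 1 2 3 4 5 6 m_def by blast
qed

text \<open>On the interval the map is the composition of \<open>A\<close> with \<open>k\<close>,
  where \<open>A\<close> and \<open>B\<close> are the distribution functions of \<open>f\<close> and
  \<open>g\<close> and \<open>k\<close> inverts \<open>B\<close>. The derivative is the chain rule
  with the inverse function theorem; the push-forward follows by writing one integral over [0,1] in
  the variables \<open>A s\<close> and \<open>B t\<close>.\<close>

lemma mono_transport: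
  fixes f g :: "real \<Rightarrow> real" and R :: real
  assumes f: "continuous_on UNIV f" "\<And>x. 0 < f x" and g: "continuous_on UNIV g" "\<And>x. 0 < g x"
    and R: "R > 0"
  defines "\<tau> \<equiv> mono_transport R f g"
    and "mf \<equiv> \<integral>y. f y \<partial>slab R" and "mg \<equiv> \<integral>y. g y \<partial>slab R"
  shows mono_transport_range: "s \<in> {-R..R} \<Longrightarrow> \<tau> s \<in> {-R..R}"
    and mono_transport_continuous: "continuous_on {-R..R} \<tau>"
    and mono_transport_deriv: "s \<in> {-R<..<R} \<Longrightarrow>
      (\<tau> has_real_derivative f s / mf * (mg / g (\<tau> s))) (at s)"
    and mono_transport_push: "\<And>\<psi>. \<psi> \<in> borel_measurable borel \<Longrightarrow>
      (\<integral>\<^sup>+s. ennreal (f s) * \<psi> (\<tau> s) \<partial>slab R) = (\<integral>\<^sup>+t. ennreal (g t) * \<psi> t \<partial>slab R) * ennreal (mf / mg)"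
proof -
  have bf [measurable]: "f \<in> borel_measurable borel" "g \<in> borel_measurable borel"
    using f(1) g(1) borel_measurable_continuous_onI by auto
  have mf: "mf > 0" unfolding mf_def using f R by (intro slab_integral_pos integrable_slab_continuous bf)
  have mg: "mg > 0" unfolding mg_def using g R by (intro slab_integral_pos integrable_slab_continuous bf)
  obtain A where A: "\<And>s. s \<in> {-R..R} \<Longrightarrow> A s = cdf_slab R f s"
    "\<And>s. s \<in> {-R..R} \<Longrightarrow> (A has_real_derivative f s / mf) (at s)"
    "A (-R) = 0" "A R = 1" "strict_mono_on {-R..R} A" "continuous_on {-R..R} A"
    unfolding mf_def using cdf_slab_antiderivative[OF f R] by metis
  obtain B where B: "\<And>s. s \<in> {-R..R} \<Longrightarrow> B s = cdf_slab R g s"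
    "\<And>s. s \<in> {-R..R} \<Longrightarrow> (B has_real_derivative g s / mg) (at s)"
    "B (-R) = 0" "B R = 1" "strict_mono_on {-R..R} B" "continuous_on {-R..R} B"
    unfolding mg_def using cdf_slab_antiderivative[OF g R] by metis
  \<comment> \<open>The defining formula of the map, with the value of the first distribution
    function replaced by a free variable. At \<open>B u\<close> the sublevel set is [-R, u), of
    length u + R, which is how \<open>k\<close> turns out to invert \<open>B\<close>.\<close>
  define k where "k y = (\<integral>t. (if cdf_slab R g t < y then 1 else 0) \<partial>slab R) - R" for y
  have \<tau>k: "\<tau> s = k (A s)" if "s \<in> {-R..R}" for s
    using A(1)[OF that] by (simp add: \<tau>_def k_def mono_transport_def)
  have Bless: "B t < B u \<longleftrightarrow> t < u" if "t \<in> {-R..R}" "u \<in> {-R..R}" for t u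
    using B(5) that by (metis linorder_neq_iff order_less_asym strict_mono_onD)
  have kB: "k (B u) = u" if u: "u \<in> {-R..R}" for u
  proof -
    have ae: "AE t in slab R. (if cdf_slab R g t < B u then 1 else 0) = (indicator {..<u} t :: real)"
      using AE_slab by eventually_elim (use B(1) Bless u in auto)
    have "(\<integral>t. (if cdf_slab R g t < B u then 1::real else 0) \<partial>slab R) = (\<integral>t. indicator {..<u} t \<partial>slab R)"
      by (intro integral_cong_AE ae) simp_all
    also have "\<dots> = (\<integral>t. indicator {-R..R} t * indicator {..<u} t \<partial>lborel)"
      by (rule integral_slab) simp
    also have "(\<lambda>t. indicator {-R..R} t * indicator {..<u} t) = (indicator {-R..<u} :: real \<Rightarrow> real)"
      using u by (auto simp: fun_eq_iff split: split_indicator)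
    also have "(\<integral>t. indicator {-R..<u} t \<partial>lborel) = u + R" using u by simp
    finally show ?thesis by (simp add: k_def)
  qed
  have im: "B ` {-R..R} = {0..1}"
  proof
    show "B ` {-R..R} \<subseteq> {0..1}"
      using B(3,4) strict_mono_on_leD[OF B(5), of "-R"] strict_mono_on_leD[OF B(5), of _ R] R
      by (force simp: image_subset_iff)
    show "{0..1} \<subseteq> B ` {-R..R}"
    proof
      fix y :: real assume "y \<in> {0..1}"
      then obtain x where "-R \<le> x" "x \<le> R" "B x = y"
        using IVT'[of B "-R" y R] B(3,4,6) R by auto
      then show "y \<in> B ` {-R..R}" by auto
    qed
  qed
  have Bk: "k y \<in> {-R..R}" "B (k y) = y" if "y \<in> {0..1}" for y
    using that kB im by (metis (no_types, lifting) imageE)+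
  have A01: "A s \<in> {0..1}" if "s \<in> {-R..R}" for s
    using A(3,4) strict_mono_on_leD[OF A(5), of "-R" s] strict_mono_on_leD[OF A(5), of s R] that R by auto
  have A01': "A s \<in> {0<..<1}" if "s \<in> {-R<..<R}" for s
    using A(3,4) strict_mono_onD[OF A(5), of "-R" s] strict_mono_onD[OF A(5), of s R] that R by auto
  have kcont: "continuous_on {0..1} k"
    using continuous_on_inv[OF B(6) compact_Icc] kB im by metis
  have kder: "(k has_real_derivative mg / g (k y)) (at y)" if y: "y \<in> {0<..<1}" for y
  proof -
    have "(k has_real_derivative inverse (g (k y) / mg)) (at y)"
    proof (rule DERIV_inverse_function[where f = B and a = 0 and b = 1])
      show "(B has_real_derivative g (k y) / mg) (at (k y))"
        using B(2) Bk y by auto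
      show "g (k y) / mg \<noteq> 0" using g(2) mg by (simp add: less_imp_neq[symmetric])
      show "isCont k y" using kcont y by (simp add: continuous_on_interior)
    qed (use y Bk in auto)
    then show ?thesis by simp
  qed
  show "\<tau> s \<in> {-R..R}" if "s \<in> {-R..R}" for s
    using \<tau>k Bk A01 that by metis
  have "continuous_on {-R..R} (\<lambda>s. k (A s))"
    by (rule continuous_on_compose2[OF kcont A(6)]) (use A01 in auto)
  then show "continuous_on {-R..R} \<tau>"
    by (rule continuous_on_eq) (simp add: \<tau>k)
  show "(\<tau> has_real_derivative f s / mf * (mg / g (\<tau> s))) (at s)" if s: "s \<in> {-R<..<R}" for s
  proof -
    have "((\<lambda>s. k (A s)) has_real_derivative (mg / g (k (A s))) * (f s / mf)) (at s)"
      using s by (intro DERIV_chain2[OF kder A(2)] A01') auto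
    then have "((\<lambda>s. k (A s)) has_real_derivative f s / mf * (mg / g (\<tau> s))) (at s)"
      using s \<tau>k by (simp add: mult.commute)
    then show ?thesis
      by (rule has_field_derivative_transform_within_open[of _ _ _ "{-R<..<R}"]) (use s \<tau>k in auto)
  qed
  \<comment> \<open>As the measure of growing sublevel sets, \<open>k\<close> is monotone on the
    whole line, hence Borel even outside [0,1], where it inverts nothing.\<close>
  have "mono k"
  proof (rule monoI)
    fix y y' :: real assume "y \<le> y'"
    then show "k y \<le> k y'"
      unfolding k_def
      by (auto intro!: integral_mono integrable_slab_bounded[where C = 1])
  qed
  then have kb [measurable]: "k \<in> borel_measurable borel" by (rule borel_measurable_mono)
  show "(\<integral>\<^sup>+s. ennreal (f s) * \<psi> (\<tau> s) \<partial>slab R) = (\<integral>\<^sup>+t. ennreal (g t) * \<psi> t \<partial>slab R) * ennreal (mf / mg)"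
    if [measurable]: "\<psi> \<in> borel_measurable borel" for \<psi>
  proof -
    have cf: "continuous_on {-R..R} (\<lambda>s. f s / mf)" "continuous_on {-R..R} (\<lambda>s. g s / mg)"
      using f(1) g(1) mf mg by (auto intro!: continuous_intros intro: continuous_on_subset)
    \<comment> \<open>Both substitutions rewrite the same integral of \<open>\<psi> (k y)\<close>
      over [0,1]; equating them is the push-forward identity up to the masses.\<close>
    have 1: "(\<integral>\<^sup>+y. \<psi> (k y) * indicator {0..1} y \<partial>lborel) =
        (\<integral>\<^sup>+s. \<psi> (k (A s)) * ennreal (f s / mf) * indicator {-R..R} s \<partial>lborel)"
      using nn_integral_substitution_aux[of "\<lambda>y. \<psi> (k y)" "-R" R A "\<lambda>s. f s / mf"] cf A(2,3,4) R f(2) mf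
      by (auto simp: less_imp_le)
    have 2: "(\<integral>\<^sup>+y. \<psi> (k y) * indicator {0..1} y \<partial>lborel) =
        (\<integral>\<^sup>+s. \<psi> (k (B s)) * ennreal (g s / mg) * indicator {-R..R} s \<partial>lborel)"
      using nn_integral_substitution_aux[of "\<lambda>y. \<psi> (k y)" "-R" R B "\<lambda>s. g s / mg"] cf B(2,3,4) R g(2) mg
      by (auto simp: less_imp_le)
    \<comment> \<open>\<open>A\<close> is only controlled on the interval, where it equals
      \<open>cdf_slab\<close>; the indicator cuts off the rest before measurability is
      claimed.\<close>
    have [measurable]: "(\<lambda>s. \<psi> (k (A s)) * indicator {-R..R} s) \<in> borel_measurable borel"
    proof -
      have "(\<lambda>s. \<psi> (k (A s)) * indicator {-R..R} s) = (\<lambda>s. \<psi> (k (cdf_slab R f s)) * indicator {-R..R} s)"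
        using A(1) by (auto simp: fun_eq_iff split: split_indicator)
      then show ?thesis by simp
    qed
    have "(\<integral>\<^sup>+s. ennreal (f s) * \<psi> (\<tau> s) \<partial>slab R) = (\<integral>\<^sup>+s. ennreal (f s) * (\<psi> (k (A s)) * indicator {-R..R} s) \<partial>slab R)"
      by (rule nn_integral_cong_AE) (use AE_slab in \<open>eventually_elim, use \<tau>k in auto\<close>)
    also have "\<dots> = (\<integral>\<^sup>+s. ennreal mf * (\<psi> (k (A s)) * ennreal (f s / mf) * indicator {-R..R} s) \<partial>lborel)"
    proof (subst nn_integral_slab, measurable, rule nn_integral_cong)
      fix s
      have "ennreal (f s) = ennreal mf * ennreal (f s / mf)"
        using mf f(2)[of s] by (simp add: ennreal_mult[symmetric] less_imp_le)
      then show "ennreal (f s) * (\<psi> (k (A s)) * indicator {-R..R} s) * indicator {-R..R} s =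
          ennreal mf * (\<psi> (k (A s)) * ennreal (f s / mf) * indicator {-R..R} s)"
        by (auto split: split_indicator simp: ac_simps)
    qed
    also have "\<dots> = ennreal mf * (\<integral>\<^sup>+s. (\<psi> (k (A s)) * ennreal (f s / mf) * indicator {-R..R} s) \<partial>lborel)"
    proof (rule nn_integral_cmult)
      have "(\<lambda>s. \<psi> (k (A s)) * ennreal (f s / mf) * indicator {-R..R} s) =
          (\<lambda>s. (\<psi> (k (A s)) * indicator {-R..R} s) * ennreal (f s / mf))"
        by (auto simp: fun_eq_iff ac_simps)
      then show "(\<lambda>s. \<psi> (k (A s)) * ennreal (f s / mf) * indicator {-R..R} s) \<in> borel_measurable lborel"
        by simp
    qed
    also have "\<dots> = ennreal mf * (\<integral>\<^sup>+s. (\<psi> (k (B s)) * ennreal (g s / mg) * indicator {-R..R} s) \<partial>lborel)"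
      unfolding 1[symmetric] 2[symmetric] ..
    also have "(\<integral>\<^sup>+s. (\<psi> (k (B s)) * ennreal (g s / mg) * indicator {-R..R} s) \<partial>lborel) =
        (\<integral>\<^sup>+t. ennreal (1 / mg) * (ennreal (g t) * \<psi> t * indicator {-R..R} t) \<partial>lborel)"
    proof (rule nn_integral_cong)
      fix t
      have "ennreal (g t / mg) = ennreal (1 / mg) * ennreal (g t)"
        using mg g(2)[of t] by (simp add: ennreal_mult[symmetric] less_imp_le)
      then show "\<psi> (k (B t)) * ennreal (g t / mg) * indicator {-R..R} t =
          ennreal (1 / mg) * (ennreal (g t) * \<psi> t * indicator {-R..R} t)"
        using kB by (auto split: split_indicator simp: ac_simps)
    qed
    also have "\<dots> = ennreal (1 / mg) * (\<integral>\<^sup>+t. ennreal (g t) * \<psi> t \<partial>slab R)"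
      by (subst nn_integral_cmult) (auto simp: nn_integral_slab)
    finally show ?thesis
      using mf mg by (simp add: ennreal_mult[symmetric] mult.assoc[symmetric] mult.commute)
  qed
qed

section \<open>The Knothe map on a box\<close>

text \<open>The conditions are imposed at every function, extensional or not, so that coordinates
  can be overwritten freely. Continuity is asked in each coordinate separately: this, together with
  the bound, is what integrating out a coordinate preserves.\<close>

definition box_density :: "'i set \<Rightarrow> (('i \<Rightarrow> real) \<Rightarrow> real) \<Rightarrow> bool" where
  "box_density I F \<longleftrightarrow> F \<in> borel_measurable (PiM I (\<lambda>_. borel)) \<and> (\<forall>x. 0 < F x) \<and>
     (\<exists>C. \<forall>x. F x \<le> C) \<and> (\<forall>x. \<forall>j\<in>I. continuous_on UNIV (\<lambda>s. F (x(j := s))))"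

definition marginal :: "real \<Rightarrow> 'i \<Rightarrow> (('i \<Rightarrow> real) \<Rightarrow> real) \<Rightarrow> ('i \<Rightarrow> real) \<Rightarrow> real" where
  "marginal R i F x = (\<integral>y. F (x(i := y)) \<partial>slab R)"

lemma sigma_finite_slab: "sigma_finite_measure (slab R)"
  using finite_measure_slab finite_measure.axioms(1) by auto

lemma product_sigma_finite_slab: "product_sigma_finite (\<lambda>_. slab R)"
  using sigma_finite_slab by (simp add: product_sigma_finite_def)

lemma sets_PiM_slab [simp, measurable_cong]: "sets (PiM I (\<lambda>_. slab R)) = sets (PiM I (\<lambda>_. borel))"
  by (intro sets_PiM_cong) auto

lemma space_PiM_slab [simp]: "space (PiM I (\<lambda>_. slab R)) = PiE I (\<lambda>_. UNIV)"
  by (simp add: space_PiM)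

lemma finite_measure_PiM_slab: "finite I \<Longrightarrow> finite_measure (PiM I (\<lambda>_. slab R))"
proof
  assume I: "finite I"
  interpret product_sigma_finite "\<lambda>_. slab R" by (rule product_sigma_finite_slab)
  show "emeasure (PiM I (\<lambda>_. slab R)) (space (PiM I (\<lambda>_. slab R))) \<noteq> \<infinity>"
    using emeasure_PiM[OF I, of "\<lambda>_. UNIV"] finite_measure.emeasure_finite[OF finite_measure_slab, of R UNIV]
    by (cases "emeasure (slab R) UNIV" rule: ennreal_cases) (simp_all add: ennreal_power)
qed

lemma box_density_measurable_upd:
  assumes "F \<in> borel_measurable (PiM (insert i I) (\<lambda>_. borel))"
  shows "(\<lambda>(x, y). F (x(i := y))) \<in> borel_measurable (PiM I (\<lambda>_. borel) \<Otimes>\<^sub>M borel)"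
  using measurable_compose[OF measurable_add_dim assms] by (simp add: case_prod_beta)

text \<open>Continuity in the remaining coordinates survives by dominated convergence, with the
  constant bound of \<open>F\<close> as majorant on the interval of finite measure.\<close>

lemma box_density_marginal:
  assumes F: "box_density (insert i I) F" and i: "i \<notin> I" and R: "R > 0"
  shows "box_density I (marginal R i F)"
proof -
  obtain C where C: "\<And>x. F x \<le> C" and pos: "\<And>x. 0 < F x"
    and m: "F \<in> borel_measurable (PiM (insert i I) (\<lambda>_. borel))"
    and cont: "\<And>x j. j \<in> insert i I \<Longrightarrow> continuous_on UNIV (\<lambda>s. F (x(j := s)))"
    using F unfolding box_density_def by blast
  interpret finite_measure "slab R" by (rule finite_measure_slab)
  have meas [measurable]: "(\<lambda>y. F (x(i := y))) \<in> borel_measurable borel" for x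
    using cont by (intro borel_measurable_continuous_onI) auto
  have int: "integrable (slab R) (\<lambda>y. F (x(i := y)))" for x
    using C pos by (intro integrable_slab_bounded[where C = C] meas) (auto simp: abs_of_pos)
  have [measurable]: "(\<lambda>(x, y). F (x(i := y))) \<in> borel_measurable (PiM I (\<lambda>_. borel) \<Otimes>\<^sub>M slab R)"
    using box_density_measurable_upd[OF m] by (simp cong: measurable_cong_sets)
  have 1: "marginal R i F \<in> borel_measurable (PiM I (\<lambda>_. borel))"
    unfolding marginal_def by measurable
  have 2: "0 < marginal R i F x" for x
    unfolding marginal_def using pos R by (intro slab_integral_pos int meas)
  have 3: "marginal R i F x \<le> (\<integral>y. C \<partial>slab R)" for x
    unfolding marginal_def using C by (intro integral_mono int) auto
  have 4: "continuous_on UNIV (\<lambda>s. marginal R i F (x(j := s)))" if j: "j \<in> I" for x j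
  proof -
    have ne: "j \<noteq> i" using i j by auto
    show ?thesis
      unfolding continuous_on_sequentially comp_def
    proof (intro allI ballI impI)
      fix S s assume "(\<forall>n::nat. S n \<in> (UNIV :: real set)) \<and> S \<longlonglongrightarrow> s"
      then have S: "S \<longlonglongrightarrow> s" by simp
      show "(\<lambda>n. marginal R i F (x(j := S n))) \<longlonglongrightarrow> marginal R i F (x(j := s))"
        unfolding marginal_def
      proof (rule integral_dominated_convergence[where w = "\<lambda>_. C"])
        show "AE y in slab R. (\<lambda>n. F ((x(j := S n))(i := y))) \<longlonglongrightarrow> F ((x(j := s))(i := y))"
        proof (rule AE_I2)
          fix y
          have "continuous_on UNIV (\<lambda>s. F ((x(i := y))(j := s)))" using cont j by auto
          then have "(\<lambda>n. F ((x(i := y))(j := S n))) \<longlonglongrightarrow> F ((x(i := y))(j := s))"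
            using S by (auto simp: continuous_on_sequentially comp_def)
          then show "(\<lambda>n. F ((x(j := S n))(i := y))) \<longlonglongrightarrow> F ((x(j := s))(i := y))"
            using ne by (simp add: fun_upd_twist)
        qed
      qed (use C pos in \<open>auto simp: abs_of_pos\<close>)
    qed
  qed
  show ?thesis using 1 2 3 4 unfolding box_density_def by blast
qed

text \<open>\<open>T\<close> is the transport map and \<open>d j\<close> its diagonal derivative \<open>\<partial>\<^sub>j T\<^sub>j\<close>. The Jacobian equation holds
  on the whole space since it is only the definition of the one-dimensional derivatives multiplied up.\<close>

definition box_transport ::
  "'i set \<Rightarrow> real \<Rightarrow> (('i \<Rightarrow> real) \<Rightarrow> real) \<Rightarrow> (('i \<Rightarrow> real) \<Rightarrow> real) \<Rightarrow>
    (('i \<Rightarrow> real) \<Rightarrow> 'i \<Rightarrow> real) \<Rightarrow> ('i \<Rightarrow> ('i \<Rightarrow> real) \<Rightarrow> real) \<Rightarrow> bool" where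
  "box_transport I R F G T d \<longleftrightarrow>
     (let P = PiM I (\<lambda>_. slab R); mF = \<integral>x. F x \<partial>P; mG = \<integral>x. G x \<partial>P in
     T \<in> P \<rightarrow>\<^sub>M P \<and> (\<forall>j\<in>I. d j \<in> borel_measurable P) \<and>
     (\<forall>\<phi>\<in>borel_measurable P. (\<integral>\<^sup>+x. ennreal (F x) * \<phi> (T x) \<partial>P) =
        (\<integral>\<^sup>+y. ennreal (G y) * \<phi> y \<partial>P) * ennreal (mF / mG)) \<and>
     (\<forall>x\<in>space P. (\<forall>j\<in>I. \<bar>x j\<bar> \<le> R) \<longrightarrow> (\<forall>j\<in>I. \<bar>T x j\<bar> \<le> R \<and> 0 < d j x)) \<and>
     (\<forall>x\<in>space P. (\<Prod>j\<in>I. d j x) * G (T x) * mF = F x * mG) \<and>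
     (\<forall>x\<in>space P. \<forall>j\<in>I. continuous_on {-R..R} (\<lambda>s. T (x(j := s)) j) \<and>
        (\<forall>s\<in>{-R<..<R}. ((\<lambda>s. T (x(j := s)) j) has_real_derivative d j (x(j := s))) (at s))))"

lemma integral_PiM_slab_insert:
  assumes F: "box_density (insert i I) F" and i: "i \<notin> I" and I: "finite I" and R: "R > 0"
  shows "(\<integral>x. F x \<partial>PiM (insert i I) (\<lambda>_. slab R)) = (\<integral>x. marginal R i F x \<partial>PiM I (\<lambda>_. slab R))"
    and "integrable (PiM (insert i I) (\<lambda>_. slab R)) F"
proof -
  obtain C where C: "\<And>x. F x \<le> C" and pos: "\<And>x. 0 < F x"
    and m: "F \<in> borel_measurable (PiM (insert i I) (\<lambda>_. borel))"
    using F unfolding box_density_def by blast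
  interpret product_sigma_finite "\<lambda>_. slab R" by (rule product_sigma_finite_slab)
  interpret P: finite_measure "PiM (insert i I) (\<lambda>_. slab R)" using I by (simp add: finite_measure_PiM_slab)
  show int: "integrable (PiM (insert i I) (\<lambda>_. slab R)) F"
    by (rule P.integrable_const_bound[where B = C]) (use C pos m in \<open>auto simp: abs_of_pos cong: measurable_cong_sets\<close>)
  show "(\<integral>x. F x \<partial>PiM (insert i I) (\<lambda>_. slab R)) = (\<integral>x. marginal R i F x \<partial>PiM I (\<lambda>_. slab R))"
    unfolding marginal_def using product_integral_insert[OF I i int] .
qed

text \<open>Joint measurability in the parameter and the threshold; it makes the last component of
  the Knothe map measurable.\<close>

lemma measurable_cdf_slab_upd:
  assumes F: "F \<in> borel_measurable (PiM (insert i I) (\<lambda>_. borel))"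
  shows "(\<lambda>(x, s). cdf_slab R (\<lambda>y. F (x(i := y))) s) \<in> borel_measurable (PiM I (\<lambda>_. borel) \<Otimes>\<^sub>M borel)"
proof -
  interpret finite_measure "slab R" by (rule finite_measure_slab)
  have 1: "(\<lambda>(x, y). F (x(i := y))) \<in> borel_measurable (PiM I (\<lambda>_. borel) \<Otimes>\<^sub>M slab R)"
    using box_density_measurable_upd[OF F] by (simp cong: measurable_cong_sets)
  have "(\<lambda>w. (fst (fst w), snd w)) \<in> (PiM I (\<lambda>_. borel) \<Otimes>\<^sub>M borel) \<Otimes>\<^sub>M slab R \<rightarrow>\<^sub>M PiM I (\<lambda>_. borel :: real measure) \<Otimes>\<^sub>M slab R"
    by measurable
  from measurable_compose[OF this 1]
  have [measurable]: "(\<lambda>w. F ((fst (fst w))(i := snd w))) \<in> borel_measurable ((PiM I (\<lambda>_. borel) \<Otimes>\<^sub>M borel) \<Otimes>\<^sub>M slab R)"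
    by (simp add: case_prod_beta)
  show ?thesis
    unfolding cdf_slab_def case_prod_beta by measurable
qed

text \<open>Induction on the coordinates: the marginals are transported first, and the new
  coordinate is then moved by the monotone map from the section of \<open>F\<close> over
  \<open>z\<close> to the section of \<open>G\<close> over the image \<open>T' z\<close>. The
  section masses \<open>F' z\<close> and \<open>G' (T' z)\<close> in the new derivative cancel
  against the Jacobian equation of the marginals.\<close>

lemma box_transport_exists:
  assumes "finite I" "box_density I F" "box_density I G" and R: "R > 0"
  shows "\<exists>T d. box_transport I R F G T d"
  using assms(1,2,3)
proof (induction I arbitrary: F G rule: finite_induct)
  case empty
  have pos: "0 < F x" "0 < G x" for x using empty by (auto simp: box_density_def)
  \<comment> \<open>With no coordinates the product measure is a unit point mass; the identity
    works, and \<open>mF / mG\<close> is the ratio of the two values there.\<close>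
  have "box_transport {} R F G (\<lambda>x. x) (\<lambda>_ _. 0)"
    using pos(1)[of "\<lambda>_. undefined"] pos(2)[of "\<lambda>_. undefined"] unfolding box_transport_def Let_def
    by (auto simp: PiM_empty nn_integral_count_space_finite lebesgue_integral_count_space_finite
        ennreal_mult[symmetric] less_imp_le mult.commute mult.left_commute ac_simps
        intro!: arg_cong2[where f = "(*)"])
  then show ?case by blast
next
  case (insert i I)
  note F = insert.prems(1) and G = insert.prems(2) and I = insert.hyps(1) and i = insert.hyps(2)
  interpret product_sigma_finite "\<lambda>_. slab R" by (rule product_sigma_finite_slab)
  interpret sl: finite_measure "slab R" by (rule finite_measure_slab)
  define F' where "F' = marginal R i F"
  define G' where "G' = marginal R i G"
  define P where "P = PiM I (\<lambda>_. slab R)"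
  define P' where "P' = PiM (insert i I) (\<lambda>_. slab R)"
  have setsP [measurable_cong]: "sets P = sets (PiM I (\<lambda>_. borel))" "sets P' = sets (PiM (insert i I) (\<lambda>_. borel))"
    by (simp_all add: P_def P'_def)
  have spaceP: "space P = PiE I (\<lambda>_. UNIV)" "space P' = PiE (insert i I) (\<lambda>_. UNIV)"
    by (simp_all add: P_def P'_def)
  have F'd: "box_density I F'" and G'd: "box_density I G'"
    unfolding F'_def G'_def by (rule box_density_marginal[OF F i R] box_density_marginal[OF G i R])+
  have pos: "0 < F x" "0 < G x" "0 < F' x" "0 < G' x" for x
    using F G F'd G'd by (auto simp: box_density_def)
  have mF [measurable]: "F \<in> borel_measurable P'" and mG [measurable]: "G \<in> borel_measurable P'"
    and mF' [measurable]: "F' \<in> borel_measurable P" and mG' [measurable]: "G' \<in> borel_measurable P"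
    using F G F'd G'd by (auto simp: box_density_def cong: measurable_cong_sets)
  have contF: "continuous_on UNIV (\<lambda>s. F (x(j := s)))" and contG: "continuous_on UNIV (\<lambda>s. G (x(j := s)))"
    if "j \<in> insert i I" for x j using that F G by (auto simp: box_density_def)
  define m where "m = (\<integral>x. F x \<partial>P')"
  define mg where "mg = (\<integral>x. G x \<partial>P')"
  have mF': "m = (\<integral>x. F' x \<partial>P)" and mG': "mg = (\<integral>x. G' x \<partial>P)"
    using integral_PiM_slab_insert(1)[OF F i I R] integral_PiM_slab_insert(1)[OF G i I R]
    by (simp_all add: m_def mg_def P_def P'_def F'_def G'_def)
  obtain T' d' where "box_transport I R F' G' T' d'"
    using insert.IH[OF F'd G'd] by blast
  then have T'm [measurable]: "T' \<in> P \<rightarrow>\<^sub>M P" and d'm: "\<And>j. j \<in> I \<Longrightarrow> d' j \<in> borel_measurable P"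
    and push': "\<And>\<phi>. \<phi> \<in> borel_measurable P \<Longrightarrow> (\<integral>\<^sup>+x. ennreal (F' x) * \<phi> (T' x) \<partial>P) =
        (\<integral>\<^sup>+y. ennreal (G' y) * \<phi> y \<partial>P) * ennreal (m / mg)"
    and range': "\<And>x j. x \<in> space P \<Longrightarrow> \<forall>j\<in>I. \<bar>x j\<bar> \<le> R \<Longrightarrow> j \<in> I \<Longrightarrow> \<bar>T' x j\<bar> \<le> R \<and> 0 < d' j x"
    and jac': "\<And>x. x \<in> space P \<Longrightarrow> (\<Prod>j\<in>I. d' j x) * G' (T' x) * m = F' x * mg"
    and der': "\<And>x j. x \<in> space P \<Longrightarrow> j \<in> I \<Longrightarrow> continuous_on {-R..R} (\<lambda>s. T' (x(j := s)) j)"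
        "\<And>x j s. x \<in> space P \<Longrightarrow> j \<in> I \<Longrightarrow> s \<in> {-R<..<R} \<Longrightarrow> ((\<lambda>s. T' (x(j := s)) j) has_real_derivative d' j (x(j := s))) (at s)"
    unfolding box_transport_def Let_def mF' mG' P_def[symmetric] by blast+
  \<comment> \<open>Sections are taken over \<open>z\<close> for the source and over the already
    transported point for the target; this dependence makes the map triangular.\<close>
  define \<tau> where "\<tau> z = mono_transport R (\<lambda>y. F (z(i := y))) (\<lambda>y. G ((T' z)(i := y)))" for z
  define T where "T x = (T' (restrict x I))(i := \<tau> (restrict x I) (x i))" for x
  define d where "d j x = (if j = i then F x / F' (restrict x I) * (G' (T' (restrict x I)) / G (T x))
                     else d' j (restrict x I))" for j x
  have rm [measurable]: "(\<lambda>x. restrict x I) \<in> P' \<rightarrow>\<^sub>M P"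
    unfolding P_def P'_def by (rule measurable_restrict_subset) auto
  have rs: "restrict x I \<in> space P" if "x \<in> space P'" for x
    using that by (auto simp: spaceP)
  have T's: "T' z \<in> space P" if "z \<in> space P" for z
    using measurable_space[OF T'm that] .
  have um: "(\<lambda>(x, y). x(i := y)) \<in> P \<Otimes>\<^sub>M slab R \<rightarrow>\<^sub>M P'"
    unfolding P_def P'_def by (rule measurable_add_dim)
  have ci [measurable]: "(\<lambda>x. x i) \<in> borel_measurable P'"
    using measurable_component_singleton[of i "insert i I" "\<lambda>_. slab R"] by (simp add: P'_def cong: measurable_cong_sets)
  have KF: "(\<lambda>(x, s). cdf_slab R (\<lambda>y. F (x(i := y))) s) \<in> borel_measurable (P \<Otimes>\<^sub>M borel)"
    and KG: "(\<lambda>(x, s). cdf_slab R (\<lambda>y. G (x(i := y))) s) \<in> borel_measurable (P \<Otimes>\<^sub>M borel)"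
    using measurable_cdf_slab_upd[of F i I R] measurable_cdf_slab_upd[of G i I R] mF mG
    by (simp_all cong: measurable_cong_sets)
  have tm [measurable]: "(\<lambda>x. \<tau> (restrict x I) (x i)) \<in> borel_measurable P'"
  proof -
    have "(\<lambda>x. (restrict x I, x i)) \<in> P' \<rightarrow>\<^sub>M P \<Otimes>\<^sub>M borel" by measurable
    from measurable_compose[OF this KF]
    have [measurable]: "(\<lambda>x. cdf_slab R (\<lambda>y. F ((restrict x I)(i := y))) (x i)) \<in> borel_measurable P'" by simp
    have "(\<lambda>w. (T' (restrict (fst w) I), snd w)) \<in> P' \<Otimes>\<^sub>M slab R \<rightarrow>\<^sub>M P \<Otimes>\<^sub>M borel" by measurable
    from measurable_compose[OF this KG]
    have [measurable]: "(\<lambda>w. cdf_slab R (\<lambda>y. G ((T' (restrict (fst w) I))(i := y))) (snd w)) \<in> borel_measurable (P' \<Otimes>\<^sub>M slab R)" by simp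
    show ?thesis unfolding \<tau>_def mono_transport_def by measurable
  qed
  have Tm [measurable]: "T \<in> P' \<rightarrow>\<^sub>M P'"
  proof -
    have "(\<lambda>x. (T' (restrict x I), \<tau> (restrict x I) (x i))) \<in> P' \<rightarrow>\<^sub>M P \<Otimes>\<^sub>M slab R" by measurable
    from measurable_compose[OF this um] show ?thesis unfolding T_def[abs_def] by simp
  qed
  \<comment> \<open>Points of the product space are extensional, so updating at the new index and
    restricting back recovers them.\<close>
  have ru: "restrict (z(i := y)) I = z" if "z \<in> space P" for z y
    using that i by (auto simp: spaceP fun_eq_iff PiE_def extensional_def)
  have xz: "(restrict x I)(i := y) = x(i := y)" if "x \<in> space P'" for x y
    using that by (auto simp: spaceP fun_eq_iff PiE_def extensional_def)
  have \<tau>f: "\<And>s. s \<in> {-R..R} \<Longrightarrow> \<tau> z s \<in> {-R..R}" "continuous_on {-R..R} (\<tau> z)"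
     "\<And>s. s \<in> {-R<..<R} \<Longrightarrow> (\<tau> z has_real_derivative F (z(i := s)) / F' z * (G' (T' z) / G ((T' z)(i := \<tau> z s)))) (at s)"
     "\<And>\<psi>. \<psi> \<in> borel_measurable borel \<Longrightarrow>
      (\<integral>\<^sup>+s. ennreal (F (z(i := s))) * \<psi> (\<tau> z s) \<partial>slab R) = (\<integral>\<^sup>+t. ennreal (G ((T' z)(i := t))) * \<psi> t \<partial>slab R) * ennreal (F' z / G' (T' z))" for z
    unfolding \<tau>_def F'_def G'_def marginal_def
    using mono_transport[of "\<lambda>y. F (z(i := y))" "\<lambda>y. G ((T' z)(i := y))" R] contF contG pos R by auto
  have jac: "(\<Prod>j\<in>insert i I. d j x) * G (T x) * m = F x * mg" if x: "x \<in> space P'" for x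
  proof -
    have "(\<Prod>j\<in>I. d j x) = (\<Prod>j\<in>I. d' j (restrict x I))"
      using i by (intro prod.cong) (auto simp: d_def)
    then have "(\<Prod>j\<in>insert i I. d j x) * G (T x) * m = d i x * G (T x) * ((\<Prod>j\<in>I. d' j (restrict x I)) * m)"
      using i I by simp
    also have "\<dots> = F x / F' (restrict x I) * ((\<Prod>j\<in>I. d' j (restrict x I)) * G' (T' (restrict x I)) * m)"
      using pos[of "T x"] by (simp add: d_def)
    also have "\<dots> = F x * mg"
      using jac'[OF rs[OF x]] pos[of "restrict x I"] by simp
    finally show ?thesis .
  qed
  have push: "(\<integral>\<^sup>+x. ennreal (F x) * \<phi> (T x) \<partial>P') = (\<integral>\<^sup>+y. ennreal (G y) * \<phi> y \<partial>P') * ennreal (m / mg)"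
    if [measurable]: "\<phi> \<in> borel_measurable P'" for \<phi>
  proof -
    have um': "(\<lambda>t. w(i := t)) \<in> slab R \<rightarrow>\<^sub>M P'" if "w \<in> space P" for w
      using measurable_Pair2[OF um that] by simp
    \<comment> \<open>The conditional mean of \<open>\<phi>\<close> over the section of the target;
      the induction hypothesis is applied to this function.\<close>
    define \<psi> where "\<psi> w = (\<integral>\<^sup>+t. ennreal (G (w(i := t))) * \<phi> (w(i := t)) \<partial>slab R) / ennreal (G' w)" for w
    have m\<psi>: "\<psi> \<in> borel_measurable P"
    proof -
      have "(\<lambda>x. ennreal (G x) * \<phi> x) \<in> borel_measurable P'" by measurable
      from measurable_compose[OF um this]
      have [measurable]: "(\<lambda>w. ennreal (G ((fst w)(i := snd w))) * \<phi> ((fst w)(i := snd w))) \<in> borel_measurable (P \<Otimes>\<^sub>M slab R)"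
        by (simp add: case_prod_beta)
      show ?thesis unfolding \<psi>_def by measurable
    qed
    have "(\<integral>\<^sup>+x. ennreal (F x) * \<phi> (T x) \<partial>P') = (\<integral>\<^sup>+z. (\<integral>\<^sup>+y. ennreal (F (z(i := y))) * \<phi> (T (z(i := y))) \<partial>slab R) \<partial>P)"
      unfolding P_def P'_def
      by (rule product_nn_integral_insert[OF I i]) (fold P_def P'_def, measurable)
    also have "\<dots> = (\<integral>\<^sup>+z. ennreal (F' z) * \<psi> (T' z) \<partial>P)"
    proof (rule nn_integral_cong)
      fix z assume z: "z \<in> space P"
      have \<phi>m: "(\<lambda>t. \<phi> ((T' z)(i := t))) \<in> borel_measurable borel"
        using measurable_compose[OF um'[OF T's[OF z]] that] by (simp cong: measurable_cong_sets)
      have "(\<integral>\<^sup>+y. ennreal (F (z(i := y))) * \<phi> (T (z(i := y))) \<partial>slab R)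
          = (\<integral>\<^sup>+y. ennreal (F (z(i := y))) * \<phi> ((T' z)(i := \<tau> z y)) \<partial>slab R)"
        by (simp add: T_def ru[OF z])
      also have "\<dots> = (\<integral>\<^sup>+t. ennreal (G ((T' z)(i := t))) * \<phi> ((T' z)(i := t)) \<partial>slab R) * ennreal (F' z / G' (T' z))"
        by (rule \<tau>f(4)[OF \<phi>m])
      also have "\<dots> = ennreal (F' z) * \<psi> (T' z)"
        unfolding \<psi>_def using pos(3)[of z] pos(4)[of "T' z"]
        by (simp add: divide_ennreal[symmetric] ennreal_times_divide ennreal_divide_times mult.commute less_imp_le)
      finally show "(\<integral>\<^sup>+y. ennreal (F (z(i := y))) * \<phi> (T (z(i := y))) \<partial>slab R) = ennreal (F' z) * \<psi> (T' z)" .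
    qed
    also have "\<dots> = (\<integral>\<^sup>+w. ennreal (G' w) * \<psi> w \<partial>P) * ennreal (m / mg)"
      by (rule push'[OF m\<psi>])
    also have "(\<integral>\<^sup>+w. ennreal (G' w) * \<psi> w \<partial>P) = (\<integral>\<^sup>+w. (\<integral>\<^sup>+t. ennreal (G (w(i := t))) * \<phi> (w(i := t)) \<partial>slab R) \<partial>P)"
    proof (rule nn_integral_cong)
      fix w
      show "ennreal (G' w) * \<psi> w = (\<integral>\<^sup>+t. ennreal (G (w(i := t))) * \<phi> (w(i := t)) \<partial>slab R)"
        unfolding \<psi>_def using pos(4)[of w] by (simp add: ennreal_times_divide mult.commute[of "ennreal (G' w)"] mult_divide_eq_ennreal)
    qed
    also have "\<dots> = (\<integral>\<^sup>+y. ennreal (G y) * \<phi> y \<partial>P')"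
      unfolding P_def P'_def
      by (rule product_nn_integral_insert[OF I i, symmetric]) (fold P_def P'_def, measurable)
    finally show ?thesis .
  qed
  have dm: "d j \<in> borel_measurable P'" if "j \<in> insert i I" for j
  proof (cases "j = i")
    case True
    then show ?thesis unfolding d_def by simp
  next
    case False
    then have "j \<in> I" using that by auto
    from measurable_compose[OF rm d'm[OF this]] show ?thesis unfolding d_def[abs_def] using False by simp
  qed
  have range: "\<bar>T x j\<bar> \<le> R \<and> 0 < d j x" if x: "x \<in> space P'" "\<forall>j\<in>insert i I. \<bar>x j\<bar> \<le> R" and j: "j \<in> insert i I" for x j
  proof (cases "j = i")
    case True
    have "\<tau> (restrict x I) (x i) \<in> {-R..R}" using x(2) by (intro \<tau>f(1)) (auto simp: abs_le_iff)
    then show ?thesis using True pos by (auto simp: T_def d_def abs_le_iff)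
  next
    case False
    have "\<forall>j\<in>I. \<bar>restrict x I j\<bar> \<le> R" using x(2) by auto
    then have "\<bar>T' (restrict x I) j\<bar> \<le> R \<and> 0 < d' j (restrict x I)"
      by (rule range'[OF rs[OF x(1)]]) (use False j in auto)
    then show ?thesis using False by (simp add: T_def d_def del: restrict_apply)
  qed
  have der: "continuous_on {-R..R} (\<lambda>s. T (x(j := s)) j) \<and>
        (\<forall>s\<in>{-R<..<R}. ((\<lambda>s. T (x(j := s)) j) has_real_derivative d j (x(j := s))) (at s))"
    if x: "x \<in> space P'" and j: "j \<in> insert i I" for x j
  proof (cases "j = i")
    case True
    define z where "z = restrict x I"
    have z: "z \<in> space P" unfolding z_def by (rule rs[OF x])
    have e: "restrict (x(i := s)) I = z" for s using i by (auto simp: z_def fun_eq_iff)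
    have 1: "(\<lambda>s. T (x(i := s)) i) = \<tau> z"
      by (simp add: T_def e)
    have 2: "d i (x(i := s)) = F (z(i := s)) / F' z * (G' (T' z) / G ((T' z)(i := \<tau> z s)))" for s
      by (simp add: d_def T_def e xz[OF x, folded z_def])
    show ?thesis unfolding True 1 2 using \<tau>f(2,3) by blast
  next
    case False
    \<comment> \<open>Components with index in \<open>I\<close> do not see the new coordinate, so
      the derivative is that of the smaller map.\<close>
    then have jI: "j \<in> I" using j by auto
    define z where "z = restrict x I"
    have z: "z \<in> space P" unfolding z_def by (rule rs[OF x])
    have e: "restrict (x(j := s)) I = z(j := s)" for s using jI by (auto simp: z_def fun_eq_iff)
    have 1: "(\<lambda>s. T (x(j := s)) j) = (\<lambda>s. T' (z(j := s)) j)" using False by (simp add: T_def e)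
    have 2: "d j (x(j := s)) = d' j (z(j := s))" for s using False by (simp add: d_def e)
    show ?thesis unfolding 1 2 using der'[OF z jI] by blast
  qed
  have "box_transport (insert i I) R F G T d"
    unfolding box_transport_def Let_def
    using Tm dm push range jac der unfolding m_def mg_def P'_def by blast
  then show ?case by blast
qed

section \<open>Sharp Sobolev inequality for smooth functions\<close>

text \<open>Young's inequality is applied to the functions divided by their norms; if a norm
  vanishes, the product vanishes almost everywhere.\<close>

lemma Hoelder_integral:
  fixes f g :: "'a \<Rightarrow> real"
  assumes pq: "p > 1" "q > 1" "1 / p + 1 / q = 1"
    and [measurable]: "f \<in> borel_measurable M" "g \<in> borel_measurable M"
    and nonneg: "\<And>x. 0 \<le> f x" "\<And>x. 0 \<le> g x"
    and int: "integrable M (\<lambda>x. f x powr p)" "integrable M (\<lambda>x. g x powr q)"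
  shows "integrable M (\<lambda>x. f x * g x)"
    and "(\<integral>x. f x * g x \<partial>M) \<le> (\<integral>x. f x powr p \<partial>M) powr (1 / p) * (\<integral>x. g x powr q \<partial>M) powr (1 / q)"
proof -
  have Y: "f x * g x \<le> f x powr p / p + g x powr q / q" for x
    by (rule Youngs_inequality[OF pq nonneg])
  show I: "integrable M (\<lambda>x. f x * g x)"
    by (rule Bochner_Integration.integrable_bound[where f = "\<lambda>x. f x powr p / p + g x powr q / q"])
      (use int Y nonneg in \<open>auto intro!: AE_I2 order_trans[OF _ abs_ge_self]\<close>)
  define A where "A = (\<integral>x. f x powr p \<partial>M)"
  define B where "B = (\<integral>x. g x powr q \<partial>M)"
  have AB0: "A \<ge> 0" "B \<ge> 0" unfolding A_def B_def by (auto intro!: integral_nonneg_AE)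
  have null: "(\<integral>x. f x * g x \<partial>M) = 0" if "A = 0 \<or> B = 0"
  proof -
    have "AE x in M. f x * g x = 0"
    proof (cases "A = 0")
      case True
      then have "AE x in M. f x powr p = 0"
        using integral_nonneg_eq_0_iff_AE[OF int(1)] by (simp add: A_def)
      then show ?thesis by eventually_elim auto
    next
      case False
      then have "AE x in M. g x powr q = 0"
        using that integral_nonneg_eq_0_iff_AE[OF int(2)] by (simp add: B_def)
      then show ?thesis by eventually_elim auto
    qed
    then show ?thesis by (rule integral_eq_zero_AE)
  qed
  show "(\<integral>x. f x * g x \<partial>M) \<le> A powr (1 / p) * B powr (1 / q)"
  proof (cases "A = 0 \<or> B = 0")
    case True
    then show ?thesis using null by simp
  next
    case False
    then have AB: "A > 0" "B > 0" using AB0 by auto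
    define a where "a = A powr (1 / p)"
    define b where "b = B powr (1 / q)"
    have ab: "a > 0" "b > 0" using AB by (auto simp: a_def b_def)
    have powrs: "a powr p = A" "b powr q = B"
      using pq(1,2) AB by (simp_all add: a_def b_def powr_powr)
    have "f x * g x \<le> a * b * (f x powr p / (p * A) + g x powr q / (q * B))" for x
    proof -
      have "f x / a * (g x / b) \<le> (f x / a) powr p / p + (g x / b) powr q / q"
        using ab nonneg by (intro Youngs_inequality[OF pq] divide_nonneg_pos) simp_all
      also have "\<dots> = f x powr p / (p * A) + g x powr q / (q * B)"
        using ab nonneg by (simp add: powr_divide powrs mult.commute)
      finally have "a * b * (f x / a * (g x / b)) \<le> a * b * (f x powr p / (p * A) + g x powr q / (q * B))"
        using ab by (intro mult_left_mono) auto
      then show ?thesis using ab by simp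
    qed
    then have "(\<integral>x. f x * g x \<partial>M) \<le> (\<integral>x. a * b * (f x powr p / (p * A) + g x powr q / (q * B)) \<partial>M)"
      by (intro integral_mono I) (auto intro!: int)
    also have "\<dots> = a * b * (A / (p * A) + B / (q * B))"
      using int unfolding A_def[symmetric] B_def[symmetric] by (simp flip: A_def B_def)
    also have "A / (p * A) + B / (q * B) = 1" using AB pq(3) by simp
    finally show ?thesis unfolding a_def b_def by (simp only: mult_1_right)
  qed
qed

section \<open>Coordinates, integrals over cubes, and integration by parts against the transport
  map\<close>

definition of_coords :: "('a \<Rightarrow> real) \<Rightarrow> 'a::euclidean_space" where
  "of_coords x = (\<Sum>b\<in>Basis. x b *\<^sub>R b)"

abbreviation sym_box :: "real \<Rightarrow> 'a::euclidean_space set" where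
  "sym_box R \<equiv> cbox (- (\<Sum>b\<in>Basis. R *\<^sub>R b)) (\<Sum>b\<in>Basis. R *\<^sub>R b)"

lemma mem_sym_box: "y \<in> sym_box R \<longleftrightarrow> (\<forall>b\<in>Basis. \<bar>y \<bullet> b\<bar> \<le> R)"
  by (auto simp: mem_box abs_le_iff)

lemma of_coords_inner [simp]: "b \<in> Basis \<Longrightarrow> of_coords x \<bullet> b = x b"
  by (simp add: of_coords_def inner_sum_left inner_Basis if_distrib sum.delta cong: if_cong)

lemma of_coords_upd: "b \<in> Basis \<Longrightarrow> of_coords (x(b := s)) = of_coords x + (s - x b) *\<^sub>R b"
  by (rule euclidean_eqI) (auto simp: inner_add_left inner_Basis)

lemma measurable_of_coords [measurable]:
  "of_coords \<in> borel_measurable (PiM Basis (\<lambda>_. borel))"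
  unfolding of_coords_def[abs_def] by measurable

lemma prod_indicator_eq:
  "finite B \<Longrightarrow> (\<Prod>b\<in>B. indicator (S b) (f b) :: ennreal) = of_bool (\<forall>b\<in>B. f b \<in> S b)"
  by (induction B rule: finite_induct) auto

text \<open>The product of interval measures is the product Lebesgue measure cut down to the cube,
  which is checked on measurable rectangles.\<close>

lemma nn_integral_box:
  fixes h :: "'a::euclidean_space \<Rightarrow> ennreal"
  assumes [measurable]: "h \<in> borel_measurable borel"
  shows "(\<integral>\<^sup>+x. h (of_coords x) \<partial>PiM Basis (\<lambda>_. slab R)) = (\<integral>\<^sup>+y. h y * indicator (sym_box R) y \<partial>lborel)"
proof -
  let ?L = "PiM Basis (\<lambda>_::'a. lborel :: real measure)"
  interpret S: product_sigma_finite "\<lambda>_. slab R" by (rule product_sigma_finite_slab)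
  interpret L: product_sigma_finite "\<lambda>_. lborel :: real measure"
    by (simp add: product_sigma_finite_def sigma_finite_lborel)
  have [measurable]: "of_coords \<in> borel_measurable ?L"
    using measurable_of_coords measurable_cong_sets[OF sets_PiM_cong[OF refl sets_lborel]] by blast
  have eq: "density ?L (\<lambda>x. indicator (sym_box R) (of_coords x)) = PiM Basis (\<lambda>_. slab R)"
  proof (rule S.PiM_eqI)
    show "sets (density ?L (\<lambda>x. indicator (sym_box R) (of_coords x))) = sets (PiM Basis (\<lambda>_. slab R))"
      using sets_PiM_cong[OF refl sets_lborel] by (simp only: sets_density sets_PiM_slab)
    fix A :: "'a \<Rightarrow> real set" assume "\<And>i. i \<in> Basis \<Longrightarrow> A i \<in> sets (slab R)"
    then have A [measurable]: "\<And>i. i \<in> Basis \<Longrightarrow> A i \<in> sets borel" by simp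
    have "emeasure (density ?L (\<lambda>x. indicator (sym_box R) (of_coords x))) (PiE Basis A)
        = (\<integral>\<^sup>+x. indicator (sym_box R) (of_coords x) * indicator (PiE Basis A) x \<partial>?L)"
      by (rule emeasure_density) (auto intro!: sets_PiM_I_finite)
    also have "\<dots> = (\<integral>\<^sup>+x. (\<Prod>b\<in>Basis. indicator {-R..R} (x b) * indicator (A b) (x b)) \<partial>?L)"
    proof (rule nn_integral_cong)
      fix x :: "'a \<Rightarrow> real" assume x: "x \<in> space ?L"
      have "indicator (sym_box R) (of_coords x) = (\<Prod>b\<in>Basis. indicator {-R..R} (x b) :: ennreal)"
        by (simp add: prod_indicator_eq indicator_def mem_sym_box abs_le_iff minus_le_iff conj_commute)
      moreover have "indicator (PiE Basis A) x = (\<Prod>b\<in>Basis. indicator (A b) (x b) :: ennreal)"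
        using x by (simp add: prod_indicator_eq indicator_def PiE_iff space_PiM)
      ultimately show "indicator (sym_box R) (of_coords x) * indicator (PiE Basis A) x =
          (\<Prod>b\<in>Basis. indicator {-R..R} (x b) * indicator (A b) (x b) :: ennreal)"
        by (simp add: prod.distrib)
    qed
    also have "\<dots> = (\<Prod>b\<in>Basis. (\<integral>\<^sup>+x. indicator {-R..R} x * indicator (A b) x \<partial>lborel))"
      using A by (intro L.product_nn_integral_prod) auto
    also have "\<dots> = (\<Prod>b\<in>Basis. emeasure (slab R) (A b))"
      using A by (intro prod.cong) (auto simp: slab_def emeasure_density)
    finally show "emeasure (density ?L (\<lambda>x. indicator (sym_box R) (of_coords x))) (PiE Basis A) =
        (\<Prod>b\<in>Basis. emeasure (slab R) (A b))" .
  qed auto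
  have "(\<integral>\<^sup>+y. h y * indicator (sym_box R) y \<partial>lborel) = (\<integral>\<^sup>+y. h y * indicator (sym_box R) y \<partial>distr ?L borel of_coords)"
    by (subst lborel_eq) (simp add: of_coords_def[abs_def])
  also have "\<dots> = (\<integral>\<^sup>+x. indicator (sym_box R) (of_coords x) * h (of_coords x) \<partial>?L)"
    by (subst nn_integral_distr) (auto simp: mult.commute)
  also have "\<dots> = (\<integral>\<^sup>+x. h (of_coords x) \<partial>density ?L (\<lambda>x. indicator (sym_box R) (of_coords x)))"
    by (subst nn_integral_density) auto
  finally show ?thesis unfolding eq by simp
qed

lemma integral_box:
  fixes h :: "'a::euclidean_space \<Rightarrow> real"
  assumes h: "continuous_on UNIV h" and nonneg: "\<And>x. 0 \<le> h x"
  shows "(\<integral>x. h (of_coords x) \<partial>PiM Basis (\<lambda>_. slab R)) = (\<integral>y. h y * indicator (sym_box R) y \<partial>lborel)"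
    and "integrable (PiM Basis (\<lambda>_. slab R)) (\<lambda>x. h (of_coords x))"
    and "integrable lborel (\<lambda>y. h y * indicator (sym_box R) y)"
    and "(\<integral>\<^sup>+x. ennreal (h (of_coords x)) \<partial>PiM Basis (\<lambda>_. slab R)) = ennreal (\<integral>y. h y * indicator (sym_box R) y \<partial>lborel)"
proof -
  have [measurable]: "h \<in> borel_measurable borel" using h by (rule borel_measurable_continuous_onI)
  have "set_integrable lborel (sym_box R) h"
    unfolding set_integrable_def
    by (rule borel_integrable_compact[OF compact_cbox]) (use h continuous_on_subset in blast)
  then show i1: "integrable lborel (\<lambda>y. h y * indicator (sym_box R) y)"
    by (simp add: set_integrable_def mult.commute)
  show n1: "(\<integral>\<^sup>+x. ennreal (h (of_coords x)) \<partial>PiM Basis (\<lambda>_. slab R)) = ennreal (\<integral>y. h y * indicator (sym_box R) y \<partial>lborel)"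
    using nn_integral_eq_integral[OF i1] nonneg nn_integral_box[of "\<lambda>y. ennreal (h y)" R]
    by (simp add: ennreal_mult' ennreal_indicator)
  have m: "(\<lambda>x. h (of_coords x)) \<in> borel_measurable (PiM Basis (\<lambda>_. slab R))" by measurable
  show i2: "integrable (PiM Basis (\<lambda>_. slab R)) (\<lambda>x. h (of_coords x))"
    using m n1 nonneg by (intro integrableI_nonneg) auto
  show "(\<integral>x. h (of_coords x) \<partial>PiM Basis (\<lambda>_. slab R)) = (\<integral>y. h y * indicator (sym_box R) y \<partial>lborel)"
    using nn_integral_eq_integral[OF i2] n1 nonneg by (simp add: integral_nonneg_AE)
qed

lemma slab_by_parts:
  fixes a a' t e :: "real \<Rightarrow> real"
  assumes R: "R > 0" and a: "\<And>s. (a has_real_derivative a' s) (at s)" and a': "continuous_on UNIV a'"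
    and bdry: "a R = c" "a (-R) = c" and nonneg: "\<And>s. 0 \<le> a s" "\<And>s. s \<in> {-R..R} \<Longrightarrow> 0 \<le> e s"
    and t: "continuous_on {-R..R} t" "\<And>s. s \<in> {-R<..<R} \<Longrightarrow> (t has_real_derivative e s) (at s)"
    and tR: "\<And>s. s \<in> {-R..R} \<Longrightarrow> \<bar>t s\<bar> \<le> R"
    and [measurable]: "t \<in> borel_measurable borel" "e \<in> borel_measurable borel"
  shows "(\<integral>\<^sup>+s. ennreal (a s * e s) \<partial>slab R) \<le> ennreal (2 * R * c + (\<integral>s. - a' s * t s \<partial>slab R))"
    and "0 \<le> 2 * R * c + (\<integral>s. - a' s * t s \<partial>slab R)"
proof -
  have ca: "continuous_on S a" for S
    using a by (meson DERIV_continuous continuous_at_imp_continuous_on)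
  have [measurable]: "a \<in> borel_measurable borel" "a' \<in> borel_measurable borel"
    using ca a' borel_measurable_continuous_onI by auto
  have c: "c \<ge> 0" using bdry nonneg(1)[of R] by simp
  have cat: "continuous_on {-R..R} (\<lambda>s. a' s * t s)"
    by (intro continuous_intros t continuous_on_subset[OF a']) auto
  have 1: "((\<lambda>s. a' s * t s + a s * e s) has_integral a R * t R - a (-R) * t (-R)) {-R..R}"
  proof (rule fundamental_theorem_of_calculus_interior)
    show "continuous_on {-R..R} (\<lambda>s. a s * t s)" by (intro continuous_intros ca t)
    fix s assume s: "s \<in> {-R<..<R}"
    have "((\<lambda>s. a s * t s) has_real_derivative a' s * t s + a s * e s) (at s)"
      using a t(2)[OF s] by (auto intro!: derivative_eq_intros)
    then show "((\<lambda>s. a s * t s) has_vector_derivative a' s * t s + a s * e s) (at s)"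
      by (simp add: has_real_derivative_iff_has_vector_derivative)
  qed (use R in auto)
  have 2: "((\<lambda>s. a' s * t s) has_integral integral {-R..R} (\<lambda>s. a' s * t s)) {-R..R}"
    using integrable_continuous_real[OF cat] by (rule integrable_integral)
  have 3: "((\<lambda>s. a s * e s) has_integral (c * (t R - t (-R)) - integral {-R..R} (\<lambda>s. a' s * t s))) {-R..R}"
    using has_integral_diff[OF 1 2] bdry by (simp add: algebra_simps)
  have 4: "(\<integral>s. - a' s * t s \<partial>slab R) = - integral {-R..R} (\<lambda>s. a' s * t s)"
    using set_borel_integral_eq_integral(2)[OF borel_integrable_atLeastAtMost'[OF cat]]
    by (subst integral_slab) (simp_all add: set_lebesgue_integral_def)
  have 5: "(\<integral>\<^sup>+s. ennreal (a s * e s) \<partial>slab R) = ennreal (c * (t R - t (-R)) - integral {-R..R} (\<lambda>s. a' s * t s))"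
    using nn_integral_has_integral_lebesgue'[OF _ 3] nonneg by (subst nn_integral_slab) auto
  have 6: "0 \<le> c * (t R - t (-R)) - integral {-R..R} (\<lambda>s. a' s * t s)"
    by (rule has_integral_nonneg[OF 3]) (use nonneg in auto)
  \<comment> \<open>As \<open>t\<close> stays in [-R, R], its increase is at most 2R, whatever its
    end values are.\<close>
  have "t R - t (-R) \<le> 2 * R" using tR[of R] tR[of "-R"] R by (auto simp: abs_le_iff)
  then have "c * (t R - t (-R)) \<le> 2 * R * c" using mult_left_mono[OF _ c] by (metis mult.commute)
  then show "(\<integral>\<^sup>+s. ennreal (a s * e s) \<partial>slab R) \<le> ennreal (2 * R * c + (\<integral>s. - a' s * t s \<partial>slab R))"
    and "0 \<le> 2 * R * c + (\<integral>s. - a' s * t s \<partial>slab R)"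
    using 4 5 6 by (auto intro!: ennreal_leI)
qed

lemma AE_PiM_slab:
  assumes I: "finite I"
  shows "AE x in PiM I (\<lambda>_. slab R). \<forall>k\<in>I. \<bar>x k\<bar> \<le> R"
proof -
  interpret product_sigma_finite "\<lambda>_. slab R" by (rule product_sigma_finite_slab)
  have "AE x in PiM I (\<lambda>_. slab R). \<bar>x k\<bar> \<le> R" if k: "k \<in> I" for k
  proof (rule AE_I')
    let ?A = "PiE I (\<lambda>i. if i = k then - {-R..R} else UNIV)"
    have "emeasure (slab R) (- {-R..R}) = 0"
    proof -
      have "(\<integral>\<^sup>+x. indicator {-R..R} x * indicator (- {-R..R}) x \<partial>lborel) = (\<integral>\<^sup>+(x::real). 0 \<partial>lborel)"
        by (intro nn_integral_cong) (auto split: split_indicator)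
      then show ?thesis unfolding slab_def by (subst emeasure_density) auto
    qed
    then have "emeasure (PiM I (\<lambda>_. slab R)) ?A = 0"
      using k I by (subst emeasure_PiM[OF I]) (auto intro!: prod_zero bexI[of _ k])
    then show "?A \<in> null_sets (PiM I (\<lambda>_. slab R))"
      using I by (auto simp: null_sets_def intro!: sets_PiM_I_finite)
    show "{x \<in> space (PiM I (\<lambda>_. slab R)). \<not> \<bar>x k\<bar> \<le> R} \<subseteq> ?A"
      by (auto simp: PiE_iff abs_le_iff extensional_def)
  qed
  then show ?thesis using I by (simp add: AE_finite_all)
qed

lemma measure_PiM_slab:
  assumes "finite I" "R \<ge> 0"
  shows "measure (PiM I (\<lambda>_. slab R)) (space (PiM I (\<lambda>_. slab R))) = (2 * R) ^ card I"
proof -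
  interpret product_sigma_finite "\<lambda>_. slab R" by (rule product_sigma_finite_slab)
  have "emeasure (PiM I (\<lambda>_. slab R)) (space (PiM I (\<lambda>_. slab R))) = ennreal ((2 * R) ^ card I)"
    using emeasure_PiM[OF assms(1), of "\<lambda>_. UNIV"] assms by (simp add: emeasure_slab ennreal_power)
  then show ?thesis using assms by (simp add: measure_def)
qed

text \<open>Fubini with the coordinate \<open>j\<close> innermost reduces the claim to the interval.
  The left side is a nonnegative integral because nothing is assumed about integrability of
  \<open>d j\<close>; finiteness is part of the conclusion.\<close>

lemma box_by_parts:
  fixes w w' :: "('i \<Rightarrow> real) \<Rightarrow> real" and T :: "('i \<Rightarrow> real) \<Rightarrow> 'i \<Rightarrow> real"
  assumes R: "R > 0" and I: "finite I" "j \<in> I" and tr: "box_transport I R F G T d"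
    and [measurable]: "w \<in> borel_measurable (PiM I (\<lambda>_. borel))" "w' \<in> borel_measurable (PiM I (\<lambda>_. borel))"
    and w: "\<And>x s. ((\<lambda>s. w (x(j := s))) has_real_derivative w' (x(j := s))) (at s)"
    and w'c: "\<And>x. continuous_on UNIV (\<lambda>s. w' (x(j := s)))"
    and w0: "\<And>x. 0 \<le> w x" and bdry: "\<And>x. w (x(j := R)) = c" "\<And>x. w (x(j := - R)) = c"
    and B: "\<And>x. (\<forall>k\<in>I. \<bar>x k\<bar> \<le> R) \<Longrightarrow> \<bar>w' x\<bar> \<le> B"
  shows "integrable (PiM I (\<lambda>_. slab R)) (\<lambda>x. - w' x * T x j)"
    and "(\<integral>\<^sup>+x. ennreal (w x * d j x) \<partial>PiM I (\<lambda>_. slab R))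
      \<le> ennreal (c * (2 * R) ^ card I + (\<integral>x. - w' x * T x j \<partial>PiM I (\<lambda>_. slab R)))"
    and "0 \<le> c * (2 * R) ^ card I + (\<integral>x. - w' x * T x j \<partial>PiM I (\<lambda>_. slab R))"
proof -
  define J where "J = I - {j}"
  have IJ: "I = insert j J" "finite J" "j \<notin> J" using I by (auto simp: J_def)
  define P where "P = PiM I (\<lambda>_. slab R)"
  define Q where "Q = PiM J (\<lambda>_. slab R)"
  interpret product_sigma_finite "\<lambda>_. slab R" by (rule product_sigma_finite_slab)
  interpret P: finite_measure P unfolding P_def using I by (simp add: finite_measure_PiM_slab)
  interpret Q: finite_measure Q unfolding Q_def using IJ by (simp add: finite_measure_PiM_slab)
  have [measurable_cong]: "sets P = sets (PiM I (\<lambda>_. borel))" by (simp add: P_def)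
  have Tm [measurable]: "T \<in> P \<rightarrow>\<^sub>M P" and dm [measurable]: "d j \<in> borel_measurable P"
    and rg: "\<And>x. x \<in> space P \<Longrightarrow> (\<forall>j\<in>I. \<bar>x j\<bar> \<le> R) \<Longrightarrow> \<bar>T x j\<bar> \<le> R \<and> 0 < d j x"
    and der: "\<And>x. x \<in> space P \<Longrightarrow> continuous_on {-R..R} (\<lambda>s. T (x(j := s)) j)"
       "\<And>x s. x \<in> space P \<Longrightarrow> s \<in> {-R<..<R} \<Longrightarrow> ((\<lambda>s. T (x(j := s)) j) has_real_derivative d j (x(j := s))) (at s)"
    using tr I(2) unfolding box_transport_def Let_def P_def[symmetric] by blast+
  have Tjm [measurable]: "(\<lambda>x. T x j) \<in> borel_measurable P"
  proof -
    have "(\<lambda>x. x j) \<in> borel_measurable P"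
      using measurable_component_singleton[of j I "\<lambda>_. slab R"] I by (simp add: P_def cong: measurable_cong_sets)
    from measurable_compose[OF Tm this] show ?thesis .
  qed
  have aeP: "AE x in P. \<forall>k\<in>I. \<bar>x k\<bar> \<le> R" unfolding P_def by (rule AE_PiM_slab[OF I(1)])
  have aeQ: "AE x in Q. \<forall>k\<in>J. \<bar>x k\<bar> \<le> R" unfolding Q_def by (rule AE_PiM_slab[OF IJ(2)])
  have B0: "B \<ge> 0" using B[of "\<lambda>_. 0"] R by auto
  have int: "integrable P (\<lambda>x. - w' x * T x j)"
  proof (rule P.integrable_const_bound[where B = "B * R"])
    show "AE x in P. norm (- w' x * T x j) \<le> B * R"
      using aeP AE_space
    proof eventually_elim
      fix x assume "\<forall>k\<in>I. \<bar>x k\<bar> \<le> R" "x \<in> space P"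
      then show "norm (- w' x * T x j) \<le> B * R"
        using B[of x] rg[of x] B0 R by (auto simp: abs_mult intro!: mult_mono)
    qed
  qed measurable
  then show "integrable (PiM I (\<lambda>_. slab R)) (\<lambda>x. - w' x * T x j)" by (simp add: P_def)
  \<comment> \<open>The inner integral over the coordinate \<open>j\<close>; a uniform bound makes
    it integrable over the other coordinates.\<close>
  define \<kappa> where "\<kappa> x = (\<integral>s. - w' (x(j := s)) * T (x(j := s)) j \<partial>slab R)" for x
  have int': "integrable (PiM (insert j J) (\<lambda>_. slab R)) (\<lambda>x. - w' x * T x j)"
    using int IJ(1) by (simp add: P_def)
  have sp: "x(j := s) \<in> space P" if "x \<in> space Q" for x s
    using that by (auto simp: P_def Q_def IJ(1) PiE_def extensional_def)
  have \<kappa>i: "integrable Q \<kappa>"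
  proof (rule Q.integrable_const_bound[where B = "B * R * (2 * R)"])
    have "(\<lambda>(x, s). x(j := s)) \<in> Q \<Otimes>\<^sub>M slab R \<rightarrow>\<^sub>M P"
      unfolding P_def Q_def IJ(1) by (rule measurable_add_dim)
    from measurable_compose[OF this, of "\<lambda>x. - w' x * T x j" borel]
    have [measurable]: "(\<lambda>z. - w' ((fst z)(j := snd z)) * T ((fst z)(j := snd z)) j) \<in> borel_measurable (Q \<Otimes>\<^sub>M slab R)"
      by (simp add: case_prod_beta)
    interpret sl: finite_measure "slab R" by (rule finite_measure_slab)
    show "\<kappa> \<in> borel_measurable Q" unfolding \<kappa>_def by measurable
    show "AE x in Q. norm (\<kappa> x) \<le> B * R * (2 * R)"
      using aeQ AE_space
    proof eventually_elim
      fix x assume x: "\<forall>k\<in>J. \<bar>x k\<bar> \<le> R" "x \<in> space Q"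
      have upd: "(\<lambda>s. x(j := s)) \<in> borel \<rightarrow>\<^sub>M P"
        using measurable_component_update[of x J "\<lambda>_. slab R" j] x(2) IJ by (simp add: P_def Q_def cong: measurable_cong_sets)
      have bd: "\<bar>- w' (x(j := s)) * T (x(j := s)) j\<bar> \<le> B * R" if "s \<in> {-R..R}" for s
      proof -
        have box: "\<forall>k\<in>I. \<bar>(x(j := s)) k\<bar> \<le> R" using x(1) that by (auto simp: IJ(1) abs_le_iff)
        have "\<bar>w' (x(j := s))\<bar> \<le> B" by (rule B[OF box])
        moreover have "\<bar>T (x(j := s)) j\<bar> \<le> R" using rg[OF sp[OF x(2)] box] by (rule conjunct1)
        ultimately show ?thesis using B0 R by (simp only: abs_mult abs_minus_cancel mult_mono abs_ge_zero)
      qed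
      have m: "(\<lambda>s. - w' (x(j := s)) * T (x(j := s)) j) \<in> borel_measurable borel"
        by (rule measurable_compose[OF upd, of "\<lambda>x. - w' x * T x j"]) measurable
      have i: "integrable (slab R) (\<lambda>s. - w' (x(j := s)) * T (x(j := s)) j)"
        by (rule integrable_slab_bounded[OF m bd])
      have "norm (\<kappa> x) \<le> (\<integral>s. norm (- w' (x(j := s)) * T (x(j := s)) j) \<partial>slab R)"
        unfolding \<kappa>_def by (rule integral_norm_bound)
      also have "\<dots> \<le> (\<integral>s. B * R \<partial>slab R)"
        using AE_slab[of R] bd by (intro integral_mono_AE integrable_norm i) auto
      also have "\<dots> = B * R * (2 * R)" using emeasure_slab[of R] R by (simp add: measure_def)
      finally show "norm (\<kappa> x) \<le> B * R * (2 * R)" .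
    qed
  qed
  have \<kappa>: "(\<integral>x. - w' x * T x j \<partial>P) = (\<integral>x. \<kappa> x \<partial>Q)"
    using product_integral_insert[OF IJ(2,3) int'] by (simp add: P_def Q_def \<kappa>_def IJ(1))
  have key: "AE x in Q. (\<integral>\<^sup>+s. ennreal (w (x(j := s)) * d j (x(j := s))) \<partial>slab R) \<le> ennreal (2 * R * c + \<kappa> x)
      \<and> 0 \<le> 2 * R * c + \<kappa> x"
    using aeQ AE_space
  proof eventually_elim
    fix x assume x: "\<forall>k\<in>J. \<bar>x k\<bar> \<le> R" "x \<in> space Q"
    have upd: "(\<lambda>s. x(j := s)) \<in> borel \<rightarrow>\<^sub>M P"
      using measurable_component_update[of x J "\<lambda>_. slab R" j] x(2) IJ by (simp add: P_def Q_def cong: measurable_cong_sets)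
    have box: "\<forall>k\<in>I. \<bar>(x(j := s)) k\<bar> \<le> R" if "s \<in> {-R..R}" for s
      using x(1) that by (auto simp: IJ(1) abs_le_iff)
    have r: "\<bar>T (x(j := s)) j\<bar> \<le> R \<and> 0 < d j (x(j := s))" if "s \<in> {-R..R}" for s
      by (rule rg[OF sp[OF x(2)] box[OF that]])
    have d2: "continuous_on {-R..R} (\<lambda>s. T (x(j := s)) j)"
       "\<And>s. s \<in> {-R<..<R} \<Longrightarrow> ((\<lambda>s. T (x(j := s)) j) has_real_derivative d j (x(j := s))) (at s)"
      using der[OF sp[OF x(2), of 0]] by simp_all
    show "(\<integral>\<^sup>+s. ennreal (w (x(j := s)) * d j (x(j := s))) \<partial>slab R) \<le> ennreal (2 * R * c + \<kappa> x)
      \<and> 0 \<le> 2 * R * c + \<kappa> x"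
      unfolding \<kappa>_def
      by (intro conjI slab_by_parts[OF R w w'c bdry w0 _ d2] measurable_compose[OF upd Tjm] measurable_compose[OF upd dm])
        (use r in \<open>auto simp: less_imp_le\<close>)
  qed
  have "(\<integral>\<^sup>+x. ennreal (w x * d j x) \<partial>P) = (\<integral>\<^sup>+x. (\<integral>\<^sup>+s. ennreal (w (x(j := s)) * d j (x(j := s))) \<partial>slab R) \<partial>Q)"
    unfolding P_def Q_def IJ(1)
    by (rule product_nn_integral_insert[OF IJ(2,3)]) (fold IJ(1), fold P_def, measurable)
  also have "\<dots> \<le> (\<integral>\<^sup>+x. ennreal (2 * R * c + \<kappa> x) \<partial>Q)"
    using key by (intro nn_integral_mono_AE) auto
  also have "\<dots> = ennreal (\<integral>x. 2 * R * c + \<kappa> x \<partial>Q)"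
    using key by (intro nn_integral_eq_integral) (auto intro!: \<kappa>i)
  \<comment> \<open>The boundary term 2 R c is integrated over the coordinates in \<open>J\<close>;
    since \<open>card I = Suc (card J)\<close>, the powers of 2R combine to
    \<open>card I\<close>.\<close>
  also have eq: "(\<integral>x. 2 * R * c + \<kappa> x \<partial>Q) = c * (2 * R) ^ card I + (\<integral>x. - w' x * T x j \<partial>P)"
  proof -
    have "card I = Suc (card J)" using IJ by simp
    moreover have "(\<integral>x. 2 * R * c + \<kappa> x \<partial>Q) = 2 * R * c * (2 * R) ^ card J + (\<integral>x. \<kappa> x \<partial>Q)"
      using \<kappa>i R measure_PiM_slab[OF IJ(2), of R] by (subst Bochner_Integration.integral_add[OF Q.integrable_const \<kappa>i]) (simp add: Q_def)
    ultimately show ?thesis unfolding \<kappa> by simp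
  qed
  finally show "(\<integral>\<^sup>+x. ennreal (w x * d j x) \<partial>PiM I (\<lambda>_. slab R))
      \<le> ennreal (c * (2 * R) ^ card I + (\<integral>x. - w' x * T x j \<partial>PiM I (\<lambda>_. slab R)))" by (simp add: P_def)
  show "0 \<le> c * (2 * R) ^ card I + (\<integral>x. - w' x * T x j \<partial>PiM I (\<lambda>_. slab R))"
    unfolding P_def[symmetric] eq[symmetric] using key by (intro integral_nonneg_AE) auto
qed

section \<open>The inequality for smooth functions: on a cube, with compact support, and in
  general\<close>

lemma has_real_derivative_line:
  fixes f :: "'a::real_normed_vector \<Rightarrow> real"
  assumes "\<And>x. ((\<lambda>s. f (x + s *\<^sub>R b)) has_real_derivative D x) (at 0)"
  shows "((\<lambda>s. f (x + s *\<^sub>R b)) has_real_derivative D (x + t *\<^sub>R b)) (at t)"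
proof -
  have "((\<lambda>s. f ((x + t *\<^sub>R b) + (s - t) *\<^sub>R b)) has_real_derivative D (x + t *\<^sub>R b) * 1) (at t)"
    by (rule DERIV_chain2[where g = "\<lambda>s. s - t" and f = "\<lambda>s. f ((x + t *\<^sub>R b) + s *\<^sub>R b)"])
      (use assms in \<open>auto intro!: derivative_eq_intros\<close>)
  then show ?thesis by (simp add: algebra_simps)
qed

text \<open>The inequality of arithmetic and geometric means bounds the N-th root of the Jacobian by
  the mean of the diagonal derivatives \<open>d j\<close>. After multiplication by
  \<open>F0 powr (1 - 1 / N)\<close>, which is \<open>w = a powr r\<close>, the integral is treated
  by parts in each coordinate and then by Hoelder. The push-forward evaluates both the left side and
  the Hoelder factor containing the map.\<close>

lemma box_sobolev:
  fixes f G :: "'a::euclidean_space \<Rightarrow> real" and D :: "'a \<Rightarrow> 'a" and p R \<delta> C :: real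
  defines "N \<equiv> real DIM('a)"
  defines "q \<equiv> p / (p - 1)" and "ps \<equiv> N * p / (N - p)" and "r \<equiv> p * (N - 1) / (N - p)"
  defines "bi \<equiv> \<lambda>h :: 'a \<Rightarrow> real. \<integral>y. h y * indicator (sym_box R) y \<partial>lborel"
  defines "m \<equiv> bi (\<lambda>y. (f y + \<delta>) powr ps)" and "M \<equiv> bi G"
  assumes p: "1 < p" "p < N" and R: "R > 0" and \<delta>: "\<delta> > 0"
    and f: "continuous_on UNIV f" "\<And>x. 0 \<le> f x" and D: "continuous_on UNIV D"
    and der: "\<And>x b. b \<in> Basis \<Longrightarrow> ((\<lambda>s. f (x + s *\<^sub>R b)) has_real_derivative D x \<bullet> b) (at 0)"
    and supp: "\<And>x b. b \<in> Basis \<Longrightarrow> R \<le> \<bar>x \<bullet> b\<bar> \<Longrightarrow> f x = 0"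
    and G: "continuous_on UNIV G" "\<And>x. 0 < G x" "\<And>x. G x \<le> C"
  shows "m / M * bi (\<lambda>y. G y powr (1 - 1 / N)) \<le> (m / M) powr (1 / N) * (1 / N) *
    (N * (\<delta> powr r * (2 * R) ^ DIM('a)) +
     r * (bi (\<lambda>y. norm (D y) powr p) powr (1 / p) * (m / M * bi (\<lambda>y. G y * norm y powr q)) powr (1 / q)))"
proof -
  define P where "P = PiM (Basis :: 'a set) (\<lambda>_. slab R)"
  interpret P: finite_measure P unfolding P_def by (simp add: finite_measure_PiM_slab)
  have N: "N > 1" "N - p > 0" using p by auto
  have q: "q > 1" "1 / p + 1 / q = 1" using p by (auto simp: q_def field_simps)
  have "N * 1 \<le> N * p" using p N by (intro mult_left_mono) auto
  then have "N - p \<le> N * p" using p by linarith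
  then have ps: "ps > 0" "ps \<ge> 1" using p N by (auto simp: ps_def)
  have r1: "r - 1 = N * (p - 1) / (N - p)" using p N by (simp add: r_def field_simps)
  have "(r - 1) * q = ps" unfolding r1 q_def ps_def using p N by (simp add: ac_simps)
  \<comment> \<open>The two identities behind the exponent \<open>r\<close>: the power 1 - 1/N of
    the source density is the r-th power of \<open>a\<close>, and raising
    \<open>a powr (r - 1)\<close> to the power \<open>q\<close> in Hoelder's inequality gives back
    the source density.\<close>
  then have r: "r > 0" "r = ps * (1 - 1 / N)" "(r - 1) * q = ps"
    using p N by (simp_all add: r_def ps_def) (simp add: field_simps)
  have fb [measurable]: "f \<in> borel_measurable borel" "D \<in> borel_measurable borel" "G \<in> borel_measurable borel"
    using f(1) D G(1) borel_measurable_continuous_onI by auto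
  have cD: "continuous_on UNIV (\<lambda>y. norm (D y) powr p)"
    using p by (intro continuous_on_powr' continuous_intros D) auto
  have cof: "continuous_on UNIV (\<lambda>s. of_coords (x(j := s)) :: 'a)" if "j \<in> Basis" for x j
    using that by (simp add: of_coords_upd) (intro continuous_intros)
  have "bounded (f ` sym_box R)" "bounded (D ` sym_box R)"
    using f(1) D by (auto intro!: compact_imp_bounded compact_continuous_image intro: continuous_on_subset)
  then obtain Cf CD where Cf: "\<And>x. x \<in> sym_box R \<Longrightarrow> norm (f x) \<le> Cf" and CD: "\<And>x. x \<in> sym_box R \<Longrightarrow> norm (D x) \<le> CD"
    unfolding bounded_iff by (metis imageI)
  \<comment> \<open>Outside the cube \<open>f\<close> vanishes, so the bound on the cube is global,
    as \<open>box_density\<close> demands.\<close>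
  have Cf': "f x \<le> max Cf 0" for x
  proof (cases "x \<in> sym_box R")
    case True
    then show ?thesis using Cf[OF True] f(2)[of x] by auto
  next
    case False
    then obtain b where "b \<in> Basis" "R \<le> \<bar>x \<bullet> b\<bar>" unfolding mem_sym_box by force
    then show ?thesis using supp by simp
  qed
  have CD0: "CD \<ge> 0" using CD[of 0] R by (simp add: mem_sym_box) (metis norm_ge_zero order_trans)
  define a where "a x = f (of_coords x) + \<delta>" for x
  have a: "a x > 0" for x using f(2) \<delta> by (simp add: a_def add_nonneg_pos)
  have am [measurable]: "a \<in> borel_measurable (PiM Basis (\<lambda>_. borel))"
    unfolding a_def[abs_def] by measurable
  have ca: "continuous_on UNIV (\<lambda>s. a (x(j := s)))" if "j \<in> Basis" for x j
    unfolding a_def by (intro continuous_intros continuous_on_compose2[OF f(1) cof[OF that]]) auto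
  define F0 where "F0 x = a x powr ps" for x
  define G0 where "G0 x = G (of_coords x)" for x
  define w where "w x = a x powr r" for x
  define w' where "w' j x = r * a x powr (r - 1) * (D (of_coords x) \<bullet> j)" for j x
  have setsP [measurable_cong]: "sets P = sets (PiM Basis (\<lambda>_. borel))" by (simp add: P_def)
  have F0d: "box_density Basis F0"
    unfolding box_density_def
  proof (intro conjI allI ballI)
    show "F0 \<in> borel_measurable (PiM Basis (\<lambda>_. borel))" unfolding F0_def[abs_def] by measurable
    show "0 < F0 x" for x using a[of x] by (simp add: F0_def)
    show "\<exists>C. \<forall>x. F0 x \<le> C"
      using Cf' a ps by (intro exI[of _ "(max Cf 0 + \<delta>) powr ps"]) (auto simp: F0_def a_def less_imp_le intro!: powr_mono2)
    show "continuous_on UNIV (\<lambda>s. F0 (x(j := s)))" if "j \<in> Basis" for x j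
      unfolding F0_def by (intro continuous_on_powr ca[OF that] continuous_on_const) (use a in \<open>auto simp: less_imp_neq[symmetric]\<close>)
  qed
  have G0d: "box_density Basis G0"
    unfolding box_density_def
  proof (intro conjI allI ballI)
    show "G0 \<in> borel_measurable (PiM Basis (\<lambda>_. borel))" unfolding G0_def[abs_def] by measurable
    show "continuous_on UNIV (\<lambda>s. G0 (x(j := s)))" if "j \<in> Basis" for x j
      unfolding G0_def by (rule continuous_on_compose2[OF G(1) cof[OF that]]) auto
  qed (use G in \<open>auto simp: G0_def\<close>)
  have mP: "(\<integral>x. F0 x \<partial>P) = m"
    unfolding m_def bi_def F0_def a_def P_def
    by (rule integral_box) (use f \<delta> in \<open>auto intro!: continuous_intros simp: add_nonneg_eq_0_iff\<close>)
  have MP: "(\<integral>x. G0 x \<partial>P) = M"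
    unfolding M_def bi_def G0_def P_def by (rule integral_box) (use G in \<open>auto simp: less_imp_le\<close>)
  have pos_int: "(\<integral>x. H x \<partial>P) > 0" if H: "box_density Basis H" for H
  proof -
    obtain C where C: "\<And>x. H x \<le> C" and pos: "\<And>x. 0 < H x" and [measurable]: "H \<in> borel_measurable P"
      using H unfolding box_density_def by (auto cong: measurable_cong_sets simp: setsP)
    have int: "integrable P H"
      by (rule P.integrable_const_bound[where B = C]) (use C pos in \<open>auto simp: abs_of_pos\<close>)
    have "\<not> (AE x in P. H x = 0)"
    proof
      assume "AE x in P. H x = 0"
      then have "AE x in P. False"
        by eventually_elim (use pos in \<open>auto simp: less_le\<close>)
      then have "measure P (space P) = 0"
        by (simp add: AE_iff_measurable[OF _ refl] measure_def)
      then show False using measure_PiM_slab[of "Basis :: 'a set" R] R by (simp add: P_def)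
    qed
    then show ?thesis
      using integral_nonneg_eq_0_iff_AE[OF int] pos integral_nonneg_AE[of H P] by (auto simp: less_le)
  qed
  have mpos: "m > 0" and Mpos: "M > 0" using pos_int[OF F0d] pos_int[OF G0d] mP MP by auto
  obtain T d where tr: "box_transport Basis R F0 G0 T d"
    using box_transport_exists[OF finite_Basis F0d G0d R] by blast
  then have Tm [measurable]: "T \<in> P \<rightarrow>\<^sub>M P" and dm: "\<And>j. j \<in> Basis \<Longrightarrow> d j \<in> borel_measurable P"
    and push: "\<And>\<phi>. \<phi> \<in> borel_measurable P \<Longrightarrow> (\<integral>\<^sup>+x. ennreal (F0 x) * \<phi> (T x) \<partial>P) =
        (\<integral>\<^sup>+y. ennreal (G0 y) * \<phi> y \<partial>P) * ennreal (m / M)"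
    and rg: "\<And>x j. x \<in> space P \<Longrightarrow> \<forall>j\<in>Basis. \<bar>x j\<bar> \<le> R \<Longrightarrow> j \<in> Basis \<Longrightarrow> \<bar>T x j\<bar> \<le> R \<and> 0 < d j x"
    and jac: "\<And>x. x \<in> space P \<Longrightarrow> (\<Prod>j\<in>Basis. d j x) * G0 (T x) * m = F0 x * M"
    unfolding box_transport_def Let_def P_def[symmetric] mP MP by blast+
  have aeP: "AE x in P. \<forall>k\<in>Basis. \<bar>x k\<bar> \<le> R" unfolding P_def by (rule AE_PiM_slab) simp
  define c0 where "c0 = (m / M) powr (1 / N) * (1 / N)"
  have c0: "c0 \<ge> 0" using N by (simp add: c0_def)
  \<comment> \<open>The Jacobian equation reads \<open>K = F0 x * (M / m) / G0 (T x)\<close>; taking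
    N-th roots leaves a constant factor, which is collected in \<open>c0\<close>.\<close>
  have amgm: "AE x in P. F0 x * G0 (T x) powr (- 1 / N) \<le> c0 * (\<Sum>j\<in>Basis. w x * d j x)"
    using aeP AE_space
  proof eventually_elim
    fix x assume x: "\<forall>k\<in>Basis. \<bar>x k\<bar> \<le> R" "x \<in> space P"
    define K where "K = (\<Prod>j\<in>Basis. d j x)"
    have g: "G0 (T x) > 0" using G by (simp add: G0_def)
    have F: "F0 x > 0" using a[of x] by (simp add: F0_def)
    have K: "K = F0 x * (M / m) / G0 (T x)"
      using jac[OF x(2)] g mpos by (simp add: K_def field_simps)
    have k1: "K powr (1 / N) = F0 x powr (1 / N) * (M / m) powr (1 / N) * G0 (T x) powr (- 1 / N)"
      unfolding K using F g mpos Mpos by (simp add: powr_divide powr_mult powr_minus_divide)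
    have k2: "(m / M) powr (1 / N) * (M / m) powr (1 / N) = 1"
      using mpos Mpos by (subst powr_mult[symmetric]) simp_all
    have k3: "F0 x powr (1 - 1 / N) * F0 x powr (1 / N) = F0 x"
      using F by (subst powr_add[symmetric]) simp
    have "F0 x powr (1 - 1 / N) * (m / M) powr (1 / N) * K powr (1 / N) =
        (F0 x powr (1 - 1 / N) * F0 x powr (1 / N)) * ((m / M) powr (1 / N) * (M / m) powr (1 / N)) * G0 (T x) powr (- 1 / N)"
      unfolding k1 by (simp only: ac_simps)
    then have "F0 x * G0 (T x) powr (- 1 / N) = F0 x powr (1 - 1 / N) * (m / M) powr (1 / N) * K powr (1 / N)"
      unfolding k2 k3 by simp
    also have "F0 x powr (1 - 1 / N) = w x" by (simp add: F0_def w_def powr_powr r(2))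
    also have "w x * (m / M) powr (1 / N) * K powr (1 / N) \<le> w x * (m / M) powr (1 / N) * (\<Sum>j\<in>Basis. d j x / N)"
    proof (rule mult_left_mono)
      show "K powr (1 / N) \<le> (\<Sum>j\<in>Basis. d j x / N)"
        unfolding K_def N_def using arith_geom_mean[of "Basis :: 'a set" "\<lambda>j. d j x"] rg[OF x(2,1)]
        by (auto simp: less_imp_le)
    qed (simp add: w_def)
    also have "\<dots> = c0 * (\<Sum>j\<in>Basis. w x * d j x)"
      by (simp add: c0_def sum_distrib_left sum_divide_distrib ac_simps)
    finally show "F0 x * G0 (T x) powr (- 1 / N) \<le> c0 * (\<Sum>j\<in>Basis. w x * d j x)" .
  qed
  have bp: "integrable P (\<lambda>x. - w' j x * T x j)"
    "(\<integral>\<^sup>+x. ennreal (w x * d j x) \<partial>P) \<le> ennreal (\<delta> powr r * (2 * R) ^ DIM('a) + (\<integral>x. - w' j x * T x j \<partial>P))"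
    "0 \<le> \<delta> powr r * (2 * R) ^ DIM('a) + (\<integral>x. - w' j x * T x j \<partial>P)" if j: "j \<in> Basis" for j
  proof -
    have d: "((\<lambda>s. w (x(j := s))) has_real_derivative w' j (x(j := s))) (at s)" for x s
    proof -
      have "((\<lambda>s. f (of_coords (x(j := 0)) + s *\<^sub>R j)) has_real_derivative D (of_coords (x(j := 0)) + s *\<^sub>R j) \<bullet> j) (at s)"
        by (rule has_real_derivative_line[OF der[OF j]])
      moreover have "of_coords (x(j := 0)) + s *\<^sub>R j = of_coords (x(j := s))" for s
        using j by (simp add: of_coords_upd algebra_simps)
      ultimately have "((\<lambda>s. a (x(j := s))) has_real_derivative D (of_coords (x(j := s))) \<bullet> j) (at s)"
        by (auto simp: a_def intro!: derivative_eq_intros)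
      then show ?thesis unfolding w_def w'_def using a
        by (auto intro!: derivative_eq_intros simp: powr_diff field_simps)
    qed
    have c: "continuous_on UNIV (\<lambda>s. w' j (x(j := s)))" for x
      unfolding w'_def
      by (intro continuous_intros ca[OF j] continuous_on_compose2[OF D cof[OF j]]) (use a in \<open>auto simp: less_imp_neq[symmetric]\<close>)
    have bd: "\<bar>w' j x\<bar> \<le> r * (max Cf 0 + \<delta>) powr (r - 1) * CD" if "\<forall>k\<in>Basis. \<bar>x k\<bar> \<le> R" for x
    proof -
      have "of_coords x \<in> (sym_box R :: 'a set)" using that by (simp add: mem_sym_box)
      then have "\<bar>D (of_coords x) \<bullet> j\<bar> \<le> CD" using CD Basis_le_norm[OF j] order_trans by blast
      moreover have "r - 1 \<ge> 0" using r(3) q ps by (metis less_imp_le mult_neg_pos not_less order_less_trans zero_less_one)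
      then have "a x powr (r - 1) \<le> (max Cf 0 + \<delta>) powr (r - 1)"
        using a[of x] Cf'[of "of_coords x"] by (intro powr_mono2) (auto simp: a_def)
      ultimately show ?thesis unfolding w'_def abs_mult using r(1) CD0 by (intro mult_mono) auto
    qed
    have m: "w \<in> borel_measurable (PiM Basis (\<lambda>_. borel))" "w' j \<in> borel_measurable (PiM Basis (\<lambda>_. borel))"
      unfolding w_def[abs_def] w'_def[abs_def] by measurable
    have b: "w (x(j := R)) = \<delta> powr r" "w (x(j := - R)) = \<delta> powr r" for x
    proof -
      have "f (of_coords (x(j := R))) = 0" "f (of_coords (x(j := - R))) = 0"
        using j R by (auto intro!: supp[OF j])
      then show "w (x(j := R)) = \<delta> powr r" "w (x(j := - R)) = \<delta> powr r" by (simp_all add: w_def a_def)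
    qed
    note * = box_by_parts[OF R finite_Basis j tr m d c _ b bd]
    show "integrable P (\<lambda>x. - w' j x * T x j)"
      "(\<integral>\<^sup>+x. ennreal (w x * d j x) \<partial>P) \<le> ennreal (\<delta> powr r * (2 * R) ^ DIM('a) + (\<integral>x. - w' j x * T x j \<partial>P))"
      "0 \<le> \<delta> powr r * (2 * R) ^ DIM('a) + (\<integral>x. - w' j x * T x j \<partial>P)"
      unfolding P_def by (rule *; simp add: w_def)+
  qed
  \<comment> \<open>The Hoelder partner of the gradient. Its q-th power is \<open>F0\<close> times a
    function of \<open>T x\<close>, so the push-forward computes its integral.\<close>
  define V where "V x = a x powr (r - 1) * norm (of_coords (T x) :: 'a)" for x
  have Tc [measurable]: "(\<lambda>x. of_coords (T x) :: 'a) \<in> borel_measurable P"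
  proof -
    have "of_coords \<in> P \<rightarrow>\<^sub>M (borel :: 'a measure)" using measurable_of_coords measurable_cong_sets[OF setsP refl] by blast
    from measurable_compose[OF Tm this] show ?thesis .
  qed
  have Vm [measurable]: "V \<in> borel_measurable P" unfolding V_def[abs_def] by measurable
  have Vq: "V x powr q = F0 x * norm (of_coords (T x) :: 'a) powr q" for x
    using a[of x] by (simp add: V_def F0_def powr_mult powr_powr r(3))
  have cGq: "continuous_on UNIV (\<lambda>y. G y * norm y powr q)"
    using q(1) by (intro continuous_intros G continuous_on_powr') auto
  have nV: "(\<integral>\<^sup>+x. ennreal (V x powr q) \<partial>P) = ennreal (m / M * bi (\<lambda>y. G y * norm y powr q))"
  proof -
    have [measurable]: "(\<lambda>y. norm (of_coords y :: 'a) powr q) \<in> borel_measurable P" by measurable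
    have "(\<integral>\<^sup>+x. ennreal (V x powr q) \<partial>P) = (\<integral>\<^sup>+x. ennreal (F0 x) * ennreal (norm (of_coords (T x) :: 'a) powr q) \<partial>P)"
      unfolding Vq by (intro nn_integral_cong) (simp add: F0_def ennreal_mult)
    also have "\<dots> = (\<integral>\<^sup>+y. ennreal (G0 y) * ennreal (norm (of_coords y :: 'a) powr q) \<partial>P) * ennreal (m / M)"
      by (rule push) measurable
    also have "(\<integral>\<^sup>+y. ennreal (G0 y) * ennreal (norm (of_coords y :: 'a) powr q) \<partial>P) = ennreal (bi (\<lambda>y. G y * norm y powr q))"
      unfolding bi_def P_def
      by (subst integral_box(4)[symmetric, OF cGq]) (use G in \<open>auto simp: G0_def less_imp_le ennreal_mult intro!: nn_integral_cong\<close>)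
    finally show ?thesis using mpos Mpos by (subst ennreal_mult') (simp_all add: mult.commute)
  qed
  have intV: "integrable P (\<lambda>x. V x powr q)"
    using nV by (intro integrableI_nonneg) auto
  have Vval: "(\<integral>x. V x powr q \<partial>P) = m / M * bi (\<lambda>y. G y * norm y powr q)"
  proof -
    have "0 \<le> bi (\<lambda>y. G y * norm y powr q)" unfolding bi_def using G by (intro integral_nonneg_AE) (auto simp: less_imp_le)
    then show ?thesis using nn_integral_eq_integral[OF intV] nV mpos Mpos by (simp add: integral_nonneg_AE)
  qed
  have intD: "integrable P (\<lambda>x. norm (D (of_coords x)) powr p)"
    "(\<integral>x. norm (D (of_coords x)) powr p \<partial>P) = bi (\<lambda>y. norm (D y) powr p)"
    unfolding P_def bi_def using integral_box[OF cD] by simp_all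
  have H: "integrable P (\<lambda>x. norm (D (of_coords x)) * V x)"
    "(\<integral>x. norm (D (of_coords x)) * V x \<partial>P) \<le> bi (\<lambda>y. norm (D y) powr p) powr (1 / p) * (m / M * bi (\<lambda>y. G y * norm y powr q)) powr (1 / q)"
    using Hoelder_integral[OF p(1) q, of "\<lambda>x. norm (D (of_coords x))" P V] intD intV Vval
    by (auto simp: V_def)
  define E where "E = N * (\<delta> powr r * (2 * R) ^ DIM('a)) + r * (bi (\<lambda>y. norm (D y) powr p) powr (1 / p) * (m / M * bi (\<lambda>y. G y * norm y powr q)) powr (1 / q))"
  have sumint: "(\<Sum>j\<in>Basis. (\<integral>x. - w' j x * T x j \<partial>P)) \<le> r * (\<integral>x. norm (D (of_coords x)) * V x \<partial>P)"
  proof -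
    have "(\<Sum>j\<in>Basis. (\<integral>x. - w' j x * T x j \<partial>P)) = (\<integral>x. (\<Sum>j\<in>Basis. - w' j x * T x j) \<partial>P)"
      using bp(1) by (intro Bochner_Integration.integral_sum[symmetric]) auto
    also have "\<dots> \<le> (\<integral>x. r * (norm (D (of_coords x)) * V x) \<partial>P)"
    proof (rule integral_mono)
      fix x
      have "(\<Sum>j\<in>Basis. - w' j x * T x j) = - (r * a x powr (r - 1)) * (D (of_coords x) \<bullet> of_coords (T x))"
        by (subst euclidean_inner) (simp add: w'_def sum_distrib_left sum_negf ac_simps)
      also have "\<dots> \<le> (r * a x powr (r - 1)) * (norm (D (of_coords x)) * norm (of_coords (T x) :: 'a))"
      proof -
        have "- (D (of_coords x) \<bullet> of_coords (T x)) \<le> norm (D (of_coords x)) * norm (of_coords (T x) :: 'a)"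
          using Cauchy_Schwarz_ineq2[of "D (of_coords x)" "of_coords (T x)"] by (simp add: abs_le_iff)
        moreover have "0 \<le> r * a x powr (r - 1)" using r(1) by simp
        ultimately have "(r * a x powr (r - 1)) * - (D (of_coords x) \<bullet> of_coords (T x)) \<le>
          (r * a x powr (r - 1)) * (norm (D (of_coords x)) * norm (of_coords (T x) :: 'a))"
          by (rule mult_left_mono)
        then show ?thesis by simp
      qed
      finally show "(\<Sum>j\<in>Basis. - w' j x * T x j) \<le> r * (norm (D (of_coords x)) * V x)"
        by (simp add: V_def ac_simps)
    qed (use bp(1) H(1) in \<open>auto intro!: Bochner_Integration.integrable_sum\<close>)
    finally show ?thesis by simp
  qed
  have E: "(\<Sum>j\<in>Basis. \<delta> powr r * (2 * R) ^ DIM('a) + (\<integral>x. - w' j x * T x j \<partial>P)) \<le> E"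
  proof -
    have "r * (\<integral>x. norm (D (of_coords x)) * V x \<partial>P) \<le> r * (bi (\<lambda>y. norm (D y) powr p) powr (1 / p) * (m / M * bi (\<lambda>y. G y * norm y powr q)) powr (1 / q))"
      using H(2) r(1) by (intro mult_left_mono) auto
    then show ?thesis using sumint by (simp add: sum.distrib sum_subtractf sum_negf E_def N_def)
  qed
  have cJ: "continuous_on UNIV (\<lambda>y. G y powr (1 - 1 / N))"
    using G by (intro continuous_on_powr continuous_intros) (auto simp: less_imp_neq[symmetric])
  \<comment> \<open>\<open>F0\<close> times the power -1/N of \<open>G0\<close> at the image point
    is pushed forward to \<open>G powr (1 - 1 / N)\<close>.\<close>
  have "ennreal (m / M * bi (\<lambda>y. G y powr (1 - 1 / N))) = (\<integral>\<^sup>+x. ennreal (F0 x) * ennreal (G0 (T x) powr (- 1 / N)) \<partial>P)"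
  proof -
    have [measurable]: "(\<lambda>y. G0 y powr (- 1 / N)) \<in> borel_measurable P" unfolding G0_def by measurable
    have "(\<integral>\<^sup>+x. ennreal (F0 x) * ennreal (G0 (T x) powr (- 1 / N)) \<partial>P) = (\<integral>\<^sup>+y. ennreal (G0 y) * ennreal (G0 y powr (- 1 / N)) \<partial>P) * ennreal (m / M)"
      by (rule push) measurable
    also have "(\<integral>\<^sup>+y. ennreal (G0 y) * ennreal (G0 y powr (- 1 / N)) \<partial>P) = (\<integral>\<^sup>+y. ennreal (G (of_coords y) powr (1 - 1 / N)) \<partial>P)"
    proof (rule nn_integral_cong)
      fix y
      have "G (of_coords y) powr (1 - 1 / N) = G (of_coords y) powr 1 * G (of_coords y) powr (- 1 / N)"
        by (subst powr_add[symmetric]) simp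
      then show "ennreal (G0 y) * ennreal (G0 y powr (- 1 / N)) = ennreal (G (of_coords y) powr (1 - 1 / N))"
        using G(2)[of "of_coords y"] by (simp add: G0_def ennreal_mult less_imp_le)
    qed
    also have "\<dots> = ennreal (bi (\<lambda>y. G y powr (1 - 1 / N)))"
      unfolding bi_def P_def by (rule integral_box(4)[OF cJ]) simp
    finally show ?thesis using mpos Mpos by (subst ennreal_mult') (simp_all add: mult.commute)
  qed
  also have "\<dots> \<le> (\<integral>\<^sup>+x. ennreal c0 * (\<Sum>j\<in>Basis. ennreal (w x * d j x)) \<partial>P)"
  proof (rule nn_integral_mono_AE)
    show "AE x in P. ennreal (F0 x) * ennreal (G0 (T x) powr (- 1 / N)) \<le> ennreal c0 * (\<Sum>j\<in>Basis. ennreal (w x * d j x))"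
      using amgm aeP AE_space
    proof eventually_elim
      fix x assume x: "F0 x * G0 (T x) powr (- 1 / N) \<le> c0 * (\<Sum>j\<in>Basis. w x * d j x)" "\<forall>k\<in>Basis. \<bar>x k\<bar> \<le> R" "x \<in> space P"
      have "(\<Sum>j\<in>Basis. ennreal (w x * d j x)) = ennreal (\<Sum>j\<in>Basis. w x * d j x)"
        by (rule sum_ennreal) (use rg[OF x(3,2)] in \<open>auto simp: w_def less_imp_le\<close>)
      then show "ennreal (F0 x) * ennreal (G0 (T x) powr (- 1 / N)) \<le> ennreal c0 * (\<Sum>j\<in>Basis. ennreal (w x * d j x))"
        using x(1) c0 by (simp add: F0_def ennreal_leI flip: ennreal_mult' ennreal_mult'')
    qed
  qed
  also have "\<dots> = ennreal c0 * (\<Sum>j\<in>Basis. (\<integral>\<^sup>+x. ennreal (w x * d j x) \<partial>P))"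
  proof -
    have [measurable]: "w \<in> borel_measurable P" unfolding w_def[abs_def] by measurable
    have "(\<lambda>x. ennreal (w x * d j x)) \<in> borel_measurable P" if "j \<in> Basis" for j
      using dm[OF that] by measurable
    then show ?thesis by (subst nn_integral_cmult) (auto simp: nn_integral_sum)
  qed
  also have "\<dots> \<le> ennreal c0 * (\<Sum>j\<in>Basis. ennreal (\<delta> powr r * (2 * R) ^ DIM('a) + (\<integral>x. - w' j x * T x j \<partial>P)))"
    using bp(2) by (intro mult_left_mono sum_mono) auto
  also have "\<dots> = ennreal (c0 * (\<Sum>j\<in>Basis. \<delta> powr r * (2 * R) ^ DIM('a) + (\<integral>x. - w' j x * T x j \<partial>P)))"
    using bp(3) c0 by (subst sum_ennreal) (auto simp: ennreal_mult')
  also have "\<dots> \<le> ennreal (c0 * E)"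
    using E c0 by (intro ennreal_leI mult_left_mono)
  finally have "ennreal (m / M * bi (\<lambda>y. G y powr (1 - 1 / N))) \<le> ennreal (c0 * E)" .
  moreover have "0 \<le> c0 * E"
    using c0 r(1) R N by (auto simp: E_def)
  ultimately show ?thesis
    by (simp add: ennreal_le_iff c0_def E_def)
qed

lemma tendsto_powr_nonneg:
  fixes f :: "'a \<Rightarrow> real"
  assumes "(f \<longlongrightarrow> a) F" "b > 0" "\<And>x. 0 \<le> f x"
  shows "((\<lambda>x. f x powr b) \<longlongrightarrow> a powr b) F"
  by (rule tendsto_powr2[OF assms(1) tendsto_const]) (use assms in auto)

text \<open>The inequality on the cube is divided by a power of the mass ratio
  \<open>t = m / MR\<close> that leaves the exponent 1 - 1/N - 1/q = 1/ps. Then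
  \<open>\<delta>\<close> tends to 0 at fixed R, after which M, I and E replace their truncations by
  monotonicity; only the integral of \<open>G powr (1 - 1 / N)\<close> needs a limit in R.\<close>

lemma sobolev_compact_support:
  fixes f G :: "'a::euclidean_space \<Rightarrow> real" and D :: "'a \<Rightarrow> 'a" and p R0 C :: real
  defines "N \<equiv> real DIM('a)"
  defines "q \<equiv> p / (p - 1)" and "ps \<equiv> N * p / (N - p)" and "r \<equiv> p * (N - 1) / (N - p)"
  assumes p: "1 < p" "p < N"
    and f: "continuous_on UNIV f" "\<And>x. 0 \<le> f x" and D: "continuous_on UNIV D"
    and der: "\<And>x b. b \<in> Basis \<Longrightarrow> ((\<lambda>s. f (x + s *\<^sub>R b)) has_real_derivative D x \<bullet> b) (at 0)"
    and supp: "\<And>x. R0 \<le> norm x \<Longrightarrow> f x = 0" and Dp: "integrable lborel (\<lambda>x. norm (D x) powr p)"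
    and G: "continuous_on UNIV G" "\<And>x. 0 < G x" "\<And>x. G x \<le> C"
    and Gi: "integrable lborel G" "integrable lborel (\<lambda>y. G y powr (1 - 1 / N))" "integrable lborel (\<lambda>y. G y * norm y powr q)"
  shows "N * (\<integral>y. G y powr (1 - 1 / N) \<partial>lborel) * ((\<integral>x. f x powr ps \<partial>lborel) / (\<integral>y. G y \<partial>lborel)) powr (1 / ps)
    \<le> r * ((\<integral>x. norm (D x) powr p \<partial>lborel) powr (1 / p) * (\<integral>y. G y * norm y powr q \<partial>lborel) powr (1 / q))"
proof -
  have N: "N > 1" "N - p > 0" using p by auto
  have q: "q > 1" using p by (auto simp: q_def field_simps)
  have ps: "ps > 0" using p N by (auto simp: ps_def)
  have r: "r > 0" using p N by (auto simp: r_def)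
  have expo: "1 - 1 / N - 1 / q = 1 / ps" using p N by (simp add: q_def ps_def field_simps)
  define A where "A = (\<integral>x. f x powr ps \<partial>lborel)"
  define M where "M = (\<integral>y. G y \<partial>lborel)"
  define J where "J = (\<integral>y. G y powr (1 - 1 / N) \<partial>lborel)"
  define I where "I = (\<integral>y. G y * norm y powr q \<partial>lborel)"
  define E where "E = (\<integral>x. norm (D x) powr p \<partial>lborel)"
  have [measurable]: "f \<in> borel_measurable borel" "G \<in> borel_measurable borel" "D \<in> borel_measurable borel"
    using f(1) G(1) D borel_measurable_continuous_onI by auto
  have nn: "A \<ge> 0" "M \<ge> 0" "J \<ge> 0" "I \<ge> 0" "E \<ge> 0"
    unfolding A_def M_def J_def I_def E_def using G by (auto intro!: integral_nonneg_AE simp: less_imp_le)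
  define bi where "bi R h = (\<integral>y. h y * indicator (sym_box R) y \<partial>lborel)" for R and h :: "'a \<Rightarrow> real"
  have bi_le: "bi R h \<le> (\<integral>y. h y \<partial>lborel)" if "integrable lborel h" "\<And>y. 0 \<le> h y" for R h
    unfolding bi_def using that
    by (intro integral_mono integrable_real_mult_indicator) (auto split: split_indicator)
  have bi_nn: "bi R h \<ge> 0" if "\<And>y. 0 \<le> h y" for R h
    unfolding bi_def using that by (intro integral_nonneg_AE) auto
  show ?thesis unfolding A_def[symmetric] M_def[symmetric] J_def[symmetric] I_def[symmetric] E_def[symmetric]
  proof (cases "A = 0")
    case True
    then show "N * J * (A / M) powr (1 / ps) \<le> r * (E powr (1 / p) * I powr (1 / q))"
      using r nn by simp
  next
    case False
    then have A: "A > 0" using nn by simp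
    have step: "N * bi R (\<lambda>y. G y powr (1 - 1 / N)) * (A / M) powr (1 / ps) \<le> r * (E powr (1 / p) * I powr (1 / q))"
      if R: "R \<ge> R0" "R > 0" for R
    proof -
      define MR where "MR = bi R G"
      define JR where "JR = bi R (\<lambda>y. G y powr (1 - 1 / N))"
      define IR where "IR = bi R (\<lambda>y. G y * norm y powr q)"
      define ER where "ER = bi R (\<lambda>y. norm (D y) powr p)"
      have supp': "f x = 0" if "b \<in> Basis" "R \<le> \<bar>x \<bullet> b\<bar>" for x b
        using that R Basis_le_norm[of b x] by (intro supp) linarith
      have out: "f x = 0" if "x \<notin> sym_box R" for x
        using that supp' unfolding mem_sym_box by force
      have le: "MR \<le> M" "JR \<le> J" "IR \<le> I" "ER \<le> E"
        unfolding MR_def JR_def IR_def ER_def M_def J_def I_def E_def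
        using G Gi Dp by (auto intro!: bi_le simp: less_imp_le)
      have nnR: "MR \<ge> 0" "JR \<ge> 0" "IR \<ge> 0" "ER \<ge> 0"
        unfolding MR_def JR_def IR_def ER_def using G by (auto intro!: bi_nn simp: less_imp_le)
      \<comment> \<open>The mass \<open>m\<close> depends on \<open>\<delta>\<close>, so it is
        replaced by its lower bound \<open>A\<close>: lifting \<open>f\<close> only increases the
        mass. The coefficient of \<open>\<delta> powr r\<close> is then independent of
        \<open>\<delta>\<close>.\<close>
      have box: "N * JR * (A / MR) powr (1 / ps) \<le> N * (\<delta> powr r * (2 * R) ^ DIM('a)) * (A / MR) powr (- 1 / q) + r * (ER powr (1 / p) * IR powr (1 / q))"
        if \<delta>: "\<delta> > 0" for \<delta>
      proof (cases "MR = 0")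
        \<comment> \<open>Division by zero gives zero, so both powers of \<open>A / MR\<close>
          vanish.\<close>
        case True
        then show ?thesis using r nnR ps q by simp
      next
        case False
        then have MR: "MR > 0" using nnR by simp
        define m where "m = bi R (\<lambda>y. (f y + \<delta>) powr ps)"
        have mA: "A \<le> m"
        proof -
          have "continuous_on UNIV (\<lambda>y. (f y + \<delta>) powr ps)"
            using f \<delta> by (intro continuous_on_powr continuous_intros) (auto simp: add_nonneg_eq_0_iff)
          then have i: "integrable lborel (\<lambda>y. (f y + \<delta>) powr ps * indicator (sym_box R) y)"
            by (rule integral_box(3)) simp
          have le: "f x powr ps \<le> (f x + \<delta>) powr ps * indicator (sym_box R) x" for x
            using f(2)[of x] \<delta> ps out[of x] by (auto split: split_indicator intro!: powr_mono2)
          have "integrable lborel (\<lambda>x. f x powr ps)"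
            by (rule Bochner_Integration.integrable_bound[OF i]) (use le in \<open>auto intro: order_trans\<close>)
          then show ?thesis unfolding A_def m_def bi_def by (intro integral_mono i le)
        qed
        define t where "t = m / MR"
        have t: "t > 0" "A / MR \<le> t" "A / MR > 0" using mA A MR by (auto simp: t_def divide_right_mono)
        have "t * JR \<le> t powr (1 / N) * (1 / N) *
            (N * (\<delta> powr r * (2 * R) ^ DIM('a)) + r * (ER powr (1 / p) * (t * IR) powr (1 / q)))"
          using box_sobolev[of p R \<delta> f D G C] p R \<delta> f D der supp' G
          unfolding t_def m_def MR_def JR_def IR_def ER_def bi_def q_def ps_def r_def N_def by simp
        also have "\<dots> = t powr (1 / N + 1 / q) / N *
            (N * (\<delta> powr r * (2 * R) ^ DIM('a)) * t powr (- 1 / q) + r * (ER powr (1 / p) * IR powr (1 / q)))"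
        proof -
          have "(t * IR) powr (1 / q) = t powr (1 / q) * IR powr (1 / q)" using t nnR by (simp add: powr_mult)
          moreover have "t powr (1 / q) * t powr (- 1 / q) = 1" using t by (subst powr_add[symmetric]) simp
          ultimately show ?thesis by (simp add: powr_add algebra_simps)
        qed
        finally have *: "t * JR \<le> \<dots>" .
        have "t = t powr (1 / N + 1 / q) * t powr (1 / ps)"
          using t unfolding expo[symmetric] by (subst powr_add[symmetric]) simp
        then have "t powr (1 / N + 1 / q) * (t powr (1 / ps) * JR) \<le> t powr (1 / N + 1 / q) * ((N * (\<delta> powr r * (2 * R) ^ DIM('a)) * t powr (- 1 / q) + r * (ER powr (1 / p) * IR powr (1 / q))) / N)"
          using * by (simp add: mult.assoc[symmetric])
        then have "t powr (1 / ps) * JR \<le> (N * (\<delta> powr r * (2 * R) ^ DIM('a)) * t powr (- 1 / q) + r * (ER powr (1 / p) * IR powr (1 / q))) / N"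
          using t by (subst (asm) mult_le_cancel_left_pos) simp_all
        then have 1: "N * JR * t powr (1 / ps) \<le> N * (\<delta> powr r * (2 * R) ^ DIM('a)) * t powr (- 1 / q) + r * (ER powr (1 / p) * IR powr (1 / q))"
          using N by (simp add: field_simps)
        have 2: "N * JR * (A / MR) powr (1 / ps) \<le> N * JR * t powr (1 / ps)"
          using t ps N nnR by (intro mult_left_mono powr_mono2) auto
        have 3: "N * (\<delta> powr r * (2 * R) ^ DIM('a)) * t powr (- 1 / q) \<le> N * (\<delta> powr r * (2 * R) ^ DIM('a)) * (A / MR) powr (- 1 / q)"
          using t q N R by (intro mult_left_mono powr_mono2') auto
        show ?thesis using 1 2 3 by linarith
      qed
      have "((\<lambda>\<delta>. \<delta> powr r) \<longlongrightarrow> 0) (at_right 0)"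
        by (rule tendsto_zero_powrI[OF tendsto_ident_at tendsto_const _ r])
          (use eventually_at_right_less[of "0::real"] in \<open>eventually_elim, simp\<close>)
      from tendsto_add[OF tendsto_mult[OF tendsto_mult[OF tendsto_const[of N] tendsto_mult[OF this tendsto_const[of "(2 * R) ^ DIM('a)"]]]
          tendsto_const[of "(A / MR) powr (- 1 / q)"]] tendsto_const[of "r * (ER powr (1 / p) * IR powr (1 / q))"]]
      have "N * JR * (A / MR) powr (1 / ps) \<le> N * (0 * (2 * R) ^ DIM('a)) * (A / MR) powr (- 1 / q) + r * (ER powr (1 / p) * IR powr (1 / q))"
      proof (rule tendsto_lowerbound)
        show "\<forall>\<^sub>F \<delta> in at_right 0. N * JR * (A / MR) powr (1 / ps) \<le>
            N * (\<delta> powr r * (2 * R) ^ DIM('a)) * (A / MR) powr (- 1 / q) + r * (ER powr (1 / p) * IR powr (1 / q))"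
          using eventually_at_right_less[of "0::real"] by eventually_elim (rule box)
      qed simp
      then have "N * JR * (A / MR) powr (1 / ps) \<le> r * (ER powr (1 / p) * IR powr (1 / q))" using r by simp
      also have "\<dots> \<le> r * (E powr (1 / p) * I powr (1 / q))"
        using r le nnR p q by (intro mult_left_mono mult_mono powr_mono2) auto
      finally have fin: "N * JR * (A / MR) powr (1 / ps) \<le> r * (E powr (1 / p) * I powr (1 / q))" .
      show ?thesis
      proof (cases "MR = 0")
        case True
        \<comment> \<open>The two integrands vanish at the same points, so \<open>MR = 0\<close>
          forces \<open>JR = 0\<close>.\<close>
        have "G y * indicator (sym_box R) y = 0 \<Longrightarrow> G y powr (1 - 1 / N) * indicator (sym_box R) y = 0" for y
          by (auto split: split_indicator)
        moreover have "AE y in lborel. G y * indicator (sym_box R) y = 0"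
          using True integral_nonneg_eq_0_iff_AE[OF integral_box(3)[OF G(1), of R]] G by (auto simp: MR_def bi_def less_imp_le)
        ultimately have "AE y in lborel. G y powr (1 - 1 / N) * indicator (sym_box R) y = 0" by auto
        then have "JR = 0" unfolding JR_def bi_def by (rule integral_eq_zero_AE)
        then show ?thesis using r nn by (simp add: JR_def)
      next
        case False
        then have "N * JR * (A / M) powr (1 / ps) \<le> N * JR * (A / MR) powr (1 / ps)"
          using nnR N A le ps by (intro mult_left_mono powr_mono2 divide_left_mono) auto
        then show ?thesis using fin by (simp add: JR_def)
      qed
    qed
    have lim: "(\<lambda>n. bi (real n) (\<lambda>y. G y powr (1 - 1 / N))) \<longlonglongrightarrow> J"
      unfolding bi_def J_def
    proof (rule integral_dominated_convergence[where w = "\<lambda>y. G y powr (1 - 1 / N)"])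
      show "AE y in lborel. (\<lambda>n. G y powr (1 - 1 / N) * indicator (sym_box (real n)) y) \<longlonglongrightarrow> G y powr (1 - 1 / N)"
      proof (rule AE_I2)
        fix y :: 'a
        have "\<forall>\<^sub>F n in sequentially. G y powr (1 - 1 / N) * indicator (sym_box (real n)) y = G y powr (1 - 1 / N)"
          using eventually_ge_at_top[of "nat \<lceil>norm y\<rceil>"]
        proof eventually_elim
          fix n assume "nat \<lceil>norm y\<rceil> \<le> n"
          then have "norm y \<le> real n" by linarith
          then have "y \<in> sym_box (real n)" using Basis_le_norm order_trans by (fastforce simp: mem_sym_box)
          then show "G y powr (1 - 1 / N) * indicator (sym_box (real n)) y = G y powr (1 - 1 / N)" by simp
        qed
        then show "(\<lambda>n. G y powr (1 - 1 / N) * indicator (sym_box (real n)) y) \<longlonglongrightarrow> G y powr (1 - 1 / N)"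
          by (rule tendsto_eventually)
      qed
    qed (use Gi in \<open>auto split: split_indicator\<close>)
    have "(\<lambda>n. N * bi (real n) (\<lambda>y. G y powr (1 - 1 / N)) * (A / M) powr (1 / ps)) \<longlonglongrightarrow> N * J * (A / M) powr (1 / ps)"
      by (intro tendsto_intros lim)
    then show "N * J * (A / M) powr (1 / ps) \<le> r * (E powr (1 / p) * I powr (1 / q))"
    proof (rule tendsto_upperbound)
      show "\<forall>\<^sub>F n in sequentially. N * bi (real n) (\<lambda>y. G y powr (1 - 1 / N)) * (A / M) powr (1 / ps) \<le> r * (E powr (1 / p) * I powr (1 / q))"
        using eventually_ge_at_top[of "nat \<lceil>max R0 1\<rceil>"]
      proof eventually_elim
        fix n assume "nat \<lceil>max R0 1\<rceil> \<le> n"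
        then have "max R0 1 \<le> real n" by linarith
        then show "N * bi (real n) (\<lambda>y. G y powr (1 - 1 / N)) * (A / M) powr (1 / ps) \<le> r * (E powr (1 / p) * I powr (1 / q))"
          by (intro step) auto
      qed
    qed simp
  qed
qed

text \<open>Squaring removes the corner of the positive part; this is the profile of the cutoff
  below, for which one continuous derivative is enough.\<close>

lemma has_real_derivative_pos_part_square:
  "((\<lambda>t::real. (max 0 t)\<^sup>2) has_real_derivative 2 * max 0 t) (at t)"
proof -
  consider "t > 0" | "t < 0" | "t = 0" by linarith
  then show ?thesis
  proof cases
    case 1
    have "((\<lambda>t. t\<^sup>2) has_real_derivative 2 * max 0 t) (at t)"
      using 1 by (auto intro!: derivative_eq_intros)
    then show ?thesis
      by (rule has_field_derivative_transform_within_open[of _ _ _ "{0<..}"]) (use 1 in auto)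
  next
    case 2
    have "((\<lambda>t. 0) has_real_derivative 2 * max 0 t) (at t)"
      using 2 by (auto intro!: derivative_eq_intros)
    then show ?thesis
      by (rule has_field_derivative_transform_within_open[of _ _ _ "{..<0}"]) (use 2 in auto)
  next
    case 3
    have "(\<lambda>h. ((max 0 h)\<^sup>2) / h) \<midarrow>0\<rightarrow> (0::real)"
    proof (rule Lim_null_comparison[where g = "\<lambda>h. \<bar>h\<bar>"])
      show "\<forall>\<^sub>F h in at 0. norm ((max 0 h)\<^sup>2 / h) \<le> \<bar>h :: real\<bar>"
        by (rule always_eventually) (auto simp: max_def power2_eq_square)
      show "(\<lambda>h. \<bar>h :: real\<bar>) \<midarrow>0\<rightarrow> 0" by (auto intro!: tendsto_eq_intros)
    qed
    then show ?thesis using 3 by (simp add: DERIV_def)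
  qed
qed

text \<open>The modulus is smoothed to \<open>sqrt (v\<^sup>2 + \<delta>\<^sup>2) - \<delta>\<close>, which is quadratic near \<open>v = 0\<close> and therefore in
  \<open>L\<^sup>p\<close>, because \<open>p < N/2\<close> gives \<open>p\<^sup>* \<le> 2p\<close>. This makes the cutoff terms vanish in the limit.\<close>

lemma sobolev_C1:
  fixes v G :: "'a::euclidean_space \<Rightarrow> real" and D :: "'a \<Rightarrow> 'a" and p C :: real
  defines "N \<equiv> real DIM('a)"
  defines "q \<equiv> p / (p - 1)" and "ps \<equiv> N * p / (N - p)" and "r \<equiv> p * (N - 1) / (N - p)"
  assumes p: "1 < p" "p < N / 2"
    and v: "continuous_on UNIV v" and D: "continuous_on UNIV D"
    and der: "\<And>x b. b \<in> Basis \<Longrightarrow> ((\<lambda>s. v (x + s *\<^sub>R b)) has_real_derivative D x \<bullet> b) (at 0)"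
    and vi: "integrable lborel (\<lambda>x. \<bar>v x\<bar> powr ps)" and Dp: "integrable lborel (\<lambda>x. norm (D x) powr p)"
    and G: "continuous_on UNIV G" "\<And>x. 0 < G x" "\<And>x. G x \<le> C"
    and Gi: "integrable lborel G" "integrable lborel (\<lambda>y. G y powr (1 - 1 / N))" "integrable lborel (\<lambda>y. G y * norm y powr q)"
  shows "N * (\<integral>y. G y powr (1 - 1 / N) \<partial>lborel) * ((\<integral>x. \<bar>v x\<bar> powr ps \<partial>lborel) / (\<integral>y. G y \<partial>lborel)) powr (1 / ps)
    \<le> r * ((\<integral>x. norm (D x) powr p \<partial>lborel) powr (1 / p) * (\<integral>y. G y * norm y powr q \<partial>lborel) powr (1 / q))"
proof -
  have N: "N > 1" "N - p > 0" "p < N" using p by auto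
  \<comment> \<open>The bound by 2p uses p < N/2, since ps / p = N / (N - p).\<close>
  have ps: "ps > 0" "p \<le> ps" "ps \<le> 2 * p"
    using p N by (auto simp: ps_def field_simps)
  have r: "r > 0" using p N by (auto simp: r_def)
  have [measurable]: "v \<in> borel_measurable borel" "D \<in> borel_measurable borel"
    using v D borel_measurable_continuous_onI by auto
  define LHS where "LHS A = N * (\<integral>y. G y powr (1 - 1 / N) \<partial>lborel) * (A / (\<integral>y. G y \<partial>lborel)) powr (1 / ps)" for A
  define RHS where "RHS E = r * (E powr (1 / p) * (\<integral>y. G y * norm y powr q \<partial>lborel) powr (1 / q))" for E
  define E where "E = (\<integral>x. norm (D x) powr p \<partial>lborel)"
  have LHS_cont: "(\<lambda>n. LHS (A n)) \<longlonglongrightarrow> LHS a" if "A \<longlonglongrightarrow> a" "\<And>n. A n \<ge> 0" for A a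
    unfolding LHS_def divide_inverse using that ps G
    by (intro tendsto_mult_left tendsto_powr_nonneg tendsto_mult_right mult_nonneg_nonneg)
      (auto intro!: integral_nonneg_AE simp: less_imp_le)
  have RHS_mono: "RHS a \<le> RHS b" if "0 \<le> a" "a \<le> b" for a b
    unfolding RHS_def using that r p by (intro mult_left_mono mult_right_mono powr_mono2) auto
  have RHS_cont: "(\<lambda>n. RHS (A n)) \<longlonglongrightarrow> RHS a" if "A \<longlonglongrightarrow> a" "\<And>n. A n \<ge> 0" for A a
    unfolding RHS_def using that p by (intro tendsto_mult_left tendsto_mult_right tendsto_powr_nonneg) auto
  define g where "g \<delta> x = sqrt ((v x)\<^sup>2 + \<delta>\<^sup>2) - \<delta>" for \<delta> x
  have step: "LHS (\<integral>x. g \<delta> x powr ps \<partial>lborel) \<le> RHS E" if \<delta>: "\<delta> > 0" for \<delta>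
  proof -
    define s where "s x = sqrt ((v x)\<^sup>2 + \<delta>\<^sup>2)" for x
    have s: "s x > 0" "\<bar>v x\<bar> \<le> s x" "\<delta> \<le> s x" "s x ^ 2 = (v x)\<^sup>2 + \<delta>\<^sup>2" for x
      using \<delta> by (auto simp: s_def add_nonneg_pos intro!: real_le_rsqrt)
    have gs: "g \<delta> x = s x - \<delta>" for x by (simp add: g_def s_def)
    have g0: "0 \<le> g \<delta> x" for x using s(3)[of x] by (simp add: gs)
    have gv: "g \<delta> x \<le> \<bar>v x\<bar>" for x
    proof -
      have "s x \<le> \<bar>v x\<bar> + \<delta>" unfolding s_def using \<delta> by (intro real_le_lsqrt) (auto simp: power2_sum)
      then show ?thesis by (simp add: gs)
    qed
    have gv2: "g \<delta> x \<le> (v x)\<^sup>2 / (2 * \<delta>)" for x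
    proof -
      have "(s x - \<delta>) * (2 * \<delta>) \<le> (s x - \<delta>) * (s x + \<delta>)" using s(3)[of x] by (intro mult_left_mono) auto
      also have "\<dots> = (v x)\<^sup>2" using s(4)[of x] by (simp add: algebra_simps power2_eq_square)
      finally show ?thesis using \<delta> by (simp add: gs field_simps)
    qed
    have cs: "continuous_on UNIV s" unfolding s_def[abs_def] by (intro continuous_intros v)
    have cg: "continuous_on UNIV (g \<delta>)" unfolding gs[abs_def] by (intro continuous_intros cs)
    have [measurable]: "g \<delta> \<in> borel_measurable borel" "s \<in> borel_measurable borel"
      using cg cs borel_measurable_continuous_onI by auto
    define K where "K = 1 + (1 / (2 * \<delta>)) powr p"
    have K: "K \<ge> 1" by (simp add: K_def)
    \<comment> \<open>For |v| at least 1 the bound by |v| is used with p <= ps; below 1 the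
      quadratic bound is used with ps <= 2p.\<close>
    have gp: "g \<delta> x powr p \<le> K * \<bar>v x\<bar> powr ps" for x
    proof (cases "\<bar>v x\<bar> \<ge> 1")
      case True
      have "g \<delta> x powr p \<le> \<bar>v x\<bar> powr p" using g0 gv p by (intro powr_mono2) auto
      also have "\<dots> \<le> \<bar>v x\<bar> powr ps" using True ps by (intro powr_mono) auto
      also have "\<dots> \<le> K * \<bar>v x\<bar> powr ps" using K by (simp add: mult_le_cancel_right1)
      finally show ?thesis .
    next
      case False
      have "g \<delta> x powr p \<le> (1 / (2 * \<delta>) * \<bar>v x\<bar> powr 2) powr p" using g0[of x] gv2[of x] p by (intro powr_mono2) auto
      also have "\<dots> = (1 / (2 * \<delta>)) powr p * \<bar>v x\<bar> powr (2 * p)" using \<delta> by (subst powr_mult) (simp_all add: powr_powr del: powr_numeral)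
      also have "\<dots> \<le> K * \<bar>v x\<bar> powr (2 * p)" by (intro mult_right_mono) (auto simp: K_def)
      also have "\<dots> \<le> K * \<bar>v x\<bar> powr ps" using False ps K by (intro mult_left_mono powr_mono') auto
      finally show ?thesis .
    qed
    have gpi: "integrable lborel (\<lambda>x. g \<delta> x powr p)"
      by (rule Bochner_Integration.integrable_bound[OF integrable_mult_right[OF vi, of K]]) (use gp in \<open>auto intro!: AE_I2 order_trans[OF _ abs_ge_self]\<close>)
    have gpsi: "g \<delta> x powr ps \<le> \<bar>v x\<bar> powr ps" for x using g0 gv ps by (intro powr_mono2) auto
    \<comment> \<open>A cutoff at scale n + 1. Where it is nonzero, |x| < n + 1, so the factor 4 |x|
      / (n + 1)^2 in its gradient is at most 4 / (n + 1).\<close>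
    define cut where "cut n x = (max 0 (1 - (x \<bullet> x) / (real (Suc n))\<^sup>2))\<^sup>2" for n and x :: 'a
    define Dcut where "Dcut n x = (- 4 / (real (Suc n))\<^sup>2 * max 0 (1 - (x \<bullet> x) / (real (Suc n))\<^sup>2)) *\<^sub>R x" for n and x :: 'a
    have cut1: "0 \<le> cut n x" "cut n x \<le> 1" for n x
      unfolding cut_def by (auto intro!: power_le_one)
    have ccut: "continuous_on UNIV (cut n)" "continuous_on UNIV (Dcut n)" for n
      unfolding cut_def[abs_def] Dcut_def[abs_def] by (intro continuous_intros; simp)+
    have out: "cut n x = 0" "Dcut n x = 0" if "real (Suc n) \<le> norm x" for n x
    proof -
      have "(real (Suc n))\<^sup>2 \<le> x \<bullet> x" using that by (simp add: power_mono power2_norm_eq_inner[symmetric])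
      then have "1 - (x \<bullet> x) / (real (Suc n))\<^sup>2 \<le> 0" by (simp add: le_divide_eq)
      then show "cut n x = 0" "Dcut n x = 0" by (simp_all add: cut_def Dcut_def)
    qed
    have Dcutb: "norm (Dcut n x) \<le> 4 / real (Suc n)" for n x
    proof (cases "real (Suc n) \<le> norm x")
      case False
      have "norm (Dcut n x) \<le> 4 / (real (Suc n))\<^sup>2 * 1 * real (Suc n)"
        unfolding Dcut_def norm_scaleR abs_mult using False
        by (intro mult_mono) (auto simp: abs_if)
      then show ?thesis by (simp add: power2_eq_square del: of_nat_Suc)
    qed (simp add: out)
    have dcut: "((\<lambda>s. cut n (x + s *\<^sub>R b)) has_real_derivative Dcut n x \<bullet> b) (at 0)" for n x b
    proof -
      have "((\<lambda>s. 1 - ((x + s *\<^sub>R b) \<bullet> (x + s *\<^sub>R b)) / (real (Suc n))\<^sup>2) has_real_derivative - 2 * (x \<bullet> b) / (real (Suc n))\<^sup>2) (at 0)"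
      proof -
        have "((\<lambda>s. 1 - ((x + s *\<^sub>R b) \<bullet> (x + s *\<^sub>R b)) * c) has_real_derivative - 2 * (x \<bullet> b) * c) (at 0)" for c
          by (auto intro!: derivative_eq_intros simp: inner_add_left inner_add_right inner_commute)
        from this[of "1 / (real (Suc n))\<^sup>2"] show ?thesis by simp
      qed
      from DERIV_chain2[OF has_real_derivative_pos_part_square this] show ?thesis
        unfolding cut_def Dcut_def by (simp add: algebra_simps)
    qed
    \<comment> \<open>The gradient of the smoothed modulus; its norm is at most that of
      \<open>D\<close>, because |v| <= s.\<close>
    define Dg where "Dg x = (v x / s x) *\<^sub>R D x" for x
    define f where "f n x = cut n x * g \<delta> x" for n x
    define Df where "Df n x = cut n x *\<^sub>R Dg x + g \<delta> x *\<^sub>R Dcut n x" for n x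
    have cDg: "continuous_on UNIV Dg" unfolding Dg_def[abs_def]
      using s by (intro continuous_intros cs v D) (auto simp: less_imp_neq[symmetric])
    have cDf: "continuous_on UNIV (Df n)" for n
      unfolding Df_def[abs_def] by (intro continuous_intros cDg cg ccut)
    have [measurable]: "Df n \<in> borel_measurable borel" "f n \<in> borel_measurable borel" "Dg \<in> borel_measurable borel" for n
      using cDf cDg cg ccut(1)[of n] unfolding f_def[abs_def] by (auto intro!: borel_measurable_continuous_onI continuous_intros)
    have Dgb: "norm (Dg x) \<le> norm (D x)" for x
      unfolding Dg_def using s[of x] by (auto simp: divide_le_eq mult.commute intro!: mult_right_mono)
    \<comment> \<open>A majorant independent of \<open>n\<close>; the cutoff gradient is at most 4,
      and the smoothed modulus has integrable p-th power.\<close>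
    have Dfb: "norm (Df n x) powr p \<le> 2 powr p * (norm (D x) powr p + 4 powr p * g \<delta> x powr p)" for n x
    proof -
      have "norm (Df n x) \<le> norm (D x) + 4 * g \<delta> x"
      proof -
        have "norm (Df n x) \<le> cut n x * norm (Dg x) + g \<delta> x * norm (Dcut n x)"
          unfolding Df_def using cut1 g0 by (intro norm_triangle_le) auto
        also have "\<dots> \<le> 1 * norm (D x) + g \<delta> x * 4"
          using cut1 Dgb g0 Dcutb[of n x] by (intro add_mono mult_mono) (auto intro: order_trans simp: divide_le_eq)
        finally show ?thesis by simp
      qed
      also have "\<dots> \<le> 2 * max (norm (D x)) (4 * g \<delta> x)" by auto
      finally have "norm (Df n x) powr p \<le> (2 * max (norm (D x)) (4 * g \<delta> x)) powr p"
        using p by (intro powr_mono2) auto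
      also have "\<dots> = 2 powr p * max (norm (D x)) (4 * g \<delta> x) powr p" by (subst powr_mult) auto
      also have "max (norm (D x)) (4 * g \<delta> x) powr p \<le> norm (D x) powr p + (4 * g \<delta> x) powr p"
        by (auto simp: max_def)
      also have "(4 * g \<delta> x) powr p = 4 powr p * g \<delta> x powr p" using g0[of x] by (subst powr_mult) auto
      finally show ?thesis by simp
    qed
    have dom: "integrable lborel (\<lambda>x. 2 powr p * (norm (D x) powr p + 4 powr p * g \<delta> x powr p))"
      using Dp gpi by auto
    have Dfi: "integrable lborel (\<lambda>x. norm (Df n x) powr p)" for n
      by (rule Bochner_Integration.integrable_bound[OF dom]) (use Dfb in \<open>auto intro!: AE_I2 order_trans[OF _ abs_ge_self]\<close>)
    have df: "((\<lambda>s. f n (x + s *\<^sub>R b)) has_real_derivative Df n x \<bullet> b) (at 0)" if b: "b \<in> Basis" for n x b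
    proof -
      have pos: "(v x)\<^sup>2 + \<delta>\<^sup>2 > 0" using \<delta> by (simp add: add_nonneg_pos)
      have "((\<lambda>s. g \<delta> (x + s *\<^sub>R b)) has_real_derivative Dg x \<bullet> b) (at 0)"
        unfolding g_def using der[OF b, of x] pos
        by (auto intro!: derivative_eq_intros simp: Dg_def s_def field_simps)
      from DERIV_mult[OF dcut[of n x b] this] show ?thesis
        unfolding f_def by (simp add: Df_def inner_add_left algebra_simps)
    qed
    have S: "LHS (\<integral>x. f n x powr ps \<partial>lborel) \<le> RHS (\<integral>x. norm (Df n x) powr p \<partial>lborel)" for n
      unfolding LHS_def RHS_def N_def ps_def q_def r_def
    proof (rule sobolev_compact_support[where ?R0.0 = "real (Suc n)" and C = C])
      show "continuous_on UNIV (f n)" unfolding f_def[abs_def] by (intro continuous_intros ccut cg)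
    qed (use p N N_def q_def df Dfi G Gi cDf out cut1 g0 in \<open>auto simp: f_def\<close>)
    have cutlim: "(\<lambda>n. cut n x) \<longlonglongrightarrow> 1" for x
    proof -
      have "(\<lambda>n. (max 0 (1 - (x \<bullet> x) / (real (Suc n))\<^sup>2))\<^sup>2) \<longlonglongrightarrow> (max 0 (1 - 0))\<^sup>2"
        by (intro tendsto_power tendsto_max tendsto_diff tendsto_const tendsto_divide_0[OF tendsto_const] filterlim_at_top_imp_at_infinity
            filterlim_pow_at_top filterlim_compose[OF filterlim_real_sequentially filterlim_Suc]) auto
      then show ?thesis by (simp add: cut_def)
    qed
    have Dcutlim: "(\<lambda>n. Dcut n x) \<longlonglongrightarrow> 0" for x
    proof (rule Lim_null_comparison[where g = "\<lambda>n. 4 / real (Suc n)"])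
      show "(\<lambda>n. 4 / real (Suc n)) \<longlonglongrightarrow> 0"
        by (intro tendsto_divide_0[OF tendsto_const] filterlim_at_top_imp_at_infinity
            filterlim_compose[OF filterlim_real_sequentially filterlim_Suc])
    qed (use Dcutb in auto)
    have l1: "(\<lambda>n. \<integral>x. f n x powr ps \<partial>lborel) \<longlonglongrightarrow> (\<integral>x. g \<delta> x powr ps \<partial>lborel)"
    proof (rule integral_dominated_convergence[OF _ _ vi])
      show "AE x in lborel. (\<lambda>n. f n x powr ps) \<longlonglongrightarrow> g \<delta> x powr ps"
      proof (rule AE_I2)
        fix x
        have "(\<lambda>n. f n x powr ps) \<longlonglongrightarrow> (1 * g \<delta> x) powr ps"
          unfolding f_def using ps cut1 g0
          by (intro tendsto_powr_nonneg tendsto_mult_right cutlim mult_nonneg_nonneg) auto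
        then show "(\<lambda>n. f n x powr ps) \<longlonglongrightarrow> g \<delta> x powr ps" by simp
      qed
      show "AE x in lborel. norm (f n x powr ps) \<le> \<bar>v x\<bar> powr ps" for n
      proof (rule AE_I2)
        fix x
        have "f n x \<le> g \<delta> x" unfolding f_def using cut1 g0 by (intro mult_left_le_one_le) auto
        then have "f n x powr ps \<le> g \<delta> x powr ps" using cut1 g0 ps by (intro powr_mono2) (auto simp: f_def)
        then show "norm (f n x powr ps) \<le> \<bar>v x\<bar> powr ps" using gpsi[of x] by simp
      qed
    qed measurable
    have l2: "(\<lambda>n. \<integral>x. norm (Df n x) powr p \<partial>lborel) \<longlonglongrightarrow> (\<integral>x. norm (Dg x) powr p \<partial>lborel)"
    proof (rule integral_dominated_convergence[OF _ _ dom])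
      show "AE x in lborel. (\<lambda>n. norm (Df n x) powr p) \<longlonglongrightarrow> norm (Dg x) powr p"
      proof (rule AE_I2)
        fix x
        have "(\<lambda>n. norm (Df n x) powr p) \<longlonglongrightarrow> norm (1 *\<^sub>R Dg x + g \<delta> x *\<^sub>R 0) powr p"
          unfolding Df_def using p
          by (intro tendsto_powr_nonneg tendsto_norm tendsto_add tendsto_scaleR tendsto_const cutlim Dcutlim) auto
        then show "(\<lambda>n. norm (Df n x) powr p) \<longlonglongrightarrow> norm (Dg x) powr p" by simp
      qed
    qed (use Dfb in auto)
    have "LHS (\<integral>x. g \<delta> x powr ps \<partial>lborel) \<le> RHS (\<integral>x. norm (Dg x) powr p \<partial>lborel)"
      by (rule LIMSEQ_le[OF LHS_cont[OF l1] RHS_cont[OF l2]]) (use S in \<open>auto intro!: integral_nonneg_AE\<close>)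
    also have "\<dots> \<le> RHS E"
    proof (rule RHS_mono)
      have le: "norm (Dg x) powr p \<le> norm (D x) powr p" for x using Dgb p by (intro powr_mono2) auto
      have i: "integrable lborel (\<lambda>x. norm (Dg x) powr p)"
        by (rule Bochner_Integration.integrable_bound[OF Dp]) (use le in auto)
      show "(\<integral>x. norm (Dg x) powr p \<partial>lborel) \<le> E"
        unfolding E_def by (intro integral_mono i Dp le)
    qed (auto intro!: integral_nonneg_AE)
    finally show ?thesis .
  qed
  \<comment> \<open>The smoothing is removed along \<open>\<delta> = 1 / real (Suc n)\<close>, with
    the modulus of \<open>v\<close> as common bound.\<close>
  have gn: "\<bar>g (1 / real (Suc n)) x\<bar> powr ps \<le> \<bar>v x\<bar> powr ps" for n x
  proof -
    have "sqrt ((v x)\<^sup>2 + (1 / real (Suc n))\<^sup>2) \<le> \<bar>v x\<bar> + 1 / real (Suc n)"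
      by (intro real_le_lsqrt) (auto simp: power2_sum)
    moreover have "1 / real (Suc n) \<le> sqrt ((v x)\<^sup>2 + (1 / real (Suc n))\<^sup>2)"
      by (intro real_le_rsqrt) auto
    ultimately show ?thesis using ps by (intro powr_mono2) (auto simp: g_def)
  qed
  have lim: "(\<lambda>n. \<integral>x. \<bar>g (1 / real (Suc n)) x\<bar> powr ps \<partial>lborel) \<longlonglongrightarrow> (\<integral>x. \<bar>v x\<bar> powr ps \<partial>lborel)"
  proof (rule integral_dominated_convergence[OF _ _ vi])
    show "AE x in lborel. (\<lambda>n. \<bar>g (1 / real (Suc n)) x\<bar> powr ps) \<longlonglongrightarrow> \<bar>v x\<bar> powr ps"
    proof (rule AE_I2)
      fix x
      have "(\<lambda>n. 1 / real (Suc n)) \<longlonglongrightarrow> 0"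
        by (intro tendsto_divide_0[OF tendsto_const] filterlim_at_top_imp_at_infinity
            filterlim_compose[OF filterlim_real_sequentially filterlim_Suc])
      then have "(\<lambda>n. \<bar>g (1 / real (Suc n)) x\<bar> powr ps) \<longlonglongrightarrow> \<bar>sqrt ((v x)\<^sup>2 + 0\<^sup>2) - 0\<bar> powr ps"
        unfolding g_def using ps
        by (intro tendsto_powr_nonneg tendsto_rabs tendsto_diff tendsto_real_sqrt tendsto_add tendsto_power tendsto_const) auto
      then show "(\<lambda>n. \<bar>g (1 / real (Suc n)) x\<bar> powr ps) \<longlonglongrightarrow> \<bar>v x\<bar> powr ps" by simp
    qed
  qed (use gn in \<open>auto simp: g_def\<close>)
  have gnn: "\<bar>g (1 / real (Suc n)) x\<bar> = g (1 / real (Suc n)) x" for n x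
  proof -
    have "1 / real (Suc n) \<le> sqrt ((v x)\<^sup>2 + (1 / real (Suc n))\<^sup>2)" by (intro real_le_rsqrt) auto
    then show ?thesis by (simp add: g_def)
  qed
  have "LHS (\<integral>x. \<bar>g (1 / real (Suc n)) x\<bar> powr ps \<partial>lborel) \<le> RHS E" for n
    unfolding gnn by (rule step) simp
  then have "LHS (\<integral>x. \<bar>v x\<bar> powr ps \<partial>lborel) \<le> RHS E"
    by (intro tendsto_upperbound[OF LHS_cont[OF lim]] always_eventually allI integral_nonneg_AE) auto
  then show ?thesis by (simp add: LHS_def RHS_def E_def)
qed

section \<open>Mollification\<close>

text \<open>The case k = 0 is the classical flat function exp(-1/t). Its derivatives carry powers of
  1/t, so the whole family is kept: differentiation stays inside its linear span.\<close>

definition flat :: "nat \<Rightarrow> real \<Rightarrow> real" where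
  "flat k t = (if t > 0 then (1 / t) ^ k * exp (- (1 / t)) else 0)"

text \<open>This is the difference quotient at 0; with x = 1/t it becomes a power of x divided by
  exp x.\<close>

lemma flat_tendsto_0: "((\<lambda>t. flat k t / t) \<longlongrightarrow> 0) (at 0)"
proof -
  have "((\<lambda>x::real. x ^ Suc k / exp x) \<longlongrightarrow> 0) at_top"
    by (rule tendsto_power_div_exp_0)
  then have "((\<lambda>t. (inverse t) ^ Suc k / exp (inverse t)) \<longlongrightarrow> (0::real)) (at_right 0)"
    by (rule filterlim_compose[OF _ filterlim_inverse_at_top_right])
  then have "((\<lambda>t. flat k t / t) \<longlongrightarrow> 0) (at_right 0)"
  proof (rule Lim_transform_eventually)
    show "\<forall>\<^sub>F t in at_right 0. (inverse t) ^ Suc k / exp (inverse t) = flat k t / t"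
      using eventually_at_right_less[of "0::real"]
      by eventually_elim (simp add: flat_def exp_minus inverse_eq_divide field_simps)
  qed
  moreover have "((\<lambda>t. flat k t / t) \<longlongrightarrow> 0) (at_left 0)"
    by (rule tendsto_eventually) (auto simp: flat_def eventually_at_filter)
  ultimately show ?thesis by (simp add: filterlim_split_at)
qed

lemma has_real_derivative_flat:
  "(flat k has_real_derivative flat (k + 2) t - real k * flat (k + 1) t) (at t)"
proof -
  consider "t > 0" | "t < 0" | "t = 0" by linarith
  then show ?thesis
  proof cases
    case 1
    have "((\<lambda>t. (1 / t) ^ k * exp (- (1 / t))) has_real_derivative
        (1 / t) ^ (k + 2) * exp (- (1 / t)) - real k * ((1 / t) ^ (k + 1) * exp (- (1 / t)))) (at t)"
    proof (cases k)
      case 0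
      then show ?thesis using 1 by (auto intro!: derivative_eq_intros simp: power2_eq_square)
    next
      case (Suc j)
      have d: "((\<lambda>t. 1 / t) has_real_derivative - (1 / t)\<^sup>2) (at t)"
        using 1 by (auto intro!: derivative_eq_intros simp: power2_eq_square)
      have d1: "((\<lambda>t. (1 / t) ^ k) has_real_derivative - real k * (1 / t) ^ (k + 1)) (at t)"
        by (rule DERIV_cong[OF DERIV_power[OF d, of k]])
          (simp add: Suc power2_eq_square del: of_nat_Suc)
      have d2: "((\<lambda>t. exp (- (1 / t))) has_real_derivative exp (- (1 / t)) * (1 / t)\<^sup>2) (at t)"
        using DERIV_chain2[OF DERIV_exp DERIV_minus[OF d]] by simp
      show ?thesis
        by (rule DERIV_cong[OF DERIV_mult[OF d1 d2]]) (simp add: power_add power2_eq_square mult_ac)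
    qed
    then have "((\<lambda>t. (1 / t) ^ k * exp (- (1 / t))) has_real_derivative flat (k + 2) t - real k * flat (k + 1) t) (at t)"
      using 1 by (simp add: flat_def)
    then show ?thesis
      by (rule has_field_derivative_transform_within_open[of _ _ _ "{0<..}"]) (use 1 in \<open>auto simp: flat_def\<close>)
  next
    case 2
    have "((\<lambda>t. 0) has_real_derivative flat (k + 2) t - real k * flat (k + 1) t) (at t)"
      using 2 by (auto intro!: derivative_eq_intros simp: flat_def)
    then show ?thesis
      by (rule has_field_derivative_transform_within_open[of _ _ _ "{..<0}"]) (use 2 in \<open>auto simp: flat_def\<close>)
  next
    case 3
    then show ?thesis using flat_tendsto_0[of k] by (simp add: DERIV_def flat_def[of _ 0])
  qed
qed

text \<open>A syntactic class containing its own directional derivatives, so that smoothness of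
  every order is an induction and no higher derivative has to be computed.\<close>

inductive smooth_term :: "('a::euclidean_space \<Rightarrow> real) \<Rightarrow> bool" where
  const: "smooth_term (\<lambda>_. c)"
| coord: "smooth_term (\<lambda>x. x \<bullet> b)"
| add: "smooth_term f \<Longrightarrow> smooth_term g \<Longrightarrow> smooth_term (\<lambda>x. f x + g x)"
| mult: "smooth_term f \<Longrightarrow> smooth_term g \<Longrightarrow> smooth_term (\<lambda>x. f x * g x)"
| flat: "smooth_term f \<Longrightarrow> smooth_term (\<lambda>x. flat k (f x))"

lemma smooth_term_sum:
  "finite S \<Longrightarrow> (\<And>b. b \<in> S \<Longrightarrow> smooth_term (f b)) \<Longrightarrow> smooth_term (\<lambda>x. \<Sum>b\<in>S. f b x)"
  by (induction S rule: finite_induct) (auto intro: smooth_term.intros)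

lemma smooth_term_deriv:
  "smooth_term f \<Longrightarrow> \<exists>D. \<forall>x. (f has_derivative D x) (at x) \<and> (\<forall>b. smooth_term (\<lambda>x. D x b))"
proof (induction rule: smooth_term.induct)
  case (const c)
  show ?case by (rule exI[of _ "\<lambda>x b. 0"]) (auto intro: smooth_term.intros)
next
  case (coord b)
  show ?case by (rule exI[of _ "\<lambda>x h. h \<bullet> b"]) (auto intro!: derivative_eq_intros smooth_term.const)
next
  case (add f g)
  then obtain D E where "\<forall>x. (f has_derivative D x) (at x) \<and> (\<forall>b. smooth_term (\<lambda>x. D x b))"
     "\<forall>x. (g has_derivative E x) (at x) \<and> (\<forall>b. smooth_term (\<lambda>x. E x b))" by blast
  then show ?case
    by (intro exI[of _ "\<lambda>x b. D x b + E x b"]) (auto intro!: smooth_term.add has_derivative_add)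
next
  case (mult f g)
  then obtain D E where "\<forall>x. (f has_derivative D x) (at x) \<and> (\<forall>b. smooth_term (\<lambda>x. D x b))"
     "\<forall>x. (g has_derivative E x) (at x) \<and> (\<forall>b. smooth_term (\<lambda>x. E x b))" by blast
  then show ?case using mult.hyps
    by (intro exI[of _ "\<lambda>x b. f x * E x b + D x b * g x"])
      (auto intro!: smooth_term.add smooth_term.mult has_derivative_mult)
next
  case (flat f k)
  then obtain D where D: "\<forall>x. (f has_derivative D x) (at x) \<and> (\<forall>b. smooth_term (\<lambda>x. D x b))" by blast
  define e where "e x = flat (k + 2) (f x) + (- real k) * flat (k + 1) (f x)" for x
  have e: "smooth_term e" unfolding e_def[abs_def] using flat.hyps by (intro smooth_term.intros)
  have "((\<lambda>x. flat k (f x)) has_derivative (\<lambda>b. D x b * e x)) (at x)" for x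
    using has_derivative_compose[of f "D x" x UNIV "flat k", OF _ has_real_derivative_flat[unfolded has_field_derivative_def]] D
    by (simp add: e_def mult.commute)
  then show ?case using D e
    by (intro exI[of _ "\<lambda>x b. D x b * e x"]) (auto intro!: smooth_term.mult)
qed

lemma smooth_term_C_k: "smooth_term f \<Longrightarrow> C_k k f"
proof (induction k arbitrary: f)
  case 0
  then show ?case using smooth_term_deriv
    by (metis C_k.simps(1) differentiable_def differentiable_imp_continuous_within continuous_at_imp_continuous_on)
next
  case (Suc k)
  obtain D where D: "\<And>x. (f has_derivative D x) (at x)" "\<And>b. smooth_term (\<lambda>x. D x b)"
    using smooth_term_deriv[OF Suc.prems] by blast
  have "frechet_derivative f (at x) = D x" for x using frechet_derivative_at[OF D(1)] by simp
  then show ?case using D Suc.IH by (auto simp: differentiable_def)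
qed

text \<open>The reflected translates are required to be test functions because these are what a weak
  gradient is tested with when a convolution is differentiated.\<close>

definition mollifier :: "real \<Rightarrow> ('a::euclidean_space \<Rightarrow> real) \<Rightarrow> bool" where
  "mollifier \<epsilon> \<eta> \<longleftrightarrow> continuous_on UNIV \<eta> \<and> (\<forall>z. 0 \<le> \<eta> z) \<and> (\<forall>z. \<epsilon> \<le> norm z \<longrightarrow> \<eta> z = 0) \<and>
     integrable lborel \<eta> \<and> (\<integral>z. \<eta> z \<partial>lborel) = 1 \<and> (\<forall>x. test_function (\<lambda>y. \<eta> (x - y)))"

lemma integrable_continuous_support:
  fixes f :: "'a::euclidean_space \<Rightarrow> real"
  assumes "continuous_on UNIV f" "\<And>z. R \<le> norm z \<Longrightarrow> f z = 0"
  shows "integrable lborel f"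
proof -
  have "integrable lborel (\<lambda>x. indicator (cball 0 R) x *\<^sub>R f x)"
    by (rule borel_integrable_compact[OF compact_cball continuous_on_subset[OF assms(1)]]) simp
  moreover have "(\<lambda>x. indicator (cball 0 R) x *\<^sub>R f x) = f"
    using assms(2) by (auto simp: fun_eq_iff split: split_indicator)
  ultimately show ?thesis by simp
qed

lemma mollifier_exists:
  assumes "\<epsilon> > 0"
  shows "\<exists>\<eta> :: 'a::euclidean_space \<Rightarrow> real. mollifier \<epsilon> \<eta>"
proof -
  \<comment> \<open>The flat function of the squared radius minus |z|^2 is smooth across the sphere,
    positive inside and zero outside; dividing by its integral gives mass one.\<close>
  define h :: "'a \<Rightarrow> real" where "h z = flat 0 (\<epsilon>\<^sup>2 - z \<bullet> z)" for z
  have sm: "smooth_term (\<lambda>y. c * h (x - y))" for x c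
  proof -
    \<comment> \<open>The squared norm is expanded in coordinates to exhibit the function as a
      \<open>smooth_term\<close>.\<close>
    have "(\<lambda>y. c * h (x - y)) = (\<lambda>y. c * flat 0 (\<epsilon>\<^sup>2 + (-1) * (\<Sum>b\<in>Basis. (x \<bullet> b + (-1) * (y \<bullet> b)) * (x \<bullet> b + (-1) * (y \<bullet> b)))))"
    proof
      fix y
      have "(x - y) \<bullet> (x - y) = (\<Sum>b\<in>Basis. (x \<bullet> b - y \<bullet> b) * (x \<bullet> b - y \<bullet> b))"
        by (subst euclidean_inner) (simp add: inner_diff_left)
      then show "c * h (x - y) = c * flat 0 (\<epsilon>\<^sup>2 + (-1) * (\<Sum>b\<in>Basis. (x \<bullet> b + (-1) * (y \<bullet> b)) * (x \<bullet> b + (-1) * (y \<bullet> b))))"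
        by (simp add: h_def)
    qed
    then show ?thesis by (simp only:) (intro smooth_term.intros smooth_term_sum finite_Basis)
  qed
  have ch: "continuous_on UNIV h"
  proof -
    have "continuous_on UNIV (flat 0)"
      using has_real_derivative_flat by (meson DERIV_continuous continuous_at_imp_continuous_on)
    then show ?thesis unfolding h_def[abs_def] by (rule continuous_on_compose2) (auto intro!: continuous_intros)
  qed
  have h0: "0 \<le> h z" for z by (simp add: h_def flat_def)
  have hz: "h z = 0" if "\<epsilon> \<le> norm z" for z
  proof -
    have "\<epsilon>\<^sup>2 \<le> z \<bullet> z" using that assms by (simp add: power2_norm_eq_inner[symmetric] power_mono)
    then show ?thesis by (simp add: h_def flat_def)
  qed
  have hp: "h z > 0" if "norm z < \<epsilon>" for z
  proof -
    have "z \<bullet> z < \<epsilon>\<^sup>2" using that by (simp add: power2_norm_eq_inner[symmetric] power_strict_mono)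
    then show ?thesis by (simp add: h_def flat_def)
  qed
  have ih: "integrable lborel h" by (rule integrable_continuous_support[OF ch hz])
  define c where "c = (\<integral>z. h z \<partial>lborel)"
  \<comment> \<open>A vanishing integral would make the ball, on which \<open>h\<close> is positive,
    a null set.\<close>
  have "c > 0"
  proof -
    have "\<not> (AE z in lborel. h z = 0)"
    proof
      assume "AE z in lborel. h z = 0"
      then have "AE z in lborel. z \<notin> ball (0::'a) \<epsilon>" by eventually_elim (use hp in \<open>auto simp: less_le\<close>)
      then have "emeasure lborel (ball (0::'a) \<epsilon>) = 0"
        by (subst (asm) AE_iff_measurable[of "ball 0 \<epsilon>"]) auto
      then show False
        using assms mult_pos_pos[OF unit_ball_vol_pos[OF of_nat_0_le_iff[of "DIM('a)"]] zero_less_power[OF assms, of "DIM('a)"]]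
        by (simp add: emeasure_ball ennreal_eq_0_iff)
    qed
    then show ?thesis unfolding c_def
      using integral_nonneg_eq_0_iff_AE[OF ih] h0 integral_nonneg_AE[of h lborel] by (auto simp: less_le)
  qed
  define \<eta> where "\<eta> z = (1 / c) * h z" for z
  have "test_function (\<lambda>y. \<eta> (x - y))" for x
    unfolding test_function_def
  proof
    show "\<forall>k. C_k k (\<lambda>y. \<eta> (x - y))" unfolding \<eta>_def using sm smooth_term_C_k by blast
    have "{y. \<eta> (x - y) \<noteq> 0} \<subseteq> cball x \<epsilon>"
      using hz by (force simp: \<eta>_def dist_norm)
    then show "compact (closure {y. \<eta> (x - y) \<noteq> 0})"
      by (meson bounded_cball bounded_subset compact_closure)
  qed
  then have "mollifier \<epsilon> \<eta>"
    unfolding mollifier_def \<eta>_def[abs_def] using ch h0 hz ih \<open>c > 0\<close> by (auto simp: c_def intro!: continuous_intros)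
  then show ?thesis by blast
qed

lemma mollifierD:
  assumes "mollifier \<epsilon> \<eta>"
  shows "continuous_on UNIV \<eta>" "\<eta> \<in> borel_measurable borel" "0 \<le> \<eta> z" "\<epsilon> \<le> norm z \<Longrightarrow> \<eta> z = 0"
    "integrable lborel \<eta>" "(\<integral>z. \<eta> z \<partial>lborel) = 1" "test_function (\<lambda>y. \<eta> (x - y))" "(\<integral>\<^sup>+z. ennreal (\<eta> z) \<partial>lborel) = 1"
  using assms unfolding mollifier_def
  by (auto simp: nn_integral_eq_integral borel_measurable_continuous_onI)

section \<open>Convolution with mollifiers in L^1\<close>

lemma nn_integral_lborel_translate:
  fixes f :: "'a::euclidean_space \<Rightarrow> ennreal"
  assumes [measurable]: "f \<in> borel_measurable borel" and c: "c \<noteq> 0"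
  shows "(\<integral>\<^sup>+x. f (t + c *\<^sub>R x) \<partial>lborel) = ennreal (1 / \<bar>c\<bar> ^ DIM('a)) * (\<integral>\<^sup>+x. f x \<partial>lborel)"
proof -
  have "(\<integral>\<^sup>+x. f x \<partial>lborel) = (\<integral>\<^sup>+x. f x \<partial>density (distr lborel borel (\<lambda>x. t + c *\<^sub>R x)) (\<lambda>_. ennreal (\<bar>c\<bar> ^ DIM('a))))"
    using lborel_affine[OF c, of t] by simp
  also have "\<dots> = ennreal (\<bar>c\<bar> ^ DIM('a)) * (\<integral>\<^sup>+x. f (t + c *\<^sub>R x) \<partial>lborel)"
    by (simp add: nn_integral_density nn_integral_distr nn_integral_cmult)
  finally show ?thesis
    using c by (simp add: mult.assoc[symmetric] ennreal_mult[symmetric])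
qed

lemma mollifier_nn_integral:
  fixes \<eta> :: "'a::euclidean_space \<Rightarrow> real"
  assumes \<eta>: "mollifier \<epsilon> \<eta>"
  shows "(\<integral>\<^sup>+x. ennreal (\<eta> (x - y)) \<partial>lborel) = 1" "(\<integral>\<^sup>+y. ennreal (\<eta> (x - y)) \<partial>lborel) = 1"
    "integrable lborel (\<lambda>y. \<eta> (x - y))" "(\<integral>y. \<eta> (x - y) \<partial>lborel) = 1"
proof -
  have [measurable]: "\<eta> \<in> borel_measurable borel" by (rule mollifierD[OF \<eta>])
  show "(\<integral>\<^sup>+x. ennreal (\<eta> (x - y)) \<partial>lborel) = 1"
    using nn_integral_lborel_translate[of "\<lambda>x. ennreal (\<eta> x)" 1 "- y"] mollifierD(8)[OF \<eta>] by simp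
  show n: "(\<integral>\<^sup>+y. ennreal (\<eta> (x - y)) \<partial>lborel) = 1"
    using nn_integral_lborel_translate[of "\<lambda>x. ennreal (\<eta> x)" "-1" x] mollifierD(8)[OF \<eta>] by simp
  show i: "integrable lborel (\<lambda>y. \<eta> (x - y))"
    using n mollifierD(3)[OF \<eta>] by (intro integrableI_nonneg) auto
  show "(\<integral>y. \<eta> (x - y) \<partial>lborel) = 1"
    using nn_integral_eq_integral[OF i] n mollifierD(3)[OF \<eta>] by (simp add: integral_nonneg_AE)
qed

definition mollify :: "('a::euclidean_space \<Rightarrow> real) \<Rightarrow> ('a \<Rightarrow> real) \<Rightarrow> 'a \<Rightarrow> real" where
  "mollify \<eta> f x = (\<integral>y. f y * \<eta> (x - y) \<partial>lborel)"

lemma borel_measurable_mollify [measurable]: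
  assumes [measurable]: "f \<in> borel_measurable borel" "\<eta> \<in> borel_measurable borel"
  shows "mollify \<eta> f \<in> borel_measurable borel"
  unfolding mollify_def[abs_def] by measurable

text \<open>Conservation of mass: after exchanging the integrals, the inner one is over a translated
  kernel of mass one.\<close>

lemma tonelli_mollify:
  fixes h \<eta> :: "'a::euclidean_space \<Rightarrow> real"
  assumes \<eta>: "mollifier \<epsilon> \<eta>" and [measurable]: "h \<in> borel_measurable borel" and h: "\<And>y. 0 \<le> h y"
  shows "(\<integral>\<^sup>+x. (\<integral>\<^sup>+y. ennreal (h y * \<eta> (x - y)) \<partial>lborel) \<partial>lborel) = (\<integral>\<^sup>+y. ennreal (h y) \<partial>lborel)"
proof -
  have [measurable]: "\<eta> \<in> borel_measurable borel" by (rule mollifierD[OF \<eta>])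
  have "(\<integral>\<^sup>+x. (\<integral>\<^sup>+y. ennreal (h y * \<eta> (x - y)) \<partial>lborel) \<partial>lborel) = (\<integral>\<^sup>+y. (\<integral>\<^sup>+x. ennreal (h y * \<eta> (x - y)) \<partial>lborel) \<partial>lborel)"
    by (rule lborel_pair.Fubini'[symmetric]) measurable
  also have "\<dots> = (\<integral>\<^sup>+y. ennreal (h y) \<partial>lborel)"
    using h mollifierD(3)[OF \<eta>] mollifier_nn_integral(1)[OF \<eta>]
    by (intro nn_integral_cong) (simp add: ennreal_mult nn_integral_cmult)
  finally show ?thesis .
qed

text \<open>Finiteness of the iterated integral gives this for almost every \<open>x\<close>, which
  suffices for the L^1 estimates.\<close>

lemma AE_integrable_mollify:
  fixes f :: "'a::euclidean_space \<Rightarrow> real"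
  assumes \<eta>: "mollifier \<epsilon> \<eta>" and f: "integrable lborel f"
  shows "AE x in lborel. integrable lborel (\<lambda>y. f y * \<eta> (x - y))"
proof -
  have [measurable]: "\<eta> \<in> borel_measurable borel" "f \<in> borel_measurable borel"
    using mollifierD[OF \<eta>] f by auto
  have "(\<integral>\<^sup>+x. (\<integral>\<^sup>+y. ennreal (\<bar>f y\<bar> * \<eta> (x - y)) \<partial>lborel) \<partial>lborel) \<noteq> \<infinity>"
    using tonelli_mollify[OF \<eta>, of "\<lambda>y. \<bar>f y\<bar>"] f by (simp add: integrable_iff_bounded less_top[symmetric])
  then have "AE x in lborel. (\<integral>\<^sup>+y. ennreal (\<bar>f y\<bar> * \<eta> (x - y)) \<partial>lborel) \<noteq> \<infinity>"
    by (intro nn_integral_PInf_AE) measurable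
  then show ?thesis
    by eventually_elim (use mollifierD(3)[OF \<eta>] in \<open>auto simp: integrable_iff_bounded abs_mult less_top\<close>)
qed

text \<open>Linearity and the triangle inequality under the integral, followed by conservation of
  mass for the modulus of the difference.\<close>

lemma mollify_L1_contraction:
  fixes f g :: "'a::euclidean_space \<Rightarrow> real"
  assumes \<eta>: "mollifier \<epsilon> \<eta>" and f: "integrable lborel f" and g: "integrable lborel g"
  shows "(\<integral>\<^sup>+x. ennreal \<bar>mollify \<eta> f x - mollify \<eta> g x\<bar> \<partial>lborel) \<le> (\<integral>\<^sup>+x. ennreal \<bar>f x - g x\<bar> \<partial>lborel)"
proof -
  have [measurable]: "\<eta> \<in> borel_measurable borel" "f \<in> borel_measurable borel" "g \<in> borel_measurable borel"
    using mollifierD[OF \<eta>] f g by auto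
  have "(\<integral>\<^sup>+x. ennreal \<bar>mollify \<eta> f x - mollify \<eta> g x\<bar> \<partial>lborel) \<le> (\<integral>\<^sup>+x. (\<integral>\<^sup>+y. ennreal (\<bar>f y - g y\<bar> * \<eta> (x - y)) \<partial>lborel) \<partial>lborel)"
  proof (rule nn_integral_mono_AE)
    show "AE x in lborel. ennreal \<bar>mollify \<eta> f x - mollify \<eta> g x\<bar> \<le> (\<integral>\<^sup>+y. ennreal (\<bar>f y - g y\<bar> * \<eta> (x - y)) \<partial>lborel)"
      using AE_integrable_mollify[OF \<eta> f] AE_integrable_mollify[OF \<eta> g]
    proof eventually_elim
      fix x assume i: "integrable lborel (\<lambda>y. f y * \<eta> (x - y))" "integrable lborel (\<lambda>y. g y * \<eta> (x - y))"
      have d: "integrable lborel (\<lambda>y. (f y - g y) * \<eta> (x - y))"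
        using Bochner_Integration.integrable_diff[OF i] by (simp add: left_diff_distrib)
      have "mollify \<eta> f x - mollify \<eta> g x = (\<integral>y. (f y - g y) * \<eta> (x - y) \<partial>lborel)"
        using i by (simp add: mollify_def left_diff_distrib)
      then have "ennreal \<bar>mollify \<eta> f x - mollify \<eta> g x\<bar> \<le> (\<integral>\<^sup>+y. ennreal \<bar>(f y - g y) * \<eta> (x - y)\<bar> \<partial>lborel)"
        using integral_norm_bound_ennreal[OF d] by simp
      then show "ennreal \<bar>mollify \<eta> f x - mollify \<eta> g x\<bar> \<le> (\<integral>\<^sup>+y. ennreal (\<bar>f y - g y\<bar> * \<eta> (x - y)) \<partial>lborel)"
        using mollifierD(3)[OF \<eta>] by (simp add: abs_mult)
    qed
  qed
  also have "\<dots> = (\<integral>\<^sup>+x. ennreal \<bar>f x - g x\<bar> \<partial>lborel)" by (rule tonelli_mollify[OF \<eta>]) auto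
  finally show ?thesis .
qed

definition L1_mollified :: "(nat \<Rightarrow> 'a::euclidean_space \<Rightarrow> real) \<Rightarrow> ('a \<Rightarrow> real) \<Rightarrow> bool" where
  "L1_mollified \<eta> f \<longleftrightarrow> (\<lambda>n. \<integral>\<^sup>+x. ennreal \<bar>mollify (\<eta> n) f x - f x\<bar> \<partial>lborel) \<longlonglongrightarrow> 0"

text \<open>The functions whose mollifications converge form a closed set in L^1: the contraction
  property makes the three-epsilon estimate uniform in n.\<close>

lemma L1_mollified_approx:
  fixes \<eta> :: "nat \<Rightarrow> 'a::euclidean_space \<Rightarrow> real"
  assumes \<eta>: "\<And>n. mollifier (\<epsilon> n) (\<eta> n)" and f: "integrable lborel f"
    and ap: "\<And>e. e > 0 \<Longrightarrow> \<exists>g. integrable lborel g \<and> L1_mollified \<eta> g \<and> (\<integral>\<^sup>+x. ennreal \<bar>f x - g x\<bar> \<partial>lborel) \<le> ennreal e"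
  shows "L1_mollified \<eta> f"
  unfolding L1_mollified_def
proof (rule order_tendstoI)
  fix a :: ennreal assume "0 < a"
  then obtain e where e: "e > 0" "ennreal (3 * e) < a"
  proof -
    obtain b where "0 < b" "b < a" using dense[OF \<open>0 < a\<close>] by blast
    then obtain r where "r > 0" "b = ennreal r"
      by (cases b rule: ennreal_cases) (auto simp: top.not_eq_extremum)
    then show ?thesis using that[of "r / 3"] \<open>b < a\<close> by simp
  qed
  obtain g where g: "integrable lborel g" "L1_mollified \<eta> g" "(\<integral>\<^sup>+x. ennreal \<bar>f x - g x\<bar> \<partial>lborel) \<le> ennreal e"
    using ap[OF e(1)] by blast
  have [measurable]: "\<eta> n \<in> borel_measurable borel" "f \<in> borel_measurable borel" "g \<in> borel_measurable borel" for n
    using mollifierD[OF \<eta>] f g by auto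
  have "\<forall>\<^sub>F n in sequentially. (\<integral>\<^sup>+x. ennreal \<bar>mollify (\<eta> n) g x - g x\<bar> \<partial>lborel) < ennreal e"
    using g(2) e(1) unfolding L1_mollified_def by (auto dest: order_tendstoD(2)[where a = "ennreal e"])
  then show "\<forall>\<^sub>F n in sequentially. (\<integral>\<^sup>+x. ennreal \<bar>mollify (\<eta> n) f x - f x\<bar> \<partial>lborel) < a"
  proof eventually_elim
    case (elim n)
    have "(\<integral>\<^sup>+x. ennreal \<bar>mollify (\<eta> n) f x - f x\<bar> \<partial>lborel) \<le>
        (\<integral>\<^sup>+x. (ennreal \<bar>mollify (\<eta> n) f x - mollify (\<eta> n) g x\<bar> + ennreal \<bar>mollify (\<eta> n) g x - g x\<bar>) + ennreal \<bar>f x - g x\<bar> \<partial>lborel)"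
      by (intro nn_integral_mono) (simp flip: ennreal_plus)
    also have "\<dots> = ((\<integral>\<^sup>+x. ennreal \<bar>mollify (\<eta> n) f x - mollify (\<eta> n) g x\<bar> \<partial>lborel) +
        (\<integral>\<^sup>+x. ennreal \<bar>mollify (\<eta> n) g x - g x\<bar> \<partial>lborel)) + (\<integral>\<^sup>+x. ennreal \<bar>f x - g x\<bar> \<partial>lborel)"
      by (subst nn_integral_add; measurable?)+
    also have "\<dots> \<le> (ennreal e + ennreal e) + ennreal e"
      using mollify_L1_contraction[OF \<eta>[of n] f g(1)] g(3) elim by (intro add_mono) auto
    also have "\<dots> = ennreal (3 * e)" using e by (simp flip: ennreal_plus)
    finally show ?case using e(2) by simp
  qed
qed simp

text \<open>By conservation of mass, the \<open>L\<^sup>1\<close> distance of the indicator and its mollification is twice the mass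
  lost inside \<open>U\<close>, and that mass tends to zero by dominated convergence.\<close>

lemma L1_mollified_open:
  fixes \<eta> :: "nat \<Rightarrow> 'a::euclidean_space \<Rightarrow> real"
  assumes \<eta>: "\<And>n. mollifier (\<epsilon> n) (\<eta> n)" and \<epsilon>: "\<epsilon> \<longlonglongrightarrow> 0" and U: "open U" "emeasure lborel U < \<infinity>"
  shows "L1_mollified \<eta> (indicator U)"
proof -
  have [measurable]: "\<eta> n \<in> borel_measurable borel" "U \<in> sets borel" for n
    using mollifierD[OF \<eta>] U by auto
  have iU: "integrable lborel (indicator U :: 'a \<Rightarrow> real)" using U by (simp add: integrable_indicator_iff)
  define m where "m n = mollify (\<eta> n) (indicator U)" for n
  have [measurable]: "m n \<in> borel_measurable borel" for n unfolding m_def by measurable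
  have int: "integrable lborel (\<lambda>y. indicator U y * \<eta> n (x - y))" for n x
    using integrable_real_mult_indicator[OF _ mollifier_nn_integral(3)[OF \<eta>[of n]], of U x] by (simp add: mult.commute)
  have m01: "0 \<le> m n x" "m n x \<le> 1" for n x
  proof -
    show "0 \<le> m n x" unfolding m_def mollify_def by (rule integral_nonneg_AE) (simp add: mollifierD(3)[OF \<eta>])
    have "m n x \<le> (\<integral>y. \<eta> n (x - y) \<partial>lborel)"
      unfolding m_def mollify_def
      by (rule integral_mono[OF int mollifier_nn_integral(3)[OF \<eta>]])
        (simp add: mollifierD(3)[OF \<eta>] indicator_def)
    then show "m n x \<le> 1" using mollifier_nn_integral(4)[OF \<eta>[of n]] by simp
  qed
  have lim: "(\<lambda>n. m n x) \<longlonglongrightarrow> 1" if xU: "x \<in> U" for x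
  proof -
    obtain r where r: "r > 0" "ball x r \<subseteq> U" by (rule openE[OF U(1) xU])
    have "\<forall>\<^sub>F n in sequentially. \<epsilon> n < r" using order_tendstoD(2)[OF \<epsilon> r(1)] .
    then have "\<forall>\<^sub>F n in sequentially. m n x = 1"
    proof eventually_elim
      case (elim n)
      have "indicator U y * \<eta> n (x - y) = \<eta> n (x - y)" for y
        using r(2) elim mollifierD(4)[OF \<eta>[of n], of "x - y"] by (cases "norm (x - y) < r") (auto simp: dist_norm split: split_indicator)
      then have "(\<lambda>y. indicator U y * \<eta> n (x - y)) = (\<lambda>y. \<eta> n (x - y))" by blast
      then show ?case unfolding m_def mollify_def using mollifier_nn_integral(4)[OF \<eta>[of n]] by simp
    qed
    then show ?thesis by (rule tendsto_eventually)
  qed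
  have nm: "(\<integral>\<^sup>+x. ennreal (m n x) \<partial>lborel) = emeasure lborel U" for n
  proof -
    have "ennreal (m n x) = (\<integral>\<^sup>+y. ennreal (indicator U y * \<eta> n (x - y)) \<partial>lborel)" for x
      unfolding m_def mollify_def using mollifierD(3)[OF \<eta>[of n]]
      by (intro nn_integral_eq_integral[symmetric] int) auto
    then show ?thesis using tonelli_mollify[OF \<eta>[of n], of "indicator U"] by (simp add: ennreal_indicator)
  qed
  have im: "integrable lborel (m n)" for n
    using nm[of n] U m01 by (intro integrableI_nonneg) auto
  have Im: "(\<integral>x. m n x \<partial>lborel) = (\<integral>x. indicator U x \<partial>lborel)" for n
  proof -
    have e: "ennreal (\<integral>x. m n x \<partial>lborel) = emeasure lborel U"
      using nn_integral_eq_integral[OF im[of n]] nm[of n] m01(1) by simp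
    have "0 \<le> (\<integral>x. m n x \<partial>lborel)" using m01(1) by (intro integral_nonneg_AE) auto
    then show ?thesis by (simp add: measure_def e[symmetric])
  qed
  have i1: "integrable lborel (\<lambda>x. indicator U x * (1 - m n x))" for n
    by (rule Bochner_Integration.integrable_bound[OF iU]) (use m01 in \<open>auto split: split_indicator\<close>)
  have eq: "\<bar>m n x - indicator U x\<bar> = 2 * (indicator U x * (1 - m n x)) + (m n x - indicator U x)" for n x
    using m01[of n x] by (auto split: split_indicator)
  have "(\<integral>\<^sup>+x. ennreal \<bar>m n x - indicator U x\<bar> \<partial>lborel) = ennreal (2 * (\<integral>x. indicator U x * (1 - m n x) \<partial>lborel))" for n
  proof -
    have "integrable lborel (\<lambda>x. \<bar>m n x - indicator U x\<bar>)" using im iU by auto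
    then have "(\<integral>\<^sup>+x. ennreal \<bar>m n x - indicator U x\<bar> \<partial>lborel) = ennreal (\<integral>x. \<bar>m n x - indicator U x\<bar> \<partial>lborel)"
      by (intro nn_integral_eq_integral) auto
    also have "(\<integral>x. \<bar>m n x - indicator U x\<bar> \<partial>lborel) = 2 * (\<integral>x. indicator U x * (1 - m n x) \<partial>lborel)"
      unfolding eq using i1 im iU Im by simp
    finally show ?thesis .
  qed
  moreover have "(\<lambda>n. \<integral>x. indicator U x * (1 - m n x) \<partial>lborel) \<longlonglongrightarrow> (\<integral>(x::'a). 0 \<partial>lborel)"
  proof (rule integral_dominated_convergence[OF _ _ iU])
    show "AE x in lborel. (\<lambda>n. indicator U x * (1 - m n x)) \<longlonglongrightarrow> 0"
    proof (rule AE_I2)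
      fix x show "(\<lambda>n. indicator U x * (1 - m n x)) \<longlonglongrightarrow> 0"
      proof (cases "x \<in> U")
        case True
        then show ?thesis using tendsto_diff[OF tendsto_const[of 1] lim[OF True]] by simp
      qed simp
    qed
  qed (use m01 in \<open>auto split: split_indicator\<close>)
  then have "(\<lambda>n. ennreal (2 * (\<integral>x. indicator U x * (1 - m n x) \<partial>lborel))) \<longlonglongrightarrow> ennreal (2 * 0)"
    by (intro tendsto_ennrealI tendsto_mult_left) simp
  ultimately show ?thesis unfolding L1_mollified_def m_def[symmetric] by simp
qed

text \<open>Induction over integrable functions: indicators are approximated in L^1 by open sets
  through outer regularity, sums follow from the triangle inequality, and dominated limits from
  closedness in L^1.\<close>

lemma L1_mollified_integrable:
  fixes \<eta> :: "nat \<Rightarrow> 'a::euclidean_space \<Rightarrow> real"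
  assumes \<eta>: "\<And>n. mollifier (\<epsilon> n) (\<eta> n)" and \<epsilon>: "\<epsilon> \<longlonglongrightarrow> 0" and f: "integrable lborel f"
  shows "L1_mollified \<eta> f"
  using f
proof (induction f rule: integrable_induct)
  case (base A c)
  note A = base
  have [measurable]: "A \<in> sets borel" using A by simp
  show ?case
  proof (rule L1_mollified_approx[OF \<eta>])
    show "integrable lborel (\<lambda>x. indicator A x *\<^sub>R c)" using A by (simp add: integrable_indicator_iff)
    fix e :: real assume e: "e > 0"
    \<comment> \<open>The added 1 covers the case c = 0.\<close>
    define e' where "e' = e / (\<bar>c\<bar> + 1)"
    have e': "e' > 0" "\<bar>c\<bar> * e' \<le> e" using e by (auto simp: e'_def field_simps)
    obtain U where U: "open U" "A \<subseteq> U" "emeasure lborel (U - A) < ennreal e'"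
      using outer_regular_lborel[of A e'] A e' by auto
    have [measurable]: "U \<in> sets borel" using U by auto
    have UA: "emeasure lborel U = emeasure lborel A + emeasure lborel (U - A)"
      using U A by (subst plus_emeasure) (auto intro!: arg_cong[where f = "emeasure lborel"])
    have Ufin: "emeasure lborel U < \<infinity>"
      unfolding UA using A U(3) by (auto simp: ennreal_add_eq_top less_top[symmetric])
    have LU: "L1_mollified \<eta> (indicator U)" by (rule L1_mollified_open[OF \<eta> \<epsilon> U(1) Ufin])
    have iU: "integrable lborel (indicator U :: 'a \<Rightarrow> real)" using Ufin by (simp add: integrable_indicator_iff)
    show "\<exists>g. integrable lborel g \<and> L1_mollified \<eta> g \<and> (\<integral>\<^sup>+x. ennreal \<bar>indicator A x *\<^sub>R c - g x\<bar> \<partial>lborel) \<le> ennreal e"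
    proof (intro exI[of _ "\<lambda>x. indicator U x * c"] conjI)
      show "integrable lborel (\<lambda>x. indicator U x * c)" using iU by simp
      show "L1_mollified \<eta> (\<lambda>x. indicator U x * c)"
      proof -
        have [measurable]: "\<eta> n \<in> borel_measurable borel" for n using mollifierD[OF \<eta>] by auto
        have "mollify (\<eta> n) (\<lambda>x. indicator U x * c) x = c * mollify (\<eta> n) (indicator U) x" for n x
          by (simp add: mollify_def mult.assoc mult.left_commute[of _ c])
        then have "(\<integral>\<^sup>+x. ennreal \<bar>mollify (\<eta> n) (\<lambda>x. indicator U x * c) x - indicator U x * c\<bar> \<partial>lborel) =
            ennreal \<bar>c\<bar> * (\<integral>\<^sup>+x. ennreal \<bar>mollify (\<eta> n) (indicator U) x - indicator U x\<bar> \<partial>lborel)" for n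
          by (subst nn_integral_cmult[symmetric])
            (auto intro!: nn_integral_cong simp: ennreal_mult'[symmetric] abs_mult[symmetric] right_diff_distrib mult.commute)
        moreover have "(\<lambda>n. ennreal \<bar>c\<bar> * (\<integral>\<^sup>+x. ennreal \<bar>mollify (\<eta> n) (indicator U) x - indicator U x\<bar> \<partial>lborel)) \<longlonglongrightarrow> ennreal \<bar>c\<bar> * 0"
          using LU unfolding L1_mollified_def by (intro ennreal_tendsto_cmult) auto
        ultimately show ?thesis unfolding L1_mollified_def by simp
      qed
      have "(\<integral>\<^sup>+x. ennreal \<bar>indicator A x *\<^sub>R c - indicator U x * c\<bar> \<partial>lborel) = (\<integral>\<^sup>+x. ennreal \<bar>c\<bar> * indicator (U - A) x \<partial>lborel)"
        using U(2) by (intro nn_integral_cong) (auto split: split_indicator)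
      also have "\<dots> = ennreal \<bar>c\<bar> * emeasure lborel (U - A)" by (simp add: nn_integral_cmult_indicator)
      also have "\<dots> \<le> ennreal \<bar>c\<bar> * ennreal e'" using U(3) by (intro mult_left_mono) auto
      also have "\<dots> \<le> ennreal e" using e' by (simp add: ennreal_leI flip: ennreal_mult')
      finally show "(\<integral>\<^sup>+x. ennreal \<bar>indicator A x *\<^sub>R c - indicator U x * c\<bar> \<partial>lborel) \<le> ennreal e" .
    qed
  qed
next
  case (add f g)
  have [measurable]: "\<eta> n \<in> borel_measurable borel" "f \<in> borel_measurable borel" "g \<in> borel_measurable borel" for n
    using mollifierD[OF \<eta>] add by auto
  have "(\<integral>\<^sup>+x. ennreal \<bar>mollify (\<eta> n) (\<lambda>x. f x + g x) x - (f x + g x)\<bar> \<partial>lborel) \<le>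
      (\<integral>\<^sup>+x. ennreal \<bar>mollify (\<eta> n) f x - f x\<bar> \<partial>lborel) + (\<integral>\<^sup>+x. ennreal \<bar>mollify (\<eta> n) g x - g x\<bar> \<partial>lborel)" for n
  proof -
    have "AE x in lborel. mollify (\<eta> n) (\<lambda>x. f x + g x) x = mollify (\<eta> n) f x + mollify (\<eta> n) g x"
      using AE_integrable_mollify[OF \<eta>[of n] add(1)] AE_integrable_mollify[OF \<eta>[of n] add(2)]
      by eventually_elim (simp add: mollify_def distrib_right)
    then have ae: "AE x in lborel. ennreal \<bar>mollify (\<eta> n) (\<lambda>x. f x + g x) x - (f x + g x)\<bar> \<le>
        ennreal \<bar>mollify (\<eta> n) f x - f x\<bar> + ennreal \<bar>mollify (\<eta> n) g x - g x\<bar>"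
      by eventually_elim (simp flip: ennreal_plus)
    have "(\<integral>\<^sup>+x. ennreal \<bar>mollify (\<eta> n) (\<lambda>x. f x + g x) x - (f x + g x)\<bar> \<partial>lborel) \<le>
      (\<integral>\<^sup>+x. ennreal \<bar>mollify (\<eta> n) f x - f x\<bar> + ennreal \<bar>mollify (\<eta> n) g x - g x\<bar> \<partial>lborel)"
      by (rule nn_integral_mono_AE[OF ae])
    also have "\<dots> = (\<integral>\<^sup>+x. ennreal \<bar>mollify (\<eta> n) f x - f x\<bar> \<partial>lborel) + (\<integral>\<^sup>+x. ennreal \<bar>mollify (\<eta> n) g x - g x\<bar> \<partial>lborel)"
      by (rule nn_integral_add) measurable
    finally show ?thesis .
  qed
  then have le: "\<forall>\<^sub>F n in sequentially. (\<integral>\<^sup>+x. ennreal \<bar>mollify (\<eta> n) (\<lambda>x. f x + g x) x - (f x + g x)\<bar> \<partial>lborel) \<le>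
      (\<integral>\<^sup>+x. ennreal \<bar>mollify (\<eta> n) f x - f x\<bar> \<partial>lborel) + (\<integral>\<^sup>+x. ennreal \<bar>mollify (\<eta> n) g x - g x\<bar> \<partial>lborel)"
    by (intro always_eventually allI)
  have "L1_mollified \<eta> f" "L1_mollified \<eta> g" using add by simp_all
  from tendsto_add[OF this[unfolded L1_mollified_def]]
  have lim: "(\<lambda>n. (\<integral>\<^sup>+x. ennreal \<bar>mollify (\<eta> n) f x - f x\<bar> \<partial>lborel) + (\<integral>\<^sup>+x. ennreal \<bar>mollify (\<eta> n) g x - g x\<bar> \<partial>lborel)) \<longlonglongrightarrow> 0"
    by simp
  show ?case unfolding L1_mollified_def
    by (rule tendsto_sandwich[OF always_eventually[OF allI] le tendsto_const lim]) simp
next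
  case (lim f s)
  have s: "integrable lborel (s i)" "L1_mollified \<eta> (s i)" and sl: "(\<lambda>i. s i x) \<longlonglongrightarrow> f x"
    and sb: "\<bar>s i x\<bar> \<le> 2 * \<bar>f x\<bar>" and f: "integrable lborel f" for i x
    using lim by auto
  have [measurable]: "f \<in> borel_measurable borel" "s i \<in> borel_measurable borel" for i
    using s f by auto
  show ?case
  proof (rule L1_mollified_approx[OF \<eta> f])
    fix e :: real assume e: "e > 0"
    \<comment> \<open>The approximants are bounded by twice the modulus of \<open>f\<close>, hence
      the factor 3 in the majorant.\<close>
    have "(\<lambda>i. \<integral>x. \<bar>f x - s i x\<bar> \<partial>lborel) \<longlonglongrightarrow> (\<integral>(x::'a). 0 \<partial>lborel)"
    proof (rule integral_dominated_convergence[where w = "\<lambda>x. 3 * \<bar>f x\<bar>"])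
      show "AE x in lborel. (\<lambda>i. \<bar>f x - s i x\<bar>) \<longlonglongrightarrow> 0"
      proof (rule AE_I2)
        fix x
        have "(\<lambda>i. \<bar>f x - s i x\<bar>) \<longlonglongrightarrow> \<bar>f x - f x\<bar>" using sl[of x] by (intro tendsto_intros)
        then show "(\<lambda>i. \<bar>f x - s i x\<bar>) \<longlonglongrightarrow> 0" by simp
      qed
      show "AE x in lborel. norm \<bar>f x - s i x\<bar> \<le> 3 * \<bar>f x\<bar>" for i
      proof (rule AE_I2)
        fix x show "norm \<bar>f x - s i x\<bar> \<le> 3 * \<bar>f x\<bar>" using sb[of i x] by simp
      qed
    qed (use f in auto)
    then have "\<forall>\<^sub>F i in sequentially. (\<integral>x. \<bar>f x - s i x\<bar> \<partial>lborel) < e" using e by (auto dest: order_tendstoD(2))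
    then obtain i where i: "(\<integral>x. \<bar>f x - s i x\<bar> \<partial>lborel) < e" by (auto simp: eventually_sequentially)
    have "(\<integral>\<^sup>+x. ennreal \<bar>f x - s i x\<bar> \<partial>lborel) = ennreal (\<integral>x. \<bar>f x - s i x\<bar> \<partial>lborel)"
      using s(1)[of i] f by (intro nn_integral_eq_integral) auto
    then show "\<exists>g. integrable lborel g \<and> L1_mollified \<eta> g \<and> (\<integral>\<^sup>+x. ennreal \<bar>f x - g x\<bar> \<partial>lborel) \<le> ennreal e"
      using i s[of i] by (intro exI[of _ "s i"]) (auto intro!: ennreal_leI)
  qed
qed

text \<open>The Borel counterpart of \<open>locally_integrable\<close>; centred balls suffice
  because every compact set lies in one.\<close>

definition loc_int :: "('a::euclidean_space \<Rightarrow> real) \<Rightarrow> bool" where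
  "loc_int u \<longleftrightarrow> u \<in> borel_measurable borel \<and> (\<forall>R. integrable lborel (\<lambda>x. indicator (cball 0 R) x * u x))"

section \<open>Continuity, derivatives and pointwise convergence of convolutions\<close>

lemma bounded_continuous_support:
  fixes w :: "'a::euclidean_space \<Rightarrow> real"
  assumes "continuous_on UNIV w" "\<And>z. R \<le> norm z \<Longrightarrow> w z = 0"
  obtains C where "C \<ge> 0" "\<And>z. \<bar>w z\<bar> \<le> C"
proof -
  have "compact (w ` cball 0 R)"
    by (intro compact_continuous_image continuous_on_subset[OF assms(1)]) auto
  then have "bounded (w ` cball 0 R)" by (rule compact_imp_bounded)
  then obtain C where C: "\<forall>y \<in> w ` cball 0 R. norm y \<le> C" unfolding bounded_iff by blast
  show ?thesis
  proof (rule that[of "max C 0"])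
    fix z show "\<bar>w z\<bar> \<le> max C 0"
    proof (cases "norm z \<le> R")
      case True
      then have "norm (w z) \<le> C" using C by auto
      then show ?thesis by auto
    next
      case False
      then show ?thesis using assms(2)[of z] by auto
    qed
  qed simp
qed

text \<open>Common to continuity and differentiation: while the base point moves in a bounded set,
  the translated kernels are supported in one ball, where \<open>u\<close> times their bound is
  integrable.\<close>

lemma convolution_dominated:
  fixes u w :: "'a::euclidean_space \<Rightarrow> real"
  assumes u: "loc_int u" and b: "\<And>n y. \<bar>f n y\<bar> \<le> \<bar>u y\<bar> * C * indicator (cball 0 R) y" and C: "C \<ge> 0"
    and f: "\<And>n. f n \<in> borel_measurable borel" and l: "\<And>y. (\<lambda>n. f n y) \<longlonglongrightarrow> g y"
  shows "(\<lambda>n. \<integral>y. f n y \<partial>lborel) \<longlonglongrightarrow> (\<integral>y. g y \<partial>lborel)"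
proof (rule integral_dominated_convergence[where w = "\<lambda>y. \<bar>indicator (cball 0 R) y * u y\<bar> * C"])
  show "g \<in> borel_measurable lborel"
    by (rule borel_measurable_LIMSEQ_real[OF l]) (use f in simp)
  show "integrable lborel (\<lambda>y. \<bar>indicator (cball 0 R) y * u y\<bar> * C)"
    using u unfolding loc_int_def by auto
  show "AE x in lborel. norm (f n x) \<le> \<bar>indicator (cball 0 R) x * u x\<bar> * C" for n
    using b[of n] by (intro AE_I2) (simp add: abs_mult ac_simps)
qed (use f l in auto)

lemma convolution_integrable:
  fixes u w :: "'a::euclidean_space \<Rightarrow> real"
  assumes u: "loc_int u" and w: "continuous_on UNIV w" "\<And>z. \<epsilon> \<le> norm z \<Longrightarrow> w z = 0"
  shows "integrable lborel (\<lambda>y. u y * w (x - y))"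
proof -
  obtain C where C: "C \<ge> 0" "\<And>z. \<bar>w z\<bar> \<le> C" using bounded_continuous_support[OF w] by blast
  have [measurable]: "w \<in> borel_measurable borel" "u \<in> borel_measurable borel"
    using w(1) u borel_measurable_continuous_onI by (auto simp: loc_int_def)
  have "integrable lborel (\<lambda>y. indicator (cball 0 (norm x + \<epsilon>)) y * u y)" using u by (simp add: loc_int_def)
  then have i: "integrable lborel (\<lambda>y. C * (indicator (cball 0 (norm x + \<epsilon>)) y * u y))" by simp
  show ?thesis
  proof (rule Bochner_Integration.integrable_bound[OF i])
    show "AE y in lborel. norm (u y * w (x - y)) \<le> norm (C * (indicator (cball 0 (norm x + \<epsilon>)) y * u y))"
    proof (rule AE_I2)
      fix y show "norm (u y * w (x - y)) \<le> norm (C * (indicator (cball 0 (norm x + \<epsilon>)) y * u y))"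
      proof (cases "norm y \<le> norm x + \<epsilon>")
        case True
        then show ?thesis using C(1) C(2)[of "x - y"]
          by (simp add: abs_mult mult.commute[of "\<bar>u y\<bar>"] mult_right_mono)
      next
        case False
        then have "\<epsilon> \<le> norm (x - y)" using norm_triangle_ineq2[of y x] by (simp add: norm_minus_commute)
        then show ?thesis using w(2) by simp
      qed
    qed
  qed measurable
qed

lemma convolution_continuous:
  fixes u w :: "'a::euclidean_space \<Rightarrow> real"
  assumes u: "loc_int u" and w: "continuous_on UNIV w" "\<And>z. \<epsilon> \<le> norm z \<Longrightarrow> w z = 0"
  shows "continuous_on UNIV (\<lambda>x. \<integral>y. u y * w (x - y) \<partial>lborel)"
  unfolding continuous_on_sequentially comp_def
proof (intro allI ballI impI)
  fix X :: "nat \<Rightarrow> 'a" and x assume "(\<forall>n. X n \<in> UNIV) \<and> X \<longlonglongrightarrow> x"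
  then have X: "X \<longlonglongrightarrow> x" by simp
  obtain C where C: "C \<ge> 0" "\<And>z. \<bar>w z\<bar> \<le> C" using bounded_continuous_support[OF w] by blast
  have [measurable]: "w \<in> borel_measurable borel" "u \<in> borel_measurable borel"
    using w(1) u borel_measurable_continuous_onI by (auto simp: loc_int_def)
  have "Bseq X" using X by (intro convergent_imp_Bseq convergentI)
  then obtain H where H: "H > 0" "\<And>n. norm (X n) \<le> H" by (auto elim: BseqE)
  show "(\<lambda>n. \<integral>y. u y * w (X n - y) \<partial>lborel) \<longlonglongrightarrow> (\<integral>y. u y * w (x - y) \<partial>lborel)"
  proof (rule convolution_dominated[OF u _ C(1), where R = "H + \<epsilon>"])
    fix n y
    show "\<bar>u y * w (X n - y)\<bar> \<le> \<bar>u y\<bar> * C * indicator (cball 0 (H + \<epsilon>)) y"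
    proof (cases "norm y \<le> H + \<epsilon>")
      case True
      then show ?thesis using C(2)[of "X n - y"] by (simp add: abs_mult mult_left_mono)
    next
      case False
      then have "\<epsilon> \<le> norm (X n - y)" using norm_triangle_ineq2[of y "X n"] H(2)[of n] by (simp add: norm_minus_commute)
      then show ?thesis using w(2) C by simp
    qed
    show "(\<lambda>n. u y * w (X n - y)) \<longlonglongrightarrow> u y * w (x - y)"
      using w(1) X by (intro tendsto_mult tendsto_const isCont_tendsto_compose[where g = w] tendsto_diff)
        (auto simp: continuous_on_eq_continuous_at)
  qed measurable
qed

text \<open>All differentiation falls on the kernel. The mean value inequality bounds its difference
  quotients by the supremum of the derivative \<open>w\<close>, which supplies the majorant for
  dominated convergence.\<close>

lemma convolution_deriv:
  fixes u \<eta> w :: "'a::euclidean_space \<Rightarrow> real"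
  assumes u: "loc_int u" and \<eta>: "continuous_on UNIV \<eta>" "\<And>z. \<epsilon> \<le> norm z \<Longrightarrow> \<eta> z = 0"
    and w: "continuous_on UNIV w" "\<And>z. \<epsilon> \<le> norm z \<Longrightarrow> w z = 0"
    and d: "\<And>z. ((\<lambda>s. \<eta> (z + s *\<^sub>R b)) has_real_derivative w z) (at 0)"
  shows "((\<lambda>s. \<integral>y. u y * \<eta> (x + s *\<^sub>R b - y) \<partial>lborel) has_real_derivative (\<integral>y. u y * w (x - y) \<partial>lborel)) (at 0)"
  unfolding DERIV_def tendsto_at_iff_sequentially comp_def
proof (intro allI impI)
  fix X :: "nat \<Rightarrow> real" assume X: "\<forall>i. X i \<in> UNIV - {0}" "X \<longlonglongrightarrow> 0"
  obtain C where C: "C \<ge> 0" "\<And>z. \<bar>w z\<bar> \<le> C" using bounded_continuous_support[OF w] by blast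
  have [measurable]: "w \<in> borel_measurable borel" "u \<in> borel_measurable borel" "\<eta> \<in> borel_measurable borel"
    using w(1) \<eta>(1) u borel_measurable_continuous_onI by (auto simp: loc_int_def)
  have "Bseq X" using X by (intro convergent_imp_Bseq convergentI)
  then obtain H where H: "H > 0" "\<And>n. norm (X n) \<le> H" by (auto elim: BseqE)
  have lip: "\<bar>\<eta> (z + h *\<^sub>R b) - \<eta> z\<bar> \<le> C * \<bar>h\<bar>" for z h
  proof -
    have "norm (\<eta> (z + h *\<^sub>R b) - \<eta> (z + 0 *\<^sub>R b)) \<le> C * norm (h - 0)"
    proof (rule field_differentiable_bound[where S = UNIV and f' = "\<lambda>s. w (z + s *\<^sub>R b)"])
      show "((\<lambda>s. \<eta> (z + s *\<^sub>R b)) has_field_derivative w (z + s *\<^sub>R b)) (at s within UNIV)" for s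
        using has_real_derivative_line[of \<eta> b w, OF d] by simp
    qed (use C in auto)
    then show ?thesis by simp
  qed
  \<comment> \<open>Large enough that every \<open>y\<close> outside this ball has distance at least
    \<open>\<epsilon>\<close> from \<open>x\<close> and from all points
    \<open>x + X n *\<^sub>R b\<close>.\<close>
  define R where "R = norm x + H * norm b + \<epsilon>"
  have eq: "((\<integral>y. u y * \<eta> (x + (0 + X n) *\<^sub>R b - y) \<partial>lborel) - (\<integral>y. u y * \<eta> (x + 0 *\<^sub>R b - y) \<partial>lborel)) / X n
      = (\<integral>y. u y * ((\<eta> ((x - y) + X n *\<^sub>R b) - \<eta> (x - y)) / X n) \<partial>lborel)" for n
  proof -
    have "(\<integral>y. u y * ((\<eta> ((x - y) + X n *\<^sub>R b) - \<eta> (x - y)) / X n) \<partial>lborel) =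
       (\<integral>y. (u y * \<eta> ((x + X n *\<^sub>R b) - y) - u y * \<eta> (x - y)) / X n \<partial>lborel)"
      by (intro Bochner_Integration.integral_cong) (auto simp: algebra_simps diff_divide_distrib)
    also have "\<dots> = ((\<integral>y. u y * \<eta> (x + X n *\<^sub>R b - y) \<partial>lborel) - (\<integral>y. u y * \<eta> (x - y) \<partial>lborel)) / X n"
      by (simp add: convolution_integrable[OF u \<eta>])
    finally have "(\<integral>y. u y * ((\<eta> ((x - y) + X n *\<^sub>R b) - \<eta> (x - y)) / X n) \<partial>lborel) =
        ((\<integral>y. u y * \<eta> (x + X n *\<^sub>R b - y) \<partial>lborel) - (\<integral>y. u y * \<eta> (x - y) \<partial>lborel)) / X n" .
    from this[symmetric] show ?thesis by (simp only: add_0_left scaleR_zero_left add_0_right)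
  qed
  show "(\<lambda>n. ((\<integral>y. u y * \<eta> (x + (0 + X n) *\<^sub>R b - y) \<partial>lborel) - (\<integral>y. u y * \<eta> (x + 0 *\<^sub>R b - y) \<partial>lborel)) / X n)
      \<longlonglongrightarrow> (\<integral>y. u y * w (x - y) \<partial>lborel)"
    unfolding eq
  proof (rule convolution_dominated[OF u _ C(1), where R = R])
    fix n y
    have Xn: "X n \<noteq> 0" using X(1) by auto
    show "\<bar>u y * ((\<eta> ((x - y) + X n *\<^sub>R b) - \<eta> (x - y)) / X n)\<bar> \<le> \<bar>u y\<bar> * C * indicator (cball 0 R) y"
    proof (cases "norm y \<le> R")
      case True
      have "\<bar>(\<eta> ((x - y) + X n *\<^sub>R b) - \<eta> (x - y)) / X n\<bar> \<le> C"
        using lip[of "x - y" "X n"] Xn by (simp add: divide_le_eq)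
      from mult_left_mono[OF this, of "\<bar>u y\<bar>"] show ?thesis using True by (simp add: abs_mult)
    next
      case False
      have "norm (X n *\<^sub>R b) \<le> H * norm b" using H(2)[of n] by (simp add: mult_right_mono)
      moreover have "norm y \<le> norm (x - y + X n *\<^sub>R b) + norm x + norm (X n *\<^sub>R b)"
        using norm_triangle_ineq[of "- (x - y + X n *\<^sub>R b)" "x + X n *\<^sub>R b"] norm_triangle_ineq[of x "X n *\<^sub>R b"]
        by (simp only: norm_minus_cancel) (simp add: algebra_simps)
      moreover have "norm y \<le> norm (x - y) + norm x"
        using norm_triangle_ineq2[of y x] by (simp add: norm_minus_commute)
      ultimately have "\<epsilon> \<le> norm (x - y + X n *\<^sub>R b)" "\<epsilon> \<le> norm (x - y)"
        using False H(1) norm_ge_zero[of b] mult_nonneg_nonneg[of H "norm b"] unfolding R_def by linarith+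
      then show ?thesis using \<eta>(2) C by simp
    qed
    have "((\<lambda>h. (\<eta> (x - y + h *\<^sub>R b) - \<eta> (x - y)) / h) \<longlongrightarrow> w (x - y)) (at 0)"
      using d[of "x - y"] by (simp add: DERIV_def)
    then have "(\<lambda>n. (\<eta> (x - y + X n *\<^sub>R b) - \<eta> (x - y)) / X n) \<longlonglongrightarrow> w (x - y)"
      using X unfolding tendsto_at_iff_sequentially comp_def by auto
    then show "(\<lambda>n. u y * ((\<eta> (x - y + X n *\<^sub>R b) - \<eta> (x - y)) / X n)) \<longlonglongrightarrow> u y * w (x - y)"
      by (intro tendsto_mult tendsto_const)
  qed measurable
qed

text \<open>The derivative vanishes where the kernel vanishes in a neighbourhood, hence the margin 1
  in the support. The sign in the last clause comes from differentiating in \<open>y\<close> rather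
  than in the argument of the kernel.\<close>

lemma mollifier_deriv:
  fixes \<eta> :: "'a::euclidean_space \<Rightarrow> real"
  assumes \<eta>: "mollifier \<epsilon> \<eta>" and b: "b \<in> Basis"
  obtains w where "continuous_on UNIV w" "\<And>z. \<epsilon> + 1 \<le> norm z \<Longrightarrow> w z = 0"
    "\<And>z. ((\<lambda>s. \<eta> (z + s *\<^sub>R b)) has_real_derivative w z) (at 0)"
    "\<And>x y. frechet_derivative (\<lambda>y. \<eta> (x - y)) (at y) b = - w (x - y)"
proof -
  \<comment> \<open>A mollifier has its smoothness recorded for reflected translates, so the kernel
    is differentiated through its reflection.\<close>
  define \<zeta> where "\<zeta> y = \<eta> (0 - y)" for y
  have t: "test_function \<zeta>" unfolding \<zeta>_def by (rule mollifierD(7)[OF \<eta>])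
  have "C_k 1 \<zeta>" using t by (simp add: test_function_def)
  then have diff: "\<And>x. \<zeta> differentiable (at x)" and cont: "continuous_on UNIV (\<lambda>x. frechet_derivative \<zeta> (at x) b)"
    using b by (auto simp: One_nat_def)
  have D: "(\<zeta> has_derivative frechet_derivative \<zeta> (at x)) (at x)" for x
    using diff frechet_derivative_works by blast
  define w where "w z = - frechet_derivative \<zeta> (at (- z)) b" for z
  have \<eta>\<zeta>: "\<eta> z = \<zeta> (- z)" for z by (simp add: \<zeta>_def)
  show ?thesis
  proof (rule that[of w])
    show "continuous_on UNIV w" unfolding w_def[abs_def]
      by (intro continuous_intros continuous_on_compose2[OF cont]) auto
    show "w z = 0" if z: "\<epsilon> + 1 \<le> norm z" for z
    proof -
      have "((\<lambda>_. 0) has_derivative (\<lambda>_. 0)) (at (- z))" by simp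
      then have "(\<zeta> has_derivative (\<lambda>_. 0)) (at (- z))"
      proof (rule has_derivative_transform_within_open[where s = "ball (- z) 1"])
        fix y assume "y \<in> ball (- z) 1"
        then have "norm (- z - y) < 1" by (simp add: dist_norm)
        then have "\<epsilon> \<le> norm (- y)" using z norm_triangle_ineq2[of "- z" "- z - y"] by simp
        then show "0 = \<zeta> y" using mollifierD(4)[OF \<eta>, of "- y"] by (simp add: \<zeta>_def)
      qed auto
      from fun_cong[OF frechet_derivative_at[OF this], of b] show ?thesis by (simp add: w_def)
    qed
    show "((\<lambda>s. \<eta> (z + s *\<^sub>R b)) has_real_derivative w z) (at 0)" for z
    proof -
      have "((\<lambda>s. - z + s *\<^sub>R (- b)) has_derivative (\<lambda>s. s *\<^sub>R (- b))) (at 0)"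
        by (auto intro!: derivative_eq_intros)
      from has_derivative_compose[OF this, of \<zeta> "frechet_derivative \<zeta> (at (- z))"] D[of "- z"]
      have "((\<lambda>s. \<zeta> (- z + s *\<^sub>R (- b))) has_derivative (\<lambda>s. frechet_derivative \<zeta> (at (- z)) (s *\<^sub>R (- b)))) (at 0)"
        by simp
      moreover have "frechet_derivative \<zeta> (at (- z)) (s *\<^sub>R (- b)) = w z * s" for s
        using linear_scale[OF linear_frechet_derivative[OF diff], of "- z" "- s" b] by (simp add: w_def)
      ultimately show ?thesis unfolding has_field_derivative_def \<eta>\<zeta> by simp
    qed
    show "frechet_derivative (\<lambda>y. \<eta> (x - y)) (at y) b = - w (x - y)" for x y
    proof -
      have "((\<lambda>y. y - x) has_derivative (\<lambda>h. h)) (at y)" by (auto intro!: derivative_eq_intros)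
      from has_derivative_compose[OF this, of \<zeta> "frechet_derivative \<zeta> (at (y - x))"] D[of "y - x"]
      have "((\<lambda>y. \<zeta> (y - x)) has_derivative frechet_derivative \<zeta> (at (y - x))) (at y)"
        by simp
      then have "frechet_derivative (\<lambda>y. \<zeta> (y - x)) (at y) = frechet_derivative \<zeta> (at (y - x))"
        using frechet_derivative_at by metis
      then show ?thesis by (simp add: w_def \<eta>\<zeta>)
    qed
  qed
qed

text \<open>Convergence in L^1 gives almost everywhere convergence along a subsequence. To obtain an
  integrable function, \<open>u\<close> is cut off at radius R + 1; at points of norm below R this
  is invisible, since the kernels live in the unit ball. The subsequence may depend on R, and each
  application works on one ball at a time.\<close>

lemma mollify_convergence:
  fixes u :: "'a::euclidean_space \<Rightarrow> real"
  assumes u: "loc_int u" and \<eta>: "\<And>n. mollifier (1 / real (Suc n)) (\<eta> n)"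
  shows "\<exists>r::nat \<Rightarrow> nat. strict_mono r \<and> (AE x in lborel. norm x < R \<longrightarrow> (\<lambda>n. mollify (\<eta> (r n)) u x) \<longlonglongrightarrow> u x)"
proof -
  define f where "f x = indicator (cball 0 (R + 1)) x * u x" for x
  have f: "integrable lborel f" using u by (simp add: f_def[abs_def] loc_int_def)
  have [measurable]: "\<eta> n \<in> borel_measurable borel" "f \<in> borel_measurable borel" for n
    using mollifierD[OF \<eta>] f by auto
  have "(\<lambda>n. 1 / real (Suc n)) \<longlonglongrightarrow> 0"
    by (intro tendsto_divide_0[OF tendsto_const] filterlim_at_top_imp_at_infinity
        filterlim_compose[OF filterlim_real_sequentially filterlim_Suc])
  then have L: "L1_mollified \<eta> f" by (rule L1_mollified_integrable[OF \<eta> _ f])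
  have im: "integrable lborel (mollify (\<eta> n) f)" for n
  proof (rule integrableI_bounded)
    have "mollify (\<eta> n) (\<lambda>_. 0) x = 0" for x by (simp add: mollify_def)
    then have "(\<integral>\<^sup>+x. ennreal (norm (mollify (\<eta> n) f x)) \<partial>lborel) \<le> (\<integral>\<^sup>+x. ennreal (norm (f x)) \<partial>lborel)"
      using mollify_L1_contraction[OF \<eta>[of n] f, of "\<lambda>_. 0"] by simp
    then show "(\<integral>\<^sup>+x. ennreal (norm (mollify (\<eta> n) f x)) \<partial>lborel) < \<infinity>"
      using f by (auto simp: integrable_iff_bounded intro: le_less_trans)
  qed measurable
  have "(\<lambda>n. \<integral>x. norm (mollify (\<eta> n) f x - f x) \<partial>lborel) \<longlonglongrightarrow> 0"
  proof -
    have "(\<integral>\<^sup>+x. ennreal \<bar>mollify (\<eta> n) f x - f x\<bar> \<partial>lborel) = ennreal (\<integral>x. norm (mollify (\<eta> n) f x - f x) \<partial>lborel)" for n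
      using im[of n] f by (simp add: nn_integral_eq_integral)
    then have "(\<lambda>n. ennreal (\<integral>x. norm (mollify (\<eta> n) f x - f x) \<partial>lborel)) \<longlonglongrightarrow> ennreal 0"
      using L by (simp add: L1_mollified_def)
    then show ?thesis by (rule tendsto_ennrealD) (auto intro!: always_eventually integral_nonneg_AE)
  qed
  from tendsto_L1_AE_subseq[OF Bochner_Integration.integrable_diff[OF im f] this]
  obtain r :: "nat \<Rightarrow> nat" where r: "strict_mono r" "AE x in lborel. (\<lambda>n. mollify (\<eta> (r n)) f x - f x) \<longlonglongrightarrow> 0" by blast
  have "AE x in lborel. norm x < R \<longrightarrow> (\<lambda>n. mollify (\<eta> (r n)) u x) \<longlonglongrightarrow> u x"
    using r(2)
  proof eventually_elim
    fix x assume l: "(\<lambda>n. mollify (\<eta> (r n)) f x - f x) \<longlonglongrightarrow> 0"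
    show "norm x < R \<longrightarrow> (\<lambda>n. mollify (\<eta> (r n)) u x) \<longlonglongrightarrow> u x"
    proof
      assume x: "norm x < R"
      have fx: "f x = u x" using x by (simp add: f_def)
      have "f y * \<eta> n (x - y) = u y * \<eta> n (x - y)" for y n
      proof (cases "norm y \<le> R + 1")
        case False
        then have "1 \<le> norm (x - y)" using x norm_triangle_ineq2[of y x] by (simp add: norm_minus_commute)
        moreover have "1 / real (Suc n) \<le> 1" by simp
        ultimately have "\<eta> n (x - y) = 0" by (intro mollifierD(4)[OF \<eta>[of n]]) linarith
        then show ?thesis by simp
      qed (simp add: f_def)
      then have "(\<lambda>y. f y * \<eta> n (x - y)) = (\<lambda>y. u y * \<eta> n (x - y))" for n by blast
      then have "mollify (\<eta> n) f x = mollify (\<eta> n) u x" for n by (simp only: mollify_def)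
      then show "(\<lambda>n. mollify (\<eta> (r n)) u x) \<longlonglongrightarrow> u x"
        using l by (simp add: fx LIM_zero_iff)
    qed
  qed
  then show ?thesis using r(1) by blast
qed

lemma AE_all_balls:
  assumes "\<And>k::nat. AE x in lborel. norm (x::'a::euclidean_space) < real k \<longrightarrow> P x"
  shows "AE x in lborel. P x"
proof -
  have "AE x in lborel. \<forall>k::nat. norm (x::'a) < real k \<longrightarrow> P x"
    unfolding AE_all_countable using assms by blast
  then show ?thesis
  proof eventually_elim
    fix x :: 'a assume "\<forall>k::nat. norm x < real k \<longrightarrow> P x"
    moreover obtain k :: nat where "norm x < real k" using reals_Archimedean2 by blast
    ultimately show "P x" by blast
  qed
qed

text \<open>The mollification of \<open>h\<close> at a point is itself a pairing with a test
  function, so it vanishes identically; along a subsequence it converges to \<open>h\<close> almost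
  everywhere.\<close>

lemma fundamental_lemma:
  fixes h :: "'a::euclidean_space \<Rightarrow> real"
  assumes h: "loc_int h" and z: "\<And>\<phi>. test_function \<phi> \<Longrightarrow> (\<integral>y. h y * \<phi> y \<partial>lborel) = 0"
  shows "AE x in lborel. h x = 0"
proof (rule AE_all_balls)
  fix k :: nat
  obtain \<eta> :: "nat \<Rightarrow> 'a \<Rightarrow> real" where \<eta>: "\<And>n. mollifier (1 / real (Suc n)) (\<eta> n)"
  proof -
    have "\<forall>n. \<exists>\<eta> :: 'a \<Rightarrow> real. mollifier (1 / real (Suc n)) \<eta>" by (intro allI mollifier_exists) simp
    then show ?thesis using that by metis
  qed
  have "mollify (\<eta> n) h x = 0" for n x
    unfolding mollify_def by (rule z[OF mollifierD(7)[OF \<eta>]])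
  then show "AE x in lborel. norm x < real k \<longrightarrow> h x = 0"
    using mollify_convergence[OF h \<eta>, of "real k"] by (auto simp: LIMSEQ_const_iff)
qed

text \<open>Jensen's inequality for the kernel as a probability density, obtained from Hoelder by
  splitting the kernel into its powers 1/p and 1/q; then the mass of \<open>f powr p\<close> is
  conserved.\<close>

lemma mollify_Lp:
  fixes f :: "'a::euclidean_space \<Rightarrow> real"
  assumes p: "p > 1" and \<eta>: "mollifier \<epsilon> \<eta>" and [measurable]: "f \<in> borel_measurable borel"
    and nn: "\<And>y. 0 \<le> f y" and i: "integrable lborel (\<lambda>y. f y powr p)"
  shows "integrable lborel (\<lambda>x. mollify \<eta> f x powr p)"
    and "(\<integral>x. mollify \<eta> f x powr p \<partial>lborel) \<le> (\<integral>x. f x powr p \<partial>lborel)"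
proof -
  have [measurable]: "\<eta> \<in> borel_measurable borel" by (rule mollifierD[OF \<eta>])
  define q where "q = p / (p - 1)"
  have q: "q > 1" "1 / p + 1 / q = 1" using p by (auto simp: q_def field_simps)
  have bound: "AE x in lborel. ennreal (mollify \<eta> f x powr p) \<le> (\<integral>\<^sup>+y. ennreal (f y powr p * \<eta> (x - y)) \<partial>lborel)"
    using AE_integrable_mollify[OF \<eta> i]
  proof eventually_elim
    fix x assume ix: "integrable lborel (\<lambda>y. f y powr p * \<eta> (x - y))"
    define F where "F y = f y * \<eta> (x - y) powr (1 / p)" for y
    define G where "G y = \<eta> (x - y) powr (1 / q)" for y
    have \<eta>0: "0 \<le> \<eta> z" for z by (rule mollifierD[OF \<eta>])
    have Fp: "F y powr p = f y powr p * \<eta> (x - y)" for y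
      unfolding F_def using nn \<eta>0 p by (subst powr_mult) (auto simp: powr_powr)
    have Gq: "G y powr q = \<eta> (x - y)" for y
      unfolding G_def using \<eta>0 q by (simp add: powr_powr)
    have FG: "F y * G y = f y * \<eta> (x - y)" for y
    proof -
      have "\<eta> (x - y) powr (1 / p) * \<eta> (x - y) powr (1 / q) = \<eta> (x - y)"
        using \<eta>0 q by (subst powr_add[symmetric]) simp
      then show ?thesis by (simp add: F_def G_def mult.assoc)
    qed
    have "(\<integral>y. F y * G y \<partial>lborel) \<le> (\<integral>y. F y powr p \<partial>lborel) powr (1 / p) * (\<integral>y. G y powr q \<partial>lborel) powr (1 / q)"
    proof (rule Hoelder_integral(2)[OF p q])
      show "F \<in> borel_measurable lborel" "G \<in> borel_measurable lborel"
        unfolding F_def[abs_def] G_def[abs_def] by measurable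
      show "integrable lborel (\<lambda>y. F y powr p)" unfolding Fp by (rule ix)
      show "integrable lborel (\<lambda>y. G y powr q)" unfolding Gq by (rule mollifier_nn_integral(3)[OF \<eta>])
    qed (auto simp: F_def G_def nn)
    then have "mollify \<eta> f x \<le> (\<integral>y. f y powr p * \<eta> (x - y) \<partial>lborel) powr (1 / p)"
      unfolding FG Fp Gq mollify_def mollifier_nn_integral(4)[OF \<eta>] by simp
    moreover have "0 \<le> mollify \<eta> f x" unfolding mollify_def using nn \<eta>0 by (intro integral_nonneg_AE) auto
    ultimately have "mollify \<eta> f x powr p \<le> ((\<integral>y. f y powr p * \<eta> (x - y) \<partial>lborel) powr (1 / p)) powr p"
      using p by (intro powr_mono2) auto
    also have "\<dots> = (\<integral>y. f y powr p * \<eta> (x - y) \<partial>lborel)"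
    proof -
      have "0 \<le> (\<integral>y. f y powr p * \<eta> (x - y) \<partial>lborel)" using \<eta>0 by (intro integral_nonneg_AE) auto
      then show ?thesis using p by (simp add: powr_powr)
    qed
    finally show "ennreal (mollify \<eta> f x powr p) \<le> (\<integral>\<^sup>+y. ennreal (f y powr p * \<eta> (x - y)) \<partial>lborel)"
      using nn_integral_eq_integral[OF ix] \<eta>0 by (simp add: ennreal_leI)
  qed
  have "(\<integral>\<^sup>+x. ennreal (mollify \<eta> f x powr p) \<partial>lborel) \<le> (\<integral>\<^sup>+x. (\<integral>\<^sup>+y. ennreal (f y powr p * \<eta> (x - y)) \<partial>lborel) \<partial>lborel)"
    by (rule nn_integral_mono_AE[OF bound])
  also have "\<dots> = (\<integral>\<^sup>+y. ennreal (f y powr p) \<partial>lborel)"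
    by (rule tonelli_mollify[OF \<eta>]) auto
  also have "\<dots> = ennreal (\<integral>y. f y powr p \<partial>lborel)"
    using i by (intro nn_integral_eq_integral) auto
  finally have le: "(\<integral>\<^sup>+x. ennreal (mollify \<eta> f x powr p) \<partial>lborel) \<le> ennreal (\<integral>y. f y powr p \<partial>lborel)" .
  show im: "integrable lborel (\<lambda>x. mollify \<eta> f x powr p)"
    by (rule integrableI_bounded) (use le in \<open>auto intro: le_less_trans\<close>)
  have "ennreal (\<integral>x. mollify \<eta> f x powr p \<partial>lborel) \<le> ennreal (\<integral>x. f x powr p \<partial>lborel)"
    using le nn_integral_eq_integral[OF im] by simp
  then show "(\<integral>x. mollify \<eta> f x powr p \<partial>lborel) \<le> (\<integral>x. f x powr p \<partial>lborel)"
    by (simp add: ennreal_le_iff integral_nonneg_AE)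
qed

text \<open>The function spaces are defined over the completed measure, while Fubini and changes of
  variables are applied to Borel functions; integrals are carried over by this lemma.\<close>

lemma lebesgue_borel_version:
  fixes f f' :: "'a::euclidean_space \<Rightarrow> 'b::euclidean_space"
  assumes f: "f \<in> borel_measurable lebesgue" and f': "f' \<in> borel_measurable borel" and eq: "AE x in lborel. f x = f' x"
  shows "(\<integral>x. f x \<partial>lebesgue) = (\<integral>x. f' x \<partial>lborel)" and "integrable lebesgue f \<longleftrightarrow> integrable lborel f'"
proof -
  have f'm: "f' \<in> borel_measurable lborel" using f' by simp
  have f'l: "f' \<in> borel_measurable lebesgue" using f'm by (rule measurable_completion)
  have eql: "AE x in lebesgue. f x = f' x" using eq by (rule AE_completion)
  show "(\<integral>x. f x \<partial>lebesgue) = (\<integral>x. f' x \<partial>lborel)"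
    using integral_cong_AE[OF f f'l eql] integral_completion[OF f'm] by simp
  show "integrable lebesgue f \<longleftrightarrow> integrable lborel f'"
    using integrable_cong_AE[OF f f'l eql] integrable_completion[OF f'm] by simp
qed

lemma exists_borel_version:
  fixes f :: "'a::euclidean_space \<Rightarrow> 'b::euclidean_space"
  assumes f: "f \<in> borel_measurable lebesgue"
  obtains f' where "f' \<in> borel_measurable borel" "AE x in lborel. f x = f' x"
proof -
  have "\<forall>b\<in>Basis. \<exists>h. h \<in> borel_measurable lborel \<and> (AE x in lborel. f x \<bullet> b = h x)"
  proof
    fix b :: 'b
    have "(\<lambda>x. f x \<bullet> b) \<in> borel_measurable lebesgue" using f by measurable
    from completion_ex_borel_measurable_real[OF this]
    show "\<exists>h. h \<in> borel_measurable lborel \<and> (AE x in lborel. f x \<bullet> b = h x)" by blast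
  qed
  then obtain h where h: "\<And>b. b \<in> Basis \<Longrightarrow> h b \<in> borel_measurable lborel" "\<And>b. b \<in> Basis \<Longrightarrow> AE x in lborel. f x \<bullet> b = h b x"
    by metis
  show ?thesis
  proof (rule that[of "\<lambda>x. \<Sum>b\<in>Basis. h b x *\<^sub>R b"])
    show "(\<lambda>x. \<Sum>b\<in>Basis. h b x *\<^sub>R b) \<in> borel_measurable borel" using h(1) by simp
    have "AE x in lborel. \<forall>b\<in>Basis. f x \<bullet> b = h b x" using h(2) by (simp add: AE_finite_all)
    then show "AE x in lborel. f x = (\<Sum>b\<in>Basis. h b x *\<^sub>R b)"
    proof eventually_elim
      fix x assume "\<forall>b\<in>Basis. f x \<bullet> b = h b x"
      then show "f x = (\<Sum>b\<in>Basis. h b x *\<^sub>R b)" using euclidean_representation[of "f x"] by simp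
    qed
  qed
qed

lemma locally_integrable_borel_version:
  fixes u :: "'a::euclidean_space \<Rightarrow> 'b::euclidean_space"
  assumes u: "locally_integrable u" and u': "u' \<in> borel_measurable borel" "AE x in lborel. u x = u' x"
  shows "integrable lborel (\<lambda>x. indicator (cball 0 R) x *\<^sub>R u' x)"
proof -
  have m: "u \<in> borel_measurable lebesgue" and i: "integrable lebesgue (\<lambda>x. indicator (cball 0 R) x *\<^sub>R u x)"
    using u by (auto simp: locally_integrable_def set_integrable_def)
  show ?thesis
    using i
  proof (subst (asm) lebesgue_borel_version(2))
    show "(\<lambda>x. indicator (cball 0 R) x *\<^sub>R u x) \<in> borel_measurable lebesgue" using i by auto
    show "(\<lambda>x. indicator (cball 0 R) x *\<^sub>R u' x) \<in> borel_measurable borel" by (intro borel_measurable_scaleR borel_measurable_indicator u') auto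
    show "AE x in lborel. indicator (cball 0 R) x *\<^sub>R u x = indicator (cball 0 R) x *\<^sub>R u' x"
      using u'(2) by eventually_elim simp
  qed
qed

section \<open>Weak gradients\<close>

lemma test_functionD:
  fixes \<phi> :: "'a::euclidean_space \<Rightarrow> real"
  assumes t: "test_function \<phi>"
  shows "continuous_on UNIV \<phi>" "b \<in> Basis \<Longrightarrow> continuous_on UNIV (\<lambda>x. frechet_derivative \<phi> (at x) b)"
    "(\<phi> has_derivative frechet_derivative \<phi> (at x)) (at x)" "\<exists>R. \<forall>z. R \<le> norm z \<longrightarrow> \<phi> z = 0"
proof -
  have "C_k 0 \<phi>" "C_k 1 \<phi>" using t by (auto simp: test_function_def)
  then show "continuous_on UNIV \<phi>" "b \<in> Basis \<Longrightarrow> continuous_on UNIV (\<lambda>x. frechet_derivative \<phi> (at x) b)"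
    "(\<phi> has_derivative frechet_derivative \<phi> (at x)) (at x)"
    using frechet_derivative_works by (auto simp: One_nat_def)
  have "bounded {x. \<phi> x \<noteq> 0}"
    by (rule bounded_subset[OF compact_imp_bounded closure_subset]) (use t in \<open>simp add: test_function_def\<close>)
  then obtain B where B: "\<forall>x\<in>{x. \<phi> x \<noteq> 0}. norm x \<le> B" unfolding bounded_iff by blast
  show "\<exists>R. \<forall>z. R \<le> norm z \<longrightarrow> \<phi> z = 0"
  proof (intro exI[of _ "B + 1"] allI impI)
    fix z :: 'a assume z: "B + 1 \<le> norm z"
    show "\<phi> z = 0"
    proof (rule ccontr)
      assume "\<phi> z \<noteq> 0"
      then have "norm z \<le> B" using B by auto
      then show False using z by simp
    qed
  qed
qed

text \<open>A weak gradient after passing to Borel representatives. Local integrability of the norm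
  serves the vector-valued convolution of \<open>g\<close> with a kernel, that of the components its
  continuity.\<close>

definition borel_weak_gradient :: "('a::euclidean_space \<Rightarrow> real) \<Rightarrow> ('a \<Rightarrow> 'a) \<Rightarrow> bool" where
  "borel_weak_gradient u g \<longleftrightarrow> loc_int u \<and> g \<in> borel_measurable borel \<and> (\<forall>b. loc_int (\<lambda>x. g x \<bullet> b)) \<and>
     loc_int (\<lambda>x. norm (g x)) \<and> (\<forall>\<phi> b. test_function \<phi> \<longrightarrow> b \<in> Basis \<longrightarrow>
      (\<integral>x. u x * frechet_derivative \<phi> (at x) b \<partial>lborel) = - (\<integral>x. (g x \<bullet> b) * \<phi> x \<partial>lborel))"

lemma weak_gradient_borel:
  fixes u :: "'a::euclidean_space \<Rightarrow> real"
  assumes w: "has_weak_gradient u g"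
  shows "\<exists>u' g'. borel_weak_gradient u' g' \<and> (AE x in lborel. u x = u' x) \<and> (AE x in lborel. g x = g' x)"
proof -
  have ul: "locally_integrable u" and gl: "locally_integrable g"
    and eq: "\<And>\<phi> b. test_function \<phi> \<Longrightarrow> b \<in> Basis \<Longrightarrow>
      (\<integral>x. u x * frechet_derivative \<phi> (at x) b \<partial>lebesgue) = - (\<integral>x. (g x \<bullet> b) * \<phi> x \<partial>lebesgue)"
    using w by (auto simp: has_weak_gradient_def)
  have um [measurable]: "u \<in> borel_measurable lebesgue" and gm [measurable]: "g \<in> borel_measurable lebesgue"
    using ul gl by (auto simp: locally_integrable_def)
  obtain u' where u' [measurable]: "u' \<in> borel_measurable borel" and u'eq: "AE x in lborel. u x = u' x"
    using exists_borel_version[OF um] by blast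
  obtain g' where g' [measurable]: "g' \<in> borel_measurable borel" and g'eq: "AE x in lborel. g x = g' x"
    using exists_borel_version[OF gm] by blast
  note iu = locally_integrable_borel_version[OF ul u' u'eq]
  note ig = locally_integrable_borel_version[OF gl g' g'eq]
  have "borel_weak_gradient u' g'"
    unfolding borel_weak_gradient_def
  proof (intro conjI allI impI g')
    show "loc_int u'" using iu by (simp add: loc_int_def)
    show "loc_int (\<lambda>x. g' x \<bullet> b)" for b
      using integrable_inner_left[OF ig] by (auto simp: loc_int_def)
    show "loc_int (\<lambda>x. norm (g' x))"
      using integrable_norm[OF ig] by (auto simp: loc_int_def)
    fix \<phi> :: "'a \<Rightarrow> real" and b :: 'a assume t: "test_function \<phi>" and b: "b \<in> Basis"
    have [measurable]: "\<phi> \<in> borel_measurable borel" "(\<lambda>x. frechet_derivative \<phi> (at x) b) \<in> borel_measurable borel"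
      using test_functionD[OF t] b by (auto intro: borel_measurable_continuous_onI)
    have [measurable]: "\<phi> \<in> borel_measurable lebesgue" "(\<lambda>x. frechet_derivative \<phi> (at x) b) \<in> borel_measurable lebesgue"
      by (auto intro!: measurable_completion)
    have "(\<integral>x. u x * frechet_derivative \<phi> (at x) b \<partial>lebesgue) = (\<integral>x. u' x * frechet_derivative \<phi> (at x) b \<partial>lborel)"
    proof (rule lebesgue_borel_version(1))
      show "AE x in lborel. u x * frechet_derivative \<phi> (at x) b = u' x * frechet_derivative \<phi> (at x) b"
        using u'eq by eventually_elim simp
    qed measurable
    moreover have "(\<integral>x. (g x \<bullet> b) * \<phi> x \<partial>lebesgue) = (\<integral>x. (g' x \<bullet> b) * \<phi> x \<partial>lborel)"
    proof (rule lebesgue_borel_version(1))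
      show "AE x in lborel. (g x \<bullet> b) * \<phi> x = (g' x \<bullet> b) * \<phi> x"
        using g'eq by eventually_elim simp
    qed measurable
    ultimately show "(\<integral>x. u' x * frechet_derivative \<phi> (at x) b \<partial>lborel) = - (\<integral>x. (g' x \<bullet> b) * \<phi> x \<partial>lborel)"
      using eq[OF t b] by simp
  qed
  then show ?thesis using u'eq g'eq by blast
qed

text \<open>The difference of the two gradients pairs to zero with every test function. As
  \<open>weak_grad\<close> is an arbitrary choice, this is what identifies it with the classical
  gradient of the bubble.\<close>

lemma weak_gradient_unique:
  fixes u :: "'a::euclidean_space \<Rightarrow> real"
  assumes "has_weak_gradient u g1" "has_weak_gradient u g2"
  shows "AE x in lborel. g1 x = g2 x"
proof -
  obtain u1 h1 where "borel_weak_gradient u1 h1" and "AE x in lborel. u x = u1 x" "AE x in lborel. g1 x = h1 x"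
    using weak_gradient_borel[OF assms(1)] by blast
  then have 1: "loc_int u1" "\<And>b. loc_int (\<lambda>x. h1 x \<bullet> b)" "AE x in lborel. u x = u1 x" "AE x in lborel. g1 x = h1 x"
    "\<And>\<phi> b. test_function \<phi> \<Longrightarrow> b \<in> Basis \<Longrightarrow>
      (\<integral>x. u1 x * frechet_derivative \<phi> (at x) b \<partial>lborel) = - (\<integral>x. (h1 x \<bullet> b) * \<phi> x \<partial>lborel)"
    unfolding borel_weak_gradient_def by blast+
  obtain u2 h2 where "borel_weak_gradient u2 h2" and "AE x in lborel. u x = u2 x" "AE x in lborel. g2 x = h2 x"
    using weak_gradient_borel[OF assms(2)] by blast
  then have 2: "loc_int u2" "\<And>b. loc_int (\<lambda>x. h2 x \<bullet> b)" "AE x in lborel. u x = u2 x" "AE x in lborel. g2 x = h2 x"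
    "\<And>\<phi> b. test_function \<phi> \<Longrightarrow> b \<in> Basis \<Longrightarrow>
      (\<integral>x. u2 x * frechet_derivative \<phi> (at x) b \<partial>lborel) = - (\<integral>x. (h2 x \<bullet> b) * \<phi> x \<partial>lborel)"
    unfolding borel_weak_gradient_def by blast+
  have "AE x in lborel. h1 x \<bullet> b - h2 x \<bullet> b = 0" if b: "b \<in> Basis" for b
  proof (rule fundamental_lemma)
    show "loc_int (\<lambda>x. h1 x \<bullet> b - h2 x \<bullet> b)"
      using 1(2)[of b] 2(2)[of b] by (auto simp: loc_int_def right_diff_distrib)
    fix \<phi> :: "'a \<Rightarrow> real" assume t: "test_function \<phi>"
    obtain R where R: "\<And>z. R \<le> norm z \<Longrightarrow> \<phi> z = 0" using test_functionD(4)[OF t] by blast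
    \<comment> \<open>Pairing with \<open>\<phi>\<close> is the convolution with its reflection,
      evaluated at the origin.\<close>
    have c: "continuous_on UNIV (\<lambda>z. \<phi> (- z))"
      by (intro continuous_on_compose2[OF test_functionD(1)[OF t]] continuous_intros) auto
    have i: "integrable lborel (\<lambda>y. v y * \<phi> y)" if "loc_int v" for v
      using convolution_integrable[OF that c, of R 0] R by simp
    have [measurable]: "u1 \<in> borel_measurable borel" "u2 \<in> borel_measurable borel" "(\<lambda>x. frechet_derivative \<phi> (at x) b) \<in> borel_measurable borel"
      using 1(1) 2(1) borel_measurable_continuous_onI[OF test_functionD(2)[OF t b]] by (auto simp: loc_int_def)
    have "(\<integral>x. u1 x * frechet_derivative \<phi> (at x) b \<partial>lborel) = (\<integral>x. u2 x * frechet_derivative \<phi> (at x) b \<partial>lborel)"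
    proof (rule integral_cong_AE)
      show "AE x in lborel. u1 x * frechet_derivative \<phi> (at x) b = u2 x * frechet_derivative \<phi> (at x) b"
        using 1(3) 2(3) by eventually_elim simp
    qed measurable
    then show "(\<integral>y. (h1 y \<bullet> b - h2 y \<bullet> b) * \<phi> y \<partial>lborel) = 0"
      using 1(5)[OF t b] 2(5)[OF t b] i[OF 1(2)[of b]] i[OF 2(2)[of b]] by (simp add: left_diff_distrib)
  qed
  then have "AE x in lborel. \<forall>b\<in>Basis. h1 x \<bullet> b - h2 x \<bullet> b = 0" by (simp add: AE_finite_all)
  with 1(4) 2(4) show ?thesis
  proof eventually_elim
    fix x assume e: "g1 x = h1 x" "g2 x = h2 x" "\<forall>b\<in>Basis. h1 x \<bullet> b - h2 x \<bullet> b = 0"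
    have "h1 x = h2 x" by (rule euclidean_eqI) (use e(3) in auto)
    then show "g1 x = g2 x" using e by simp
  qed
qed

text \<open>Testing with a translated kernel shows that the gradient of the mollified function is
  the mollified gradient. Its p-norm does not exceed that of \<open>g\<close>, so the right side is
  stated for \<open>g\<close> and does not depend on the kernel.\<close>

lemma sobolev_mollified:
  fixes u G \<eta> :: "'a::euclidean_space \<Rightarrow> real" and g :: "'a \<Rightarrow> 'a" and p C :: real
  defines "N \<equiv> real DIM('a)"
  defines "q \<equiv> p / (p - 1)" and "ps \<equiv> N * p / (N - p)" and "r \<equiv> p * (N - 1) / (N - p)"
  assumes p: "1 < p" "p < N / 2" and w: "borel_weak_gradient u g"
    and ui: "integrable lborel (\<lambda>x. \<bar>u x\<bar> powr ps)" and gi: "integrable lborel (\<lambda>x. norm (g x) powr p)"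
    and G: "continuous_on UNIV G" "\<And>x. 0 < G x" "\<And>x. G x \<le> C"
    and Gi: "integrable lborel G" "integrable lborel (\<lambda>y. G y powr (1 - 1 / N))" "integrable lborel (\<lambda>y. G y * norm y powr q)"
    and \<eta>: "mollifier \<epsilon> \<eta>"
  shows "N * (\<integral>y. G y powr (1 - 1 / N) \<partial>lborel) * ((\<integral>x. \<bar>mollify \<eta> u x\<bar> powr ps \<partial>lborel) / (\<integral>y. G y \<partial>lborel)) powr (1 / ps)
    \<le> r * ((\<integral>x. norm (g x) powr p \<partial>lborel) powr (1 / p) * (\<integral>y. G y * norm y powr q \<partial>lborel) powr (1 / q))"
    and "integrable lborel (\<lambda>x. \<bar>mollify \<eta> u x\<bar> powr ps)"
proof -
  have ul: "loc_int u" and [measurable]: "g \<in> borel_measurable borel" and gb: "\<And>b. loc_int (\<lambda>x. g x \<bullet> b)"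
    and gn: "loc_int (\<lambda>x. norm (g x))" and wg: "\<And>\<phi> b. test_function \<phi> \<Longrightarrow> b \<in> Basis \<Longrightarrow>
      (\<integral>x. u x * frechet_derivative \<phi> (at x) b \<partial>lborel) = - (\<integral>x. (g x \<bullet> b) * \<phi> x \<partial>lborel)"
    using w by (auto simp: borel_weak_gradient_def)
  have um [measurable]: "u \<in> borel_measurable borel" using ul by (simp add: loc_int_def)
  have \<eta>m [measurable]: "\<eta> \<in> borel_measurable borel" by (rule mollifierD[OF \<eta>])
  have \<eta>c: "continuous_on UNIV \<eta>" and \<eta>0: "\<And>z. 0 \<le> \<eta> z" and \<eta>s: "\<And>z. \<epsilon> + 1 \<le> norm z \<Longrightarrow> \<eta> z = 0"
    using mollifierD[OF \<eta>] by auto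
  have N: "N > 1" "N - p > 0" using p by auto
  have ps: "ps > 1"
  proof -
    have "N * 1 < N * p" using p N by (intro mult_strict_left_mono) auto
    then have "N - p < N * p" using p by linarith
    then show ?thesis using N by (simp add: ps_def)
  qed
  define v where "v = mollify \<eta> u"
  define D where "D x = (\<integral>y. \<eta> (x - y) *\<^sub>R g y \<partial>lborel)" for x
  have Dint: "integrable lborel (\<lambda>y. \<eta> (x - y) *\<^sub>R g y)" for x
  proof (rule Bochner_Integration.integrable_bound[OF convolution_integrable[OF gn \<eta>c \<eta>s]])
    show "AE y in lborel. norm (\<eta> (x - y) *\<^sub>R g y) \<le> norm (norm (g y) * \<eta> (x - y))"
      by (intro AE_I2) (simp add: abs_mult)
  qed measurable
  have Dib: "D x \<bullet> b = (\<integral>y. (g y \<bullet> b) * \<eta> (x - y) \<partial>lborel)" for x b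
    unfolding D_def using integral_inner_left[OF Dint[of x], of b] by (simp add: mult.commute)
  have Dc: "continuous_on UNIV D"
  proof -
    have "continuous_on UNIV (\<lambda>x. D x \<bullet> b)" for b
      unfolding Dib by (rule convolution_continuous[OF gb \<eta>c \<eta>s])
    then have "continuous_on UNIV (\<lambda>x. \<Sum>b\<in>Basis. (D x \<bullet> b) *\<^sub>R b)"
      by (intro continuous_on_sum continuous_on_scaleR continuous_on_const)
    then show ?thesis by (simp add: euclidean_representation)
  qed
  have vc: "continuous_on UNIV v"
    unfolding v_def mollify_def[abs_def] by (rule convolution_continuous[OF ul \<eta>c \<eta>s])
  have der: "((\<lambda>s. v (x + s *\<^sub>R b)) has_real_derivative D x \<bullet> b) (at 0)" if b: "b \<in> Basis" for x b
  proof -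
    obtain w where w: "continuous_on UNIV w" "\<And>z. \<epsilon> + 1 \<le> norm z \<Longrightarrow> w z = 0"
      "\<And>z. ((\<lambda>s. \<eta> (z + s *\<^sub>R b)) has_real_derivative w z) (at 0)"
      "\<And>x y. frechet_derivative (\<lambda>y. \<eta> (x - y)) (at y) b = - w (x - y)"
      using mollifier_deriv[OF \<eta> b] by blast
    have "(\<integral>y. u y * w (x - y) \<partial>lborel) = D x \<bullet> b"
      using wg[OF mollifierD(7)[OF \<eta>, of x] b] by (simp add: w(4) Dib)
    then show ?thesis
      using convolution_deriv[OF ul \<eta>c \<eta>s w(1,2,3), where x = x] by (simp add: v_def mollify_def)
  qed
  have Dn: "norm (D x) \<le> mollify \<eta> (\<lambda>y. norm (g y)) x" for x
    unfolding D_def mollify_def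
    using integral_norm_bound[of lborel "\<lambda>y. \<eta> (x - y) *\<^sub>R g y"] \<eta>0 by (simp add: mult.commute)
  have mg: "integrable lborel (\<lambda>x. mollify \<eta> (\<lambda>y. norm (g y)) x powr p)"
    "(\<integral>x. mollify \<eta> (\<lambda>y. norm (g y)) x powr p \<partial>lborel) \<le> (\<integral>x. norm (g x) powr p \<partial>lborel)"
    using mollify_Lp[OF p(1) \<eta>, of "\<lambda>y. norm (g y)"] gi by auto
  have [measurable]: "D \<in> borel_measurable borel" "v \<in> borel_measurable borel"
    using Dc vc borel_measurable_continuous_onI by auto
  have Dp: "norm (D x) powr p \<le> mollify \<eta> (\<lambda>y. norm (g y)) x powr p" for x
    using Dn p by (intro powr_mono2) auto
  have Di: "integrable lborel (\<lambda>x. norm (D x) powr p)"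
    by (rule Bochner_Integration.integrable_bound[OF mg(1)]) (use Dp in auto)
  have Dle: "(\<integral>x. norm (D x) powr p \<partial>lborel) \<le> (\<integral>x. norm (g x) powr p \<partial>lborel)"
    using integral_mono[OF Di mg(1) Dp] mg(2) by simp
  have mu: "integrable lborel (\<lambda>x. mollify \<eta> (\<lambda>y. \<bar>u y\<bar>) x powr ps)"
    using mollify_Lp[OF ps \<eta>, of "\<lambda>y. \<bar>u y\<bar>"] ui by auto
  have vn: "\<bar>v x\<bar> \<le> mollify \<eta> (\<lambda>y. \<bar>u y\<bar>) x" for x
    unfolding v_def mollify_def
    using integral_norm_bound[of lborel "\<lambda>y. u y * \<eta> (x - y)"] \<eta>0 by (simp add: abs_mult)
  have vp: "\<bar>v x\<bar> powr ps \<le> mollify \<eta> (\<lambda>y. \<bar>u y\<bar>) x powr ps" for x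
    using vn ps by (intro powr_mono2) auto
  have vi: "integrable lborel (\<lambda>x. \<bar>v x\<bar> powr ps)"
    by (rule Bochner_Integration.integrable_bound[OF mu]) (use vp in auto)
  then show "integrable lborel (\<lambda>x. \<bar>mollify \<eta> u x\<bar> powr ps)" by (simp add: v_def)
  have "N * (\<integral>y. G y powr (1 - 1 / N) \<partial>lborel) * ((\<integral>x. \<bar>v x\<bar> powr ps \<partial>lborel) / (\<integral>y. G y \<partial>lborel)) powr (1 / ps)
    \<le> r * ((\<integral>x. norm (D x) powr p \<partial>lborel) powr (1 / p) * (\<integral>y. G y * norm y powr q \<partial>lborel) powr (1 / q))"
    unfolding N_def ps_def q_def r_def
    by (rule sobolev_C1[where C = C]) (use p vc Dc der vi Di G Gi in \<open>simp_all add: N_def ps_def q_def\<close>)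
  also have "\<dots> \<le> r * ((\<integral>x. norm (g x) powr p \<partial>lborel) powr (1 / p) * (\<integral>y. G y * norm y powr q \<partial>lborel) powr (1 / q))"
    using Dle p N by (intro mult_left_mono mult_right_mono powr_mono2) (auto simp: r_def intro!: integral_nonneg_AE)
  finally show "N * (\<integral>y. G y powr (1 - 1 / N) \<partial>lborel) * ((\<integral>x. \<bar>mollify \<eta> u x\<bar> powr ps \<partial>lborel) / (\<integral>y. G y \<partial>lborel)) powr (1 / ps)
    \<le> r * ((\<integral>x. norm (g x) powr p \<partial>lborel) powr (1 / p) * (\<integral>y. G y * norm y powr q \<partial>lborel) powr (1 / q))"
    by (simp add: v_def)
qed

text \<open>The bound for the mollified functions is uniform, so Fatou's lemma on each ball, along a
  subsequence converging there, passes it on to \<open>u\<close>; monotone convergence then exhausts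
  the space by balls.\<close>

lemma sobolev_weak_gradient:
  fixes u G :: "'a::euclidean_space \<Rightarrow> real" and g :: "'a \<Rightarrow> 'a" and p C :: real
  defines "N \<equiv> real DIM('a)"
  defines "q \<equiv> p / (p - 1)" and "ps \<equiv> N * p / (N - p)" and "r \<equiv> p * (N - 1) / (N - p)"
  defines "J \<equiv> \<integral>y. G y powr (1 - 1 / N) \<partial>lborel" and "M \<equiv> \<integral>y. G y \<partial>lborel"
    and "I \<equiv> \<integral>y. G y * norm y powr q \<partial>lborel"
  assumes p: "1 < p" "p < N / 2" and w: "has_weak_gradient u g"
    and ui: "integrable lebesgue (\<lambda>x. \<bar>u x\<bar> powr ps)" and gi: "integrable lebesgue (\<lambda>x. norm (g x) powr p)"
    and G: "continuous_on UNIV G" "\<And>x. 0 < G x" "\<And>x. G x \<le> C"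
    and Gi: "integrable lborel G" "integrable lborel (\<lambda>y. G y powr (1 - 1 / N))" "integrable lborel (\<lambda>y. G y * norm y powr q)"
    and pos: "J > 0" "M > 0"
  shows "(\<integral>x. \<bar>u x\<bar> powr ps \<partial>lebesgue) \<le>
    M * (r * ((\<integral>x. norm (g x) powr p \<partial>lebesgue) powr (1 / p) * I powr (1 / q)) / (N * J)) powr ps"
proof -
  have N: "N > 1" "N - p > 0" using p by auto
  have ps: "ps > 0" using N p by (simp add: ps_def)
  have r: "r > 0" using N p by (simp add: r_def)
  obtain u' g' where w': "borel_weak_gradient u' g'" and eq: "AE x in lborel. u x = u' x" "AE x in lborel. g x = g' x"
    using weak_gradient_borel[OF w] by blast
  have ul: "loc_int u'" and [measurable]: "g' \<in> borel_measurable borel" using w' by (auto simp: borel_weak_gradient_def)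
  have [measurable]: "u' \<in> borel_measurable borel" using ul by (simp add: loc_int_def)
  have "AE x in lborel. \<bar>u x\<bar> powr ps = \<bar>u' x\<bar> powr ps" using eq(1) by eventually_elim simp
  from lebesgue_borel_version[OF _ _ this] ui
  have u': "(\<integral>x. \<bar>u x\<bar> powr ps \<partial>lebesgue) = (\<integral>x. \<bar>u' x\<bar> powr ps \<partial>lborel)" "integrable lborel (\<lambda>x. \<bar>u' x\<bar> powr ps)"
    by auto
  have "AE x in lborel. norm (g x) powr p = norm (g' x) powr p" using eq(2) by eventually_elim simp
  from lebesgue_borel_version[OF _ _ this] gi
  have g': "(\<integral>x. norm (g x) powr p \<partial>lebesgue) = (\<integral>x. norm (g' x) powr p \<partial>lborel)" "integrable lborel (\<lambda>x. norm (g' x) powr p)"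
    by auto
  define B where "B = M * (r * ((\<integral>x. norm (g' x) powr p \<partial>lborel) powr (1 / p) * I powr (1 / q)) / (N * J)) powr ps"
  have B0: "B \<ge> 0" using pos by (simp add: B_def)
  obtain \<eta> :: "nat \<Rightarrow> 'a \<Rightarrow> real" where \<eta>: "\<And>n. mollifier (1 / real (Suc n)) (\<eta> n)"
  proof -
    have "\<forall>n. \<exists>\<eta> :: 'a \<Rightarrow> real. mollifier (1 / real (Suc n)) \<eta>" by (intro allI mollifier_exists) simp
    then show ?thesis using that by metis
  qed
  have bound: "(\<integral>\<^sup>+x. ennreal (\<bar>mollify (\<eta> n) u' x\<bar> powr ps) \<partial>lborel) \<le> ennreal B" for n
  proof -
    define A where "A = (\<integral>x. \<bar>mollify (\<eta> n) u' x\<bar> powr ps \<partial>lborel)"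
    have A0: "A \<ge> 0" unfolding A_def by (intro integral_nonneg_AE) auto
    have S: "N * J * (A / M) powr (1 / ps) \<le> r * ((\<integral>x. norm (g' x) powr p \<partial>lborel) powr (1 / p) * I powr (1 / q))"
      unfolding N_def J_def A_def M_def I_def ps_def q_def r_def
      by (rule sobolev_mollified(1)[where C = C, OF _ _ w' _ _ _ _ _ _ _ _ \<eta>])
        (use p u' g' G Gi in \<open>simp_all add: N_def ps_def q_def\<close>)
    have "(A / M) powr (1 / ps) \<le> r * ((\<integral>x. norm (g' x) powr p \<partial>lborel) powr (1 / p) * I powr (1 / q)) / (N * J)"
      using S pos N by (simp add: le_divide_eq mult.commute)
    then have "((A / M) powr (1 / ps)) powr ps \<le> (r * ((\<integral>x. norm (g' x) powr p \<partial>lborel) powr (1 / p) * I powr (1 / q)) / (N * J)) powr ps"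
      using ps by (intro powr_mono2) auto
    then have "A / M \<le> (r * ((\<integral>x. norm (g' x) powr p \<partial>lborel) powr (1 / p) * I powr (1 / q)) / (N * J)) powr ps"
      using ps A0 pos by (simp add: powr_powr)
    then have "A \<le> B" unfolding B_def using pos by (simp add: divide_le_eq mult.commute)
    moreover have "integrable lborel (\<lambda>x. \<bar>mollify (\<eta> n) u' x\<bar> powr ps)"
      unfolding N_def ps_def
      by (rule sobolev_mollified(2)[where C = C, OF _ _ w' _ _ _ _ _ _ _ _ \<eta>])
        (use p u' g' G Gi in \<open>simp_all add: N_def ps_def q_def\<close>)
    then have "(\<integral>\<^sup>+x. ennreal (\<bar>mollify (\<eta> n) u' x\<bar> powr ps) \<partial>lborel) = ennreal A"
      unfolding A_def by (intro nn_integral_eq_integral) auto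
    ultimately show ?thesis by (simp add: ennreal_leI)
  qed
  have [measurable]: "\<eta> n \<in> borel_measurable borel" for n by (rule mollifierD[OF \<eta>])
  have ball: "(\<integral>\<^sup>+x. ennreal (\<bar>u' x\<bar> powr ps) * indicator (ball 0 (real k)) x \<partial>lborel) \<le> ennreal B" for k :: nat
  proof -
    obtain s :: "nat \<Rightarrow> nat" where s: "AE x in lborel. norm x < real k \<longrightarrow> (\<lambda>n. mollify (\<eta> (s n)) u' x) \<longlonglongrightarrow> u' x"
      using mollify_convergence[OF ul \<eta>, of "real k"] by blast
    have "(\<integral>\<^sup>+x. ennreal (\<bar>u' x\<bar> powr ps) * indicator (ball 0 (real k)) x \<partial>lborel) \<le>
      (\<integral>\<^sup>+x. liminf (\<lambda>n. ennreal (\<bar>mollify (\<eta> (s n)) u' x\<bar> powr ps)) \<partial>lborel)"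
    proof (rule nn_integral_mono_AE)
      show "AE x in lborel. ennreal (\<bar>u' x\<bar> powr ps) * indicator (ball 0 (real k)) x \<le>
          liminf (\<lambda>n. ennreal (\<bar>mollify (\<eta> (s n)) u' x\<bar> powr ps))"
        using s
      proof eventually_elim
        fix x assume l: "norm x < real k \<longrightarrow> (\<lambda>n. mollify (\<eta> (s n)) u' x) \<longlonglongrightarrow> u' x"
        show "ennreal (\<bar>u' x\<bar> powr ps) * indicator (ball 0 (real k)) x \<le>
          liminf (\<lambda>n. ennreal (\<bar>mollify (\<eta> (s n)) u' x\<bar> powr ps))"
        proof (cases "norm x < real k")
          case True
          then have "(\<lambda>n. mollify (\<eta> (s n)) u' x) \<longlonglongrightarrow> u' x" using l by blast
          then have "(\<lambda>n. ennreal (\<bar>mollify (\<eta> (s n)) u' x\<bar> powr ps)) \<longlonglongrightarrow> ennreal (\<bar>u' x\<bar> powr ps)"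
            using ps by (intro tendsto_ennrealI tendsto_powr_nonneg tendsto_rabs) auto
          then have "liminf (\<lambda>n. ennreal (\<bar>mollify (\<eta> (s n)) u' x\<bar> powr ps)) = ennreal (\<bar>u' x\<bar> powr ps)"
            by (intro lim_imp_Liminf) auto
          then show ?thesis by (simp split: split_indicator)
        qed simp
      qed
    qed
    also have "\<dots> \<le> liminf (\<lambda>n. \<integral>\<^sup>+x. ennreal (\<bar>mollify (\<eta> (s n)) u' x\<bar> powr ps) \<partial>lborel)"
      by (rule nn_integral_liminf) measurable
    also have "\<dots> \<le> liminf (\<lambda>n. ennreal B)"
      by (intro Liminf_mono always_eventually allI bound)
    also have "\<dots> = ennreal B" by (simp add: Liminf_const)
    finally show ?thesis .
  qed
  have "(\<integral>\<^sup>+x. ennreal (\<bar>u' x\<bar> powr ps) \<partial>lborel) = (\<integral>\<^sup>+x. (SUP k::nat. ennreal (\<bar>u' x\<bar> powr ps) * indicator (ball 0 (real k)) x) \<partial>lborel)"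
  proof (rule nn_integral_cong)
    fix x :: 'a
    obtain k :: nat where "norm x < real k" using reals_Archimedean2 by blast
    then have "ennreal (\<bar>u' x\<bar> powr ps) \<le> (SUP k::nat. ennreal (\<bar>u' x\<bar> powr ps) * indicator (ball 0 (real k)) x)"
      by (intro SUP_upper2[of k]) auto
    moreover have "(SUP k::nat. ennreal (\<bar>u' x\<bar> powr ps) * indicator (ball 0 (real k)) x) \<le> ennreal (\<bar>u' x\<bar> powr ps)"
      by (intro SUP_least) (auto split: split_indicator)
    ultimately show "ennreal (\<bar>u' x\<bar> powr ps) = (SUP k::nat. ennreal (\<bar>u' x\<bar> powr ps) * indicator (ball 0 (real k)) x)"
      by (rule antisym)
  qed
  also have "(\<integral>\<^sup>+x. (SUP k::nat. ennreal (\<bar>u' x\<bar> powr ps) * indicator (ball 0 (real k)) x) \<partial>lborel) = (SUP k::nat. \<integral>\<^sup>+x. ennreal (\<bar>u' x\<bar> powr ps) * indicator (ball 0 (real k)) x \<partial>lborel)"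
    by (rule nn_integral_monotone_convergence_SUP)
      (auto simp: incseq_def le_fun_def split: split_indicator intro!: borel_measurable_times_ennreal borel_measurable_indicator)
  also have "\<dots> \<le> ennreal B" by (intro SUP_least ball)
  finally have "ennreal (\<integral>x. \<bar>u' x\<bar> powr ps \<partial>lborel) \<le> ennreal B"
    using nn_integral_eq_integral[OF u'(2)] by simp
  then have "(\<integral>x. \<bar>u' x\<bar> powr ps \<partial>lborel) \<le> B" using B0 by (simp add: ennreal_le_iff)
  then show ?thesis unfolding u'(1) g'(1) B_def .
qed

text \<open>By translation invariance the integral of \<open>h\<close> shifted along
  \<open>b\<close> is constant. It is also a convolution of \<open>h\<close> with the constant 1,
  whose derivative is the integral of \<open>w\<close>.\<close>

lemma integral_partial_derivative_zero:
  fixes h w :: "'a::euclidean_space \<Rightarrow> real"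
  assumes h: "continuous_on UNIV h" "\<And>z. R \<le> norm z \<Longrightarrow> h z = 0"
    and w: "continuous_on UNIV w" "\<And>z. R \<le> norm z \<Longrightarrow> w z = 0"
    and d: "\<And>z. ((\<lambda>s. h (z + s *\<^sub>R b)) has_real_derivative w z) (at 0)"
  shows "(\<integral>z. w z \<partial>lborel) = 0"
proof -
  have one: "loc_int (\<lambda>_::'a. 1)"
    unfolding loc_int_def using emeasure_bounded_finite[OF bounded_cball[of "0::'a"]]
    by (auto simp: integrable_indicator_iff)
  have [measurable]: "h \<in> borel_measurable borel" "w \<in> borel_measurable borel"
    using h w borel_measurable_continuous_onI by auto
  have tr: "(\<integral>y. f (a - y) \<partial>lborel) = (\<integral>y. f y \<partial>lborel)" if "f \<in> borel_measurable borel" for f :: "'a \<Rightarrow> real" and a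
  proof -
    have "(\<integral>y. f y \<partial>lborel) = (\<integral>y. f y \<partial>density (distr lborel borel (\<lambda>x. a + (-1) *\<^sub>R x)) (\<lambda>_. ennreal (\<bar>-1\<bar> ^ DIM('a))))"
      using lborel_affine[of "-1" a] by simp
    also have "\<dots> = (\<integral>y. f y \<partial>distr lborel borel (\<lambda>x. a + (-1) *\<^sub>R x))"
      by (simp add: density_1)
    also have "\<dots> = (\<integral>y. f (a - y) \<partial>lborel)"
      using that by (subst integral_distr) auto
    finally show ?thesis by simp
  qed
  have "((\<lambda>s. \<integral>y. 1 * h (0 + s *\<^sub>R b - y) \<partial>lborel) has_real_derivative (\<integral>y. 1 * w (0 - y) \<partial>lborel)) (at 0)"
    by (rule convolution_deriv[OF one h w d])
  moreover have "(\<integral>y. 1 * h (0 + s *\<^sub>R b - y) \<partial>lborel) = (\<integral>y. h y \<partial>lborel)" for s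
    using tr[of h "s *\<^sub>R b"] by simp
  moreover have "(\<integral>y. 1 * w (0 - y) \<partial>lborel) = (\<integral>y. w y \<partial>lborel)"
    using tr[of w 0] by simp
  ultimately have "((\<lambda>s. \<integral>y. h y \<partial>lborel) has_real_derivative (\<integral>z. w z \<partial>lborel)) (at 0)" by simp
  then show ?thesis using DERIV_const DERIV_unique by blast
qed

lemma locally_integrable_continuous:
  fixes f :: "'a::euclidean_space \<Rightarrow> 'b::euclidean_space"
  assumes f: "continuous_on UNIV f"
  shows "locally_integrable f"
  unfolding locally_integrable_def
proof (intro conjI allI impI)
  have [measurable]: "f \<in> borel_measurable borel" using f by (rule borel_measurable_continuous_onI)
  show "f \<in> borel_measurable lebesgue" by (rule measurable_completion) simp
  fix K :: "'a set" assume K: "compact K"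
  have [measurable]: "K \<in> sets borel" using K by (simp add: borel_compact)
  have "integrable lborel (\<lambda>x. indicator K x *\<^sub>R f x)"
    by (rule borel_integrable_compact[OF K continuous_on_subset[OF f]]) simp
  then show "set_integrable lebesgue K f"
    unfolding set_integrable_def by (subst integrable_completion) auto
qed

text \<open>The product of \<open>f\<close> with a test function has compact support, so its partial
  derivative has integral zero; the product rule splits this into the two sides.\<close>

lemma has_weak_gradient_C1:
  fixes f :: "'a::euclidean_space \<Rightarrow> real"
  assumes d: "\<And>x. (f has_derivative (\<lambda>h. D x \<bullet> h)) (at x)" and D: "continuous_on UNIV D"
  shows "has_weak_gradient f D"
  unfolding has_weak_gradient_def
proof (intro conjI allI impI ballI)
  have f: "continuous_on UNIV f"
    using d by (meson continuous_at_imp_continuous_on has_derivative_continuous)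
  show "locally_integrable f" "locally_integrable D" by (rule locally_integrable_continuous f D)+
  fix \<phi> :: "'a \<Rightarrow> real" and b :: 'a assume t: "test_function \<phi>" and b: "b \<in> Basis"
  note td = test_functionD[OF t]
  define \<phi>b where "\<phi>b x = frechet_derivative \<phi> (at x) b" for x
  have \<phi>b: "continuous_on UNIV \<phi>b" unfolding \<phi>b_def[abs_def] by (rule td(2)[OF b])
  obtain R where R: "\<And>z. R \<le> norm z \<Longrightarrow> \<phi> z = 0" using td(4) by blast
  have \<phi>b0: "\<phi>b z = 0" if z: "R + 1 \<le> norm z" for z
  proof -
    have "((\<lambda>_. 0) has_derivative (\<lambda>_. 0)) (at z)" by simp
    then have "(\<phi> has_derivative (\<lambda>_. 0)) (at z)"
    proof (rule has_derivative_transform_within_open[where s = "ball z 1"])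
      fix y assume "y \<in> ball z 1"
      then have "norm (z - y) < 1" by (simp add: dist_norm)
      then have "R \<le> norm y" using z norm_triangle_ineq2[of z "z - y"] by simp
      then show "0 = \<phi> y" using R by simp
    qed auto
    from fun_cong[OF frechet_derivative_at[OF this], of b] show ?thesis by (simp add: \<phi>b_def)
  qed
  have line: "((\<lambda>s. g (z + s *\<^sub>R b)) has_real_derivative L b) (at 0)"
    if "(g has_derivative L) (at z)" for g :: "'a \<Rightarrow> real" and L z
  proof -
    have "((\<lambda>s. z + s *\<^sub>R b) has_derivative (\<lambda>s. s *\<^sub>R b)) (at 0)" by (auto intro!: derivative_eq_intros)
    from has_derivative_compose[OF this, of g L] that
    have "((\<lambda>s. g (z + s *\<^sub>R b)) has_derivative (\<lambda>s. L (s *\<^sub>R b))) (at 0)" by simp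
    moreover have "L (s *\<^sub>R b) = L b * s" for s
      using linear_scale[OF has_derivative_linear[OF that], of s b] by simp
    ultimately show ?thesis unfolding has_field_derivative_def by simp
  qed
  have cD: "continuous_on UNIV (\<lambda>x. D x \<bullet> b)" by (intro continuous_intros D)
  have cw: "continuous_on UNIV (\<lambda>x. f x * \<phi>b x)" "continuous_on UNIV (\<lambda>x. (D x \<bullet> b) * \<phi> x)"
    by (intro continuous_intros f \<phi>b cD td(1))+
  have "(\<integral>z. f z * \<phi>b z + (D z \<bullet> b) * \<phi> z \<partial>lborel) = 0"
  proof (rule integral_partial_derivative_zero[where h = "\<lambda>z. f z * \<phi> z" and R = "R + 1" and b = b])
    show "continuous_on UNIV (\<lambda>z. f z * \<phi> z)" by (intro continuous_intros f td(1))
    show "continuous_on UNIV (\<lambda>z. f z * \<phi>b z + (D z \<bullet> b) * \<phi> z)" by (intro continuous_intros cw)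
    show "((\<lambda>s. f (z + s *\<^sub>R b) * \<phi> (z + s *\<^sub>R b)) has_real_derivative f z * \<phi>b z + (D z \<bullet> b) * \<phi> z) (at 0)" for z
      using DERIV_mult[OF line[OF d[of z]] line[OF td(3)[of z]]] by (simp add: \<phi>b_def ac_simps)
  qed (use R \<phi>b0 in auto)
  moreover have "integrable lborel (\<lambda>x. f x * \<phi>b x)"
    by (rule integrable_continuous_support[OF cw(1), of "R + 1"]) (use \<phi>b0 in auto)
  moreover have "integrable lborel (\<lambda>x. (D x \<bullet> b) * \<phi> x)"
    by (rule integrable_continuous_support[OF cw(2), of R]) (use R in auto)
  ultimately have "(\<integral>z. f z * \<phi>b z \<partial>lborel) = - (\<integral>z. (D z \<bullet> b) * \<phi> z \<partial>lborel)" by simp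
  moreover have "(\<integral>z. f z * \<phi>b z \<partial>lebesgue) = (\<integral>z. f z * \<phi>b z \<partial>lborel)"
    "(\<integral>z. (D z \<bullet> b) * \<phi> z \<partial>lebesgue) = (\<integral>z. (D z \<bullet> b) * \<phi> z \<partial>lborel)"
    using cw by (auto intro!: integral_completion dest: borel_measurable_continuous_onI)
  ultimately show "(\<integral>x. f x * frechet_derivative \<phi> (at x) b \<partial>lebesgue) = - (\<integral>x. (D x \<bullet> b) * \<phi> x \<partial>lebesgue)"
    by (simp add: \<phi>b_def)
qed

section \<open>The extremal bubble\<close>

text \<open>Because q > 1 the derivative at the origin is zero, and the formula agrees there since
  its scalar factor multiplies x = 0.\<close>

lemma has_derivative_norm_powr:
  fixes x :: "'a::euclidean_space"
  assumes q: "q > 1"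
  shows "((\<lambda>x. norm x powr q) has_derivative (\<lambda>h. (q * norm x powr (q - 2)) *\<^sub>R x \<bullet> h)) (at x)"
proof (cases "x = 0")
  case True
  have "((\<lambda>y::'a. norm y powr (q - 1)) \<longlongrightarrow> 0) (at 0)"
    by (rule tendsto_zero_powrI[where b = "q - 1"]) (use q in \<open>auto intro!: tendsto_eq_intros always_eventually\<close>)
  then have "((\<lambda>y::'a. norm (norm y powr q) / norm y) \<longlongrightarrow> 0) (at 0)"
  proof (rule Lim_transform_eventually)
    show "\<forall>\<^sub>F y::'a in at 0. norm y powr (q - 1) = norm (norm y powr q) / norm y"
      by (auto simp: eventually_at_filter powr_diff)
  qed
  then have "((\<lambda>x::'a. norm x powr q) has_derivative (\<lambda>h. 0)) (at 0)"
    using q by (simp add: has_derivative_iff_norm)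
  then show ?thesis using True by simp
next
  case False
  then have n: "norm x > 0" by simp
  have "((\<lambda>t. t powr q) has_real_derivative q * norm x powr (q - 1)) (at (norm x))"
    using has_real_derivative_powr[OF n, of q] .
  then have "((\<lambda>t. t powr q) has_derivative (\<lambda>t. (q * norm x powr (q - 1)) * t)) (at (norm x))"
    by (simp add: has_field_derivative_def)
  from has_derivative_compose[OF has_derivative_norm[OF False] this]
  have "((\<lambda>x. norm x powr q) has_derivative (\<lambda>h. q * norm x powr (q - 1) * (h \<bullet> sgn x))) (at x)" by (simp add: inner_commute)
  moreover have "q * norm x powr (q - 1) * (h \<bullet> sgn x) = (q * norm x powr (q - 2)) *\<^sub>R x \<bullet> h" for h
  proof -
    have "norm x powr (q - 1) = norm x powr (q - 2) * norm x"
      using n powr_add[of "norm x" "q - 2" 1] by simp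
    then show ?thesis using n by (simp add: sgn_div_norm inner_commute)
  qed
  ultimately show ?thesis by simp
qed

text \<open>The field has norm |x|^(q - 1), which tends to 0 at the origin even when the scalar
  factor blows up.\<close>

lemma continuous_norm_powr_scale:
  assumes q: "q > 1"
  shows "continuous_on UNIV (\<lambda>x::'a::euclidean_space. norm x powr (q - 2) *\<^sub>R x)"
proof (rule continuous_at_imp_continuous_on, rule ballI)
  fix x :: 'a
  show "isCont (\<lambda>x. norm x powr (q - 2) *\<^sub>R x) x"
  proof (cases "x = 0")
    case True
    have "((\<lambda>y::'a. norm y powr (q - 1)) \<longlongrightarrow> 0) (at 0)"
      by (rule tendsto_zero_powrI[where b = "q - 1"]) (use q in \<open>auto intro!: tendsto_eq_intros always_eventually\<close>)
    moreover have "norm (norm y powr (q - 2) *\<^sub>R y) = norm y powr (q - 1)" for y :: 'a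
    proof (cases "y = 0")
      case False
      then show ?thesis using powr_add[of "norm y" "q - 2" 1] by simp
    qed simp
    ultimately have "((\<lambda>y::'a. norm y powr (q - 2) *\<^sub>R y) \<longlongrightarrow> 0) (at 0)"
      by (subst tendsto_norm_zero_iff[symmetric]) simp
    then show ?thesis using True by (simp add: isCont_def)
  next
    case False
    then show ?thesis by (intro continuous_intros) auto
  qed
qed

text \<open>Dyadic shells take the place of polar coordinates: for 2^k <= |x| < 2^(k+1) the function
  is at most 2^(-k q s), while the ball of radius 2^(k+1) has volume of order 2^(k N). The resulting
  series is geometric with ratio 2^(N - q s) < 1.\<close>

lemma integrable_radial_decay:
  fixes q s :: real
  assumes q: "q > 0" and qs: "real DIM('a::euclidean_space) < q * s"
  shows "integrable lborel (\<lambda>x::'a. (1 + norm x powr q) powr (- s))"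
proof (rule integrableI_bounded)
  have s: "s > 0" using q qs by (metis less_trans mult_less_0_iff not_less_iff_gr_or_eq of_nat_0_less_iff DIM_positive mult_zero_right)
  define N where "N = DIM('a)"
  define V where "V = unit_ball_vol (real N)"
  have V: "V \<ge> 0" by (simp add: V_def)
  define c where "c = (2::real) powr (real N - q * s)"
  have c: "0 \<le> c" "c < 1" using qs by (auto simp: c_def N_def powr_less_one)
  have bd: "ennreal (norm ((1 + norm x powr q) powr (- s))) \<le> indicator (ball 0 1) x +
     (\<Sum>k. ennreal (2 powr (- (real k * q * s))) * indicator (ball 0 (2 powr (real k + 1))) x)" for x :: 'a
  proof (cases "norm x < 1")
    case True
    have "(1 + norm x powr q) powr (- s) \<le> 1 powr (- s)" using s by (intro powr_mono2') auto
    then have "ennreal (norm ((1 + norm x powr q) powr (- s))) \<le> 1" by (simp add: ennreal_le_1)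
    then show ?thesis using True by (intro order_trans[OF _ add_increasing2[of _ 1]]) auto
  next
    case False
    define k where "k = nat \<lfloor>log 2 (norm x)\<rfloor>"
    have x: "norm x \<ge> 1" "norm x > 0" using False by (auto simp: not_less intro: less_le_trans)
    have "log 2 (norm x) \<ge> 0" using x by simp
    then have k: "real k \<le> log 2 (norm x)" "log 2 (norm x) < real k + 1"
      unfolding k_def by linarith+
    have k1: "2 powr (real k) \<le> norm x" "norm x < 2 powr (real k + 1)"
      using k x by (simp_all add: le_log_iff log_less_iff)
    define f where "f k = ennreal (2 powr (- (real k * q * s))) * indicator (ball 0 (2 powr (real k + 1))) x" for k
    have "(1 + norm x powr q) powr (- s) \<le> (norm x powr q) powr (- s)" using s x by (intro powr_mono2') auto
    also have "\<dots> = norm x powr (- (q * s))" by (simp add: powr_powr)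
    also have "\<dots> \<le> (2 powr real k) powr (- (q * s))" using k1 q s by (intro powr_mono2') auto
    also have "\<dots> = 2 powr (- (real k * q * s))" by (simp add: powr_powr mult.assoc)
    finally have "ennreal (norm ((1 + norm x powr q) powr (- s))) \<le> f k"
      unfolding f_def using k1 by (simp add: ennreal_leI)
    also have "\<dots> \<le> (\<Sum>k. f k)"
      using sum_le_suminf[of f "{k}"] by simp
    finally show ?thesis unfolding f_def by (rule order_trans[OF _ add_increasing[OF zero_le order_refl]])
  qed
  have "(\<integral>\<^sup>+(x::'a). ennreal (norm ((1 + norm x powr q) powr (- s))) \<partial>lborel) \<le> (\<integral>\<^sup>+(x::'a). indicator (ball 0 1) x +
     (\<Sum>k. ennreal (2 powr (- (real k * q * s))) * indicator (ball 0 (2 powr (real k + 1))) x) \<partial>lborel)"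
    by (rule nn_integral_mono) (rule bd)
  also have "\<dots> = emeasure lborel (ball (0::'a) 1) +
     (\<Sum>k. ennreal (2 powr (- (real k * q * s))) * emeasure lborel (ball (0::'a) (2 powr (real k + 1))))"
  proof -
    define B where "B k = ball (0::'a) (2 powr (real k + 1))" for k
    define a where "a k = (2::real) powr (- (real k * q * s))" for k
    have B [measurable]: "B k \<in> sets borel" for k by (simp add: B_def)
    have "(\<integral>\<^sup>+x. indicator (ball (0::'a) 1) x + (\<Sum>k. ennreal (a k) * indicator (B k) x) \<partial>lborel) =
        (\<integral>\<^sup>+x. indicator (ball (0::'a) 1) x \<partial>lborel) + (\<integral>\<^sup>+x. (\<Sum>k. ennreal (a k) * indicator (B k) x) \<partial>lborel)"
      by (rule nn_integral_add) (simp_all add: borel_measurable_indicator)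
    also have "(\<integral>\<^sup>+x. (\<Sum>k. ennreal (a k) * indicator (B k) x) \<partial>lborel) = (\<Sum>k. \<integral>\<^sup>+x. ennreal (a k) * indicator (B k) x \<partial>lborel)"
      by (rule nn_integral_suminf) simp
    also have "\<dots> = (\<Sum>k. ennreal (a k) * emeasure lborel (B k))"
      by (simp add: nn_integral_cmult_indicator)
    finally show ?thesis unfolding B_def a_def by simp
  qed
  also have "(\<Sum>k. ennreal (2 powr (- (real k * q * s))) * emeasure lborel (ball (0::'a) (2 powr (real k + 1)))) = (\<Sum>k. ennreal (V * 2 ^ N * c ^ k))"
  proof (rule suminf_cong)
    fix k
    have "ennreal (2 powr (- (real k * q * s))) * emeasure lborel (ball (0::'a) (2 powr (real k + 1))) =
       ennreal (2 powr (- (real k * q * s)) * (V * (2 powr (real k + 1)) ^ N))"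
      by (simp add: emeasure_ball V_def N_def ennreal_mult')
    also have "2 powr (- (real k * q * s)) * (V * (2 powr (real k + 1)) ^ N) = V * 2 ^ N * c ^ k"
    proof -
      have "(2 powr (real k + 1)) ^ N = (2 powr (real k * real N)) * (2 ^ N :: real)"
        by (simp add: powr_add power_mult_distrib powr_realpow[symmetric] powr_powr)
      moreover have "c ^ k = 2 powr (- (real k * q * s)) * 2 powr (real k * real N)"
        by (simp add: c_def powr_realpow[symmetric] powr_powr powr_add[symmetric] algebra_simps)
      ultimately show ?thesis by simp
    qed
    finally show "ennreal (2 powr (- (real k * q * s))) * emeasure lborel (ball (0::'a) (2 powr (real k + 1))) = ennreal (V * 2 ^ N * c ^ k)" .
  qed
  also have "\<dots> = ennreal (\<Sum>k. V * 2 ^ N * c ^ k)"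
    using c V by (intro suminf_ennreal2 summable_mult summable_geometric) auto
  also have "emeasure lborel (ball (0::'a) 1) + ennreal (\<Sum>k. V * 2 ^ N * c ^ k) < \<infinity>"
    by (use emeasure_bounded_finite[OF bounded_ball[of "0::'a" 1]] in \<open>simp add: ennreal_add_eq_top less_top[symmetric]\<close>)
  finally show "(\<integral>\<^sup>+(x::'a). ennreal (norm ((1 + norm x powr q) powr (- s))) \<partial>lborel) < \<infinity>" .
qed measurable

text \<open>Let h(x) = (1 + |x|^q)^(-(N - 1)). The derivative of h(t x) at t = 1 is -(N - 1) q times
  the integrand on the left, whereas the integral of h(t x) is t^(-N) times that of h, with
  derivative factor -N. Since h decreases along rays, the difference quotients have a sign and
  Fatou's lemma gives one inequality.\<close>

lemma radial_divergence_inequality: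
  fixes q :: real
  defines "N \<equiv> real DIM('a::euclidean_space)"
  assumes q: "q > 0" and N: "N > 1"
    and J: "integrable lborel (\<lambda>x::'a. (1 + norm x powr q) powr (- (N - 1)))"
  shows "integrable lborel (\<lambda>x::'a. (1 + norm x powr q) powr (- N) * norm x powr q)"
    and "(N - 1) * q * (\<integral>(x::'a). (1 + norm x powr q) powr (- N) * norm x powr q \<partial>lborel)
      \<le> N * (\<integral>(x::'a). (1 + norm x powr q) powr (- (N - 1)) \<partial>lborel)"
proof -
  define h :: "'a \<Rightarrow> real" where "h x = (1 + norm x powr q) powr (- (N - 1))" for x
  define k :: "'a \<Rightarrow> real" where "k x = (1 + norm x powr q) powr (- N) * norm x powr q" for x
  have [measurable]: "h \<in> borel_measurable borel" "k \<in> borel_measurable borel"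
    unfolding h_def[abs_def] k_def[abs_def] by measurable
  \<comment> \<open>Scaling factors decreasing to 1, with increment 1 / (n + 1).\<close>
  define lam where "lam n = 1 + 1 / real (Suc n)" for n
  have lam: "lam n > 1" for n by (simp add: lam_def)
  have X: "\<forall>n. 1 / real (Suc n) \<in> UNIV - {0}" "(\<lambda>n. 1 / real (Suc n)) \<longlonglongrightarrow> 0"
    using LIMSEQ_inverse_real_of_nat by (auto simp: inverse_eq_divide)
  have seqD: "(\<lambda>n. real (Suc n) * (f (lam n) - f 1)) \<longlonglongrightarrow> f'" if "(f has_real_derivative f') (at 1)" for f f'
  proof -
    have "((\<lambda>h. (f (1 + h) - f 1) / h) \<longlongrightarrow> f') (at 0)" using that by (simp add: DERIV_def)
    then have "(\<lambda>n. (f (1 + 1 / real (Suc n)) - f 1) / (1 / real (Suc n))) \<longlonglongrightarrow> f'"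
      by (rule tendsto_at_iff_sequentially[THEN iffD1, unfolded comp_def, rule_format, OF _ X(1)[rule_format] X(2)])
    then show ?thesis by (simp add: lam_def mult.commute del: of_nat_Suc)
  qed
  \<comment> \<open>Minus the difference quotient of the scaled function, so that it is
    nonnegative.\<close>
  define F where "F n x = real (Suc n) * (h x - h (lam n *\<^sub>R x))" for n x
  have [measurable]: "F n \<in> borel_measurable borel" for n unfolding F_def[abs_def] by measurable
  have F0: "0 \<le> F n x" for n x
  proof -
    have "norm x \<le> norm (lam n *\<^sub>R x)" using lam[of n] by (simp add: mult_le_cancel_right1)
    then have "norm x powr q \<le> norm (lam n *\<^sub>R x) powr q" using q by (intro powr_mono2) auto
    then have "h (lam n *\<^sub>R x) \<le> h x" unfolding h_def using N by (intro powr_mono2') (auto intro: add_pos_nonneg)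
    then show ?thesis by (simp add: F_def)
  qed
  have lim: "(\<lambda>n. F n x) \<longlonglongrightarrow> (N - 1) * q * k x" for x
  proof -
    define r where "r = norm x powr q"
    have r: "r \<ge> 0" by (simp add: r_def)
    have "((\<lambda>t. (1 + t powr q * r) powr (- (N - 1))) has_real_derivative - ((N - 1) * q * k x)) (at 1)"
    proof -
      have p: "1 + r > 0" using r by simp
      have "((\<lambda>t. 1 + t powr q * r) has_real_derivative q * r) (at 1)"
        by (auto intro!: derivative_eq_intros)
      from DERIV_fun_powr[OF this, of "- (N - 1)"] p
      show ?thesis unfolding k_def r_def[symmetric] by (simp add: algebra_simps)
    qed
    from tendsto_minus[OF seqD[OF this]]
    have "(\<lambda>n. - (real (Suc n) * ((1 + lam n powr q * r) powr (- (N - 1)) - (1 + r) powr (- (N - 1))))) \<longlonglongrightarrow> (N - 1) * q * k x"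
      by simp
    moreover have "- (real (Suc n) * ((1 + lam n powr q * r) powr (- (N - 1)) - (1 + r) powr (- (N - 1)))) = F n x" for n
      using lam[of n] by (simp add: F_def h_def r_def powr_mult right_diff_distrib del: of_nat_Suc)
    ultimately show ?thesis by simp
  qed
  define JJ where "JJ = (\<integral>x. h x \<partial>lborel)"
  have hi: "integrable lborel h" using J by (simp add: h_def[abs_def])
  have h0: "0 \<le> h x" for x by (simp add: h_def)
  have J0: "JJ \<ge> 0" unfolding JJ_def using h0 by (intro integral_nonneg_AE) auto
  have nh: "(\<integral>\<^sup>+x. ennreal (h x) \<partial>lborel) = ennreal JJ" unfolding JJ_def using hi h0 by (intro nn_integral_eq_integral) auto
  have sc: "integrable lborel (\<lambda>x. h (lam n *\<^sub>R x))" "(\<integral>x. h (lam n *\<^sub>R x) \<partial>lborel) = 1 / lam n ^ DIM('a) * JJ" for n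
  proof -
    have n: "(\<integral>\<^sup>+x. ennreal (h (lam n *\<^sub>R x)) \<partial>lborel) = ennreal (1 / lam n ^ DIM('a) * JJ)"
    proof -
      have "ennreal (1 / lam n ^ DIM('a) * JJ) = ennreal (1 / lam n ^ DIM('a)) * ennreal JJ"
        by (rule ennreal_mult') (use lam[of n] in simp)
      then show ?thesis
        using nn_integral_lborel_translate[of "\<lambda>x. ennreal (h x)" "lam n" 0] lam[of n] nh by simp
    qed
    show i: "integrable lborel (\<lambda>x. h (lam n *\<^sub>R x))"
      using n h0 by (intro integrableI_nonneg) auto
    show "(\<integral>x. h (lam n *\<^sub>R x) \<partial>lborel) = 1 / lam n ^ DIM('a) * JJ"
      using nn_integral_eq_integral[OF i] n h0 lam[of n] J0 by (simp add: integral_nonneg_AE)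
  qed
  have nF: "(\<integral>\<^sup>+x. ennreal (F n x) \<partial>lborel) = ennreal (real (Suc n) * (1 - 1 / lam n ^ DIM('a)) * JJ)" for n
  proof -
    have i: "integrable lborel (F n)" unfolding F_def[abs_def] using hi sc(1)[of n] by auto
    have "(\<integral>x. F n x \<partial>lborel) = real (Suc n) * (JJ - 1 / lam n ^ DIM('a) * JJ)"
      unfolding F_def using hi sc[of n] by (simp add: JJ_def)
    also have "\<dots> = real (Suc n) * (1 - 1 / lam n ^ DIM('a)) * JJ"
      by (simp add: algebra_simps del: of_nat_Suc)
    finally show ?thesis using nn_integral_eq_integral[OF i] F0 by simp
  qed
  have "((\<lambda>t. 1 / t ^ DIM('a)) has_real_derivative - N) (at 1)"
    by (auto intro!: derivative_eq_intros simp: N_def)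
  from tendsto_mult[OF tendsto_minus[OF seqD[OF this]] tendsto_const[of JJ]]
  have nlim: "(\<lambda>n. ennreal (real (Suc n) * (1 - 1 / lam n ^ DIM('a)) * JJ)) \<longlonglongrightarrow> ennreal (N * JJ)"
    by (intro tendsto_ennrealI) (simp add: algebra_simps)
  have "(\<integral>\<^sup>+x. ennreal ((N - 1) * q * k x) \<partial>lborel) = (\<integral>\<^sup>+x. liminf (\<lambda>n. ennreal (F n x)) \<partial>lborel)"
  proof (rule nn_integral_cong)
    fix x
    have "(\<lambda>n. ennreal (F n x)) \<longlonglongrightarrow> ennreal ((N - 1) * q * k x)" by (intro tendsto_ennrealI lim)
    then show "ennreal ((N - 1) * q * k x) = liminf (\<lambda>n. ennreal (F n x))"
      by (intro lim_imp_Liminf[symmetric]) auto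
  qed
  also have "\<dots> \<le> liminf (\<lambda>n. \<integral>\<^sup>+x. ennreal (F n x) \<partial>lborel)" by (rule nn_integral_liminf) measurable
  also have "\<dots> = ennreal (N * JJ)" unfolding nF using nlim by (intro lim_imp_Liminf) auto
  finally have le: "(\<integral>\<^sup>+x. ennreal ((N - 1) * q * k x) \<partial>lborel) \<le> ennreal (N * JJ)" .
  have k0: "0 \<le> k x" for x by (simp add: k_def)
  define c where "c = (N - 1) * q"
  have c: "c > 0" using N q by (simp add: c_def)
  have i: "integrable lborel (\<lambda>x. c * k x)"
  proof (rule integrableI_nonneg)
    show "(\<integral>\<^sup>+x. ennreal (c * k x) \<partial>lborel) < \<infinity>" using le by (auto simp: c_def intro: le_less_trans)
  qed (use c k0 in auto)
  have "integrable lborel k" using integrable_mult_right[OF i, of "1 / c"] c by simp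
  then show "integrable lborel (\<lambda>x::'a. (1 + norm x powr q) powr (- N) * norm x powr q)" by (simp add: k_def[abs_def])
  have "ennreal (c * (\<integral>x. k x \<partial>lborel)) \<le> ennreal (N * JJ)"
    using le[folded c_def] nn_integral_eq_integral[OF i] c k0 by simp
  then have "c * (\<integral>x. k x \<partial>lborel) \<le> N * JJ" using J0 N by (simp add: ennreal_le_iff)
  then have "(N - 1) * q * (\<integral>x. k x \<partial>lborel) \<le> N * JJ" unfolding c_def .
  then show "(N - 1) * q * (\<integral>(x::'a). (1 + norm x powr q) powr (- N) * norm x powr q \<partial>lborel)
      \<le> N * (\<integral>(x::'a). (1 + norm x powr q) powr (- (N - 1)) \<partial>lborel)"
    by (simp add: k_def JJ_def h_def)
qed

definition bubble :: "real \<Rightarrow> 'a::euclidean_space \<Rightarrow> real" where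
  "bubble p x = (1 + norm x powr (p / (p - 1))) powr (- ((real DIM('a) - p) / p))"

text \<open>The last factor is grouped as a vector field because its scalar coefficient alone may be
  singular at the origin.\<close>

definition bubble_grad :: "real \<Rightarrow> 'a::euclidean_space \<Rightarrow> 'a" where
  "bubble_grad p x = (- ((real DIM('a) - p) / (p - 1)) * (1 + norm x powr (p / (p - 1))) powr (- (real DIM('a) / p))) *\<^sub>R
     (norm x powr (p / (p - 1) - 2) *\<^sub>R x)"

lemma bubble_pos: "bubble p x > 0"
  by (simp add: bubble_def add_pos_nonneg less_imp_neq[symmetric])

lemma has_derivative_bubble:
  fixes x :: "'a::euclidean_space"
  assumes p: "1 < p"
  shows "(bubble p has_derivative (\<lambda>h. bubble_grad p x \<bullet> h)) (at x)"
proof -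
  define N where "N = real DIM('a)"
  define q where "q = p / (p - 1)"
  define m where "m = (N - p) / p"
  have q: "q > 1" using p by (simp add: q_def field_simps)
  have pos: "1 + norm x powr q > 0" by (simp add: add_pos_nonneg)
  define c where "c = (- m) * (1 + norm x powr q) powr (- m - 1)"
  have "((\<lambda>t. 1 + t) has_real_derivative 1) (at (norm x powr q))" by (auto intro!: derivative_eq_intros)
  from DERIV_fun_powr[OF this pos, of "- m"]
  have "((\<lambda>t. (1 + t) powr (- m)) has_real_derivative c) (at (norm x powr q))"
    by (simp add: c_def)
  then have "((\<lambda>t. (1 + t) powr (- m)) has_derivative (\<lambda>t. c * t)) (at (norm x powr q))"
    by (simp add: has_field_derivative_def)
  from has_derivative_compose[OF has_derivative_norm_powr[OF q, of x] this]
  have "((\<lambda>x. (1 + norm x powr q) powr (- m)) has_derivative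
      (\<lambda>h. c * ((q * norm x powr (q - 2)) *\<^sub>R x \<bullet> h))) (at x)" by simp
  moreover have "c * ((q * norm x powr (q - 2)) *\<^sub>R x \<bullet> h) = bubble_grad p x \<bullet> h" for h
  proof -
    have "- m - 1 = - (N / p)" "m * q = (N - p) / (p - 1)" using p by (auto simp: m_def q_def field_simps)
    then show ?thesis by (simp add: c_def bubble_grad_def q_def[symmetric] N_def[symmetric] flip: \<open>m * q = _\<close>)
  qed
  moreover have "bubble p = (\<lambda>x::'a. (1 + norm x powr q) powr (- m))"
    by (simp add: fun_eq_iff bubble_def q_def m_def N_def)
  ultimately show ?thesis by simp
qed

lemma continuous_one_plus_norm_powr:
  assumes "q > 1"
  shows "continuous_on UNIV (\<lambda>x::'a::euclidean_space. (1 + norm x powr q) powr s)"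
proof -
  have "continuous_on UNIV (\<lambda>x::'a. norm x powr q)"
    using assms by (intro continuous_on_powr' continuous_intros) auto
  note c = this
  have pos: "1 + norm x powr q > 0" for x :: 'a by (simp add: add_pos_nonneg)
  show ?thesis
    by (rule continuous_on_powr[OF continuous_on_add[OF continuous_on_const c] continuous_on_const])
      (simp add: less_imp_neq[OF pos, symmetric])
qed

lemma continuous_bubble_grad:
  assumes "1 < p"
  shows "continuous_on UNIV (bubble_grad p :: 'a::euclidean_space \<Rightarrow> 'a)"
proof -
  have "p / (p - 1) > 1" using assms by (simp add: field_simps)
  then show ?thesis unfolding bubble_grad_def[abs_def]
    by (intro continuous_on_scaleR continuous_on_mult continuous_on_const continuous_one_plus_norm_powr continuous_norm_powr_scale)
qed

lemma has_weak_gradient_bubble: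
  assumes "1 < p"
  shows "has_weak_gradient (\<lambda>x. c * bubble p (x::'a::euclidean_space)) (\<lambda>x. c *\<^sub>R bubble_grad p x)"
proof (rule has_weak_gradient_C1)
  show "((\<lambda>x. c * bubble p x) has_derivative (\<lambda>h. c *\<^sub>R bubble_grad p x \<bullet> h)) (at x)" for x :: 'a
    using has_derivative_mult_right[OF has_derivative_bubble[OF assms, of x], of c] by simp
  show "continuous_on UNIV (\<lambda>x::'a. c *\<^sub>R bubble_grad p x)"
    by (intro continuous_intros continuous_bubble_grad assms)
qed

text \<open>The \<open>ps\<close>-th power of the bubble is the target density \<open>G\<close>, and
  the p-th power of its gradient is a constant times \<open>G x * norm x powr q\<close>. So
  \<open>M\<close> and \<open>A\<close> are, up to that constant, integrals from the transport
  inequality, and the last claim is the Sobolev inequality with the constant for which the bubble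
  gives equality.\<close>

lemma bubble_sobolev:
  fixes p :: real
  defines "N \<equiv> real DIM('a::euclidean_space)"
  defines "ps \<equiv> N * p / (N - p)"
  defines "M \<equiv> \<integral>(x::'a). bubble p x powr ps \<partial>lborel" and "A \<equiv> \<integral>(x::'a). norm (bubble_grad p x) powr p \<partial>lborel"
  assumes p: "1 < p" "p < N / 2"
  shows "integrable lborel (\<lambda>x::'a. bubble p x powr ps)" "integrable lborel (\<lambda>x::'a. norm (bubble_grad p x) powr p)"
    "M > 0" "A > 0"
    "\<And>(u :: 'a \<Rightarrow> real) g. has_weak_gradient u g \<Longrightarrow> integrable lebesgue (\<lambda>x. \<bar>u x\<bar> powr ps) \<Longrightarrow>
       integrable lebesgue (\<lambda>x. norm (g x) powr p) \<Longrightarrow>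
       (\<integral>x. \<bar>u x\<bar> powr ps \<partial>lebesgue) \<le> M * ((\<integral>x. norm (g x) powr p \<partial>lebesgue) / A) powr (ps / p)"
proof -
  define q where "q = p / (p - 1)"
  define r where "r = p * (N - 1) / (N - p)"
  define G :: "'a \<Rightarrow> real" where "G x = (1 + norm x powr q) powr (- N)" for x
  define I where "I = (\<integral>x. G x * norm x powr q \<partial>lborel)"
  define J where "J = (\<integral>x. G x powr (1 - 1 / N) \<partial>lborel)"
  have N: "N > 2" "N - p > 0" "N > 1" using p by auto
  have q: "q > 1" "1 / p + 1 / q = 1" using p by (auto simp: q_def field_simps)
  have ps: "ps > 0" using p N by (simp add: ps_def)
  have r: "r > 0" using p N by (simp add: r_def)
  have base: "1 + norm x powr q > 0" "1 + norm x powr q \<ge> 1" for x :: 'a by (auto simp: add_pos_nonneg)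
  have cG: "continuous_on UNIV G" unfolding G_def[abs_def] by (rule continuous_one_plus_norm_powr[OF q(1)])
  have G0: "0 < G x" for x by (simp add: G_def add_pos_nonneg less_imp_neq[symmetric])
  have G1: "G x \<le> 1" for x
    using powr_mono2'[of "- N" 1 "1 + norm x powr q"] base[of x] N by (simp add: G_def)
  have GJ: "G x powr (1 - 1 / N) = (1 + norm x powr q) powr (- (N - 1))" for x
    using N by (simp add: G_def powr_powr right_diff_distrib)
  \<comment> \<open>The decay condition for integrability of \<open>G powr (1 - 1 / N)\<close>;
    written out, it says p < N.\<close>
  have "N < q * (N - 1)"
  proof -
    have "N * (p - 1) < p * (N - 1)" using p N by (simp add: algebra_simps)
    then show ?thesis using p by (simp add: q_def field_simps)
  qed
  then have Ji: "integrable lborel (\<lambda>x::'a. (1 + norm x powr q) powr (- (N - 1)))"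
    using q by (intro integrable_radial_decay) (auto simp: N_def)
  have Ji': "integrable lborel (\<lambda>x. G x powr (1 - 1 / N))" unfolding GJ by (rule Ji)
  have [measurable]: "G \<in> borel_measurable borel" using cG by (rule borel_measurable_continuous_onI)
  \<comment> \<open>As \<open>G \<le> 1\<close>, the smaller exponent gives the larger
    function.\<close>
  have Gi: "integrable lborel G"
  proof (rule Bochner_Integration.integrable_bound[OF Ji'])
    show "AE x in lborel. norm (G x) \<le> norm (G x powr (1 - 1 / N))"
    proof (rule AE_I2)
      fix x
      have "G x powr 1 \<le> G x powr (1 - 1 / N)" using G0[of x] G1[of x] N by (intro powr_mono') auto
      then show "norm (G x) \<le> norm (G x powr (1 - 1 / N))" using G0[of x] by simp
    qed
  qed measurable
  have rd: "integrable lborel (\<lambda>x. G x * norm x powr q)" "(N - 1) * q * I \<le> N * J"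
    using radial_divergence_inequality[where 'a = 'a and q = q] Ji N q unfolding N_def[symmetric]
    by (simp_all add: I_def J_def GJ) (simp_all add: G_def)
  have bG: "bubble p x powr ps = G x" for x :: 'a
  proof -
    have "(N - p) / p * ps = N" using p N by (simp add: ps_def)
    then show ?thesis unfolding bubble_def N_def[symmetric] q_def[symmetric] powr_powr G_def by simp
  qed
  define cc where "cc = (N - p) / (p - 1)"
  have cc: "cc > 0" using p N by (simp add: cc_def)
  have gG: "norm (bubble_grad p x) powr p = cc powr p * (G x * norm x powr q)" for x :: 'a
  proof (cases "x = 0")
    case True
    then show ?thesis by (simp add: bubble_grad_def)
  next
    case False
    then have x: "norm x > 0" by simp
    have n: "norm x powr (q - 2) * norm x = norm x powr (q - 1)"
      using x powr_add[of "norm x" "q - 2" 1] by simp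
    have "norm (bubble_grad p x) = cc * (1 + norm x powr q) powr (- (N / p)) * norm x powr (q - 1)"
      unfolding bubble_grad_def N_def[symmetric] q_def[symmetric] cc_def[symmetric] using cc n
      by (simp add: abs_mult)
    moreover have "(q - 1) * p = q" using p by (simp add: q_def field_simps)
    ultimately show ?thesis using p cc
      by (simp add: powr_mult powr_powr G_def)
  qed
  show "integrable lborel (\<lambda>x::'a. bubble p x powr ps)" unfolding bG by (rule Gi)
  show "integrable lborel (\<lambda>x::'a. norm (bubble_grad p x) powr p)" unfolding gG using rd(1) by simp
  have MG: "M = (\<integral>x. G x \<partial>lborel)" unfolding M_def bG ..
  have AI: "A = cc powr p * I" unfolding A_def gG I_def using rd(1) by simp
  \<comment> \<open>Vanishing at the origin is permitted, because the integrand of \<open>I\<close>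
    vanishes there.\<close>
  have posint: "(\<integral>x. f x \<partial>lborel) > 0" if i: "integrable lborel f" and f: "\<And>x. 0 \<le> f x" "\<And>x. x \<noteq> 0 \<Longrightarrow> f x \<noteq> 0" for f :: "'a \<Rightarrow> real"
  proof -
    have "\<not> (AE x in lborel. f x = 0)"
    proof
      assume "AE x in lborel. f x = 0"
      with AE_lborel_singleton[of "0::'a"] have "AE x in (lborel :: 'a measure). False"
        by eventually_elim (use f(2) in auto)
      then have "emeasure lborel (UNIV :: 'a set) = 0" by (simp add: AE_iff_measurable[OF _ refl])
      then show False by simp
    qed
    then show ?thesis
      using integral_nonneg_eq_0_iff_AE[OF i] f(1) integral_nonneg_AE[of f lborel] by (auto simp: less_le)
  qed
  show M: "M > 0" unfolding MG using G0 by (intro posint Gi) (auto simp: less_imp_le less_imp_neq[symmetric])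
  have I: "I > 0" unfolding I_def using G0 by (intro posint rd(1)) (auto simp: less_imp_le less_imp_neq[symmetric])
  have J: "J > 0" unfolding J_def by (intro posint Ji') (use G0 in \<open>auto simp: less_imp_neq[symmetric]\<close>)
  show A: "A > 0" using AI cc I by simp
  fix u :: "'a \<Rightarrow> real" and g
  assume u: "has_weak_gradient u g" "integrable lebesgue (\<lambda>x. \<bar>u x\<bar> powr ps)" "integrable lebesgue (\<lambda>x. norm (g x) powr p)"
  define E where "E = (\<integral>x. norm (g x) powr p \<partial>lebesgue)"
  have E0: "E \<ge> 0" unfolding E_def by (intro integral_nonneg_AE) auto
  have S: "(\<integral>x. \<bar>u x\<bar> powr ps \<partial>lebesgue) \<le> M * (r * (E powr (1 / p) * I powr (1 / q)) / (N * J)) powr ps"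
    unfolding MG ps_def N_def r_def E_def I_def J_def q_def
    by (rule sobolev_weak_gradient[where C = 1])
      (use p u cG G0 G1 Gi Ji' rd(1) J M MG in \<open>simp_all add: N_def ps_def q_def J_def\<close>)
  have "r * (E powr (1 / p) * I powr (1 / q)) / (N * J) \<le> (E / A) powr (1 / p)"
  proof -
    \<comment> \<open>By this identity the divergence inequality bounds the constant r / (N J) of
      the transport inequality by 1 / (cc I), which is where the bubble becomes extremal.\<close>
    have rc: "r * cc = (N - 1) * q" using p N by (simp add: r_def cc_def q_def)
    have "r * cc * I \<le> N * J" using rd(2) rc by simp
    then have "r / (N * J) \<le> 1 / (cc * I)" using cc I J N by (simp add: field_simps)
    then have "r / (N * J) * (E powr (1 / p) * I powr (1 / q)) \<le> 1 / (cc * I) * (E powr (1 / p) * I powr (1 / q))"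
      by (intro mult_right_mono) auto
    also have "\<dots> = (E / A) powr (1 / p)"
    proof -
      have Ipq: "I powr (1 / p) * I powr (1 / q) = I" using I q by (subst powr_add[symmetric]) simp
      have "1 / (cc * (a * b)) * (e * b) = e / (cc * a)" if "b \<noteq> 0" for a b e :: real
        using that by simp
      from this[of "I powr (1 / q)" "I powr (1 / p)" "E powr (1 / p)"]
      have "1 / (cc * I) * (E powr (1 / p) * I powr (1 / q)) = E powr (1 / p) / (cc * I powr (1 / p))"
        unfolding Ipq using I by simp
      also have "\<dots> = (E / A) powr (1 / p)"
        unfolding AI using E0 cc I p by (simp add: powr_divide powr_mult powr_powr)
      finally show ?thesis .
    qed
    finally show ?thesis by simp
  qed
  then have "(r * (E powr (1 / p) * I powr (1 / q)) / (N * J)) powr ps \<le> ((E / A) powr (1 / p)) powr ps"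
    using r N J ps by (intro powr_mono2) auto
  then have "M * (r * (E powr (1 / p) * I powr (1 / q)) / (N * J)) powr ps \<le> M * (E / A) powr (ps / p)"
    using M by (simp add: powr_powr)
  then show "(\<integral>x. \<bar>u x\<bar> powr ps \<partial>lebesgue) \<le> M * ((\<integral>x. norm (g x) powr p \<partial>lebesgue) / A) powr (ps / p)"
    using S unfolding E_def by simp
qed

section \<open>The ground state\<close>

text \<open>Near t = 0 the coupling term gains at order t^a with a < 1, while the second term loses
  only linearly.\<close>

lemma coupling_not_maximal_at_0:
  fixes \<mu>1 \<mu>2 \<gamma> a b r :: real
  assumes \<mu>: "\<mu>1 > 0" "\<mu>2 > 0" "\<gamma> > 0" and ab: "0 < a" "a < 1" "0 < b" "b < 1" "r = a + b" "r > 1"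
  shows "\<exists>t\<in>{0..1}. \<mu>2 < \<mu>1 * t powr r + \<mu>2 * (1 - t) powr r + \<gamma> * (t powr a * (1 - t) powr b)"
proof -
  \<comment> \<open>Chosen so that \<open>t powr (1 - a) \<le> e\<close> makes the coupling term at
    least \<open>4 * \<mu>2 * t\<close>, twice the linear loss; the restriction t <= 1/2 bounds the
    factor (1 - t)^b from below.\<close>
  define e where "e = \<gamma> * (1 / 2) powr b / (4 * \<mu>2)"
  define t where "t = min (1 / 2) (e powr (1 / (1 - a)))"
  have e: "e > 0" using \<mu> by (simp add: e_def)
  have t: "0 < t" "t \<le> 1 / 2" using e by (auto simp: t_def)
  have "t powr (1 - a) \<le> (e powr (1 / (1 - a))) powr (1 - a)"
    using t ab by (intro powr_mono2) (auto simp: t_def)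
  then have te: "t powr (1 - a) \<le> e" using e ab by (simp add: powr_powr)
  have "t = t powr (1 - a) * t powr a" using t by (subst powr_add[symmetric]) simp
  also have "\<dots> \<le> e * t powr a" using te by (intro mult_right_mono) auto
  finally have "4 * \<mu>2 * t \<le> 4 * \<mu>2 * (e * t powr a)" using \<mu> by (intro mult_left_mono) auto
  also have "\<dots> = \<gamma> * (t powr a * (1 / 2) powr b)" using \<mu> by (simp add: e_def)
  also have "\<dots> \<le> \<gamma> * (t powr a * (1 - t) powr b)"
    using \<mu> t ab by (intro mult_left_mono powr_mono2) auto
  finally have 1: "4 * \<mu>2 * t \<le> \<gamma> * (t powr a * (1 - t) powr b)" .
  \<comment> \<open>As r = a + b < 2, the power r may be replaced by the square, and (1 - t)^2 is at
    least 1 - 2t.\<close>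
  have "(1 - t) powr 2 \<le> (1 - t) powr r" using t ab by (intro powr_mono') auto
  then have "1 - 2 * t \<le> (1 - t) powr r" using t by (simp add: power2_eq_square algebra_simps)
       (use zero_le_square[of t] in linarith)
  then have "\<mu>2 * (1 - 2 * t) \<le> \<mu>2 * (1 - t) powr r" using \<mu> by (intro mult_left_mono) auto
  moreover have "0 < \<mu>1 * t powr r" using \<mu> t by simp
  moreover have "0 < \<mu>2 * t" using \<mu> t by simp
  ultimately have "\<mu>2 < \<mu>1 * t powr r + \<mu>2 * (1 - t) powr r + \<gamma> * (t powr a * (1 - t) powr b)"
    using 1 by (simp add: algebra_simps)
  then show ?thesis using t by (intro bexI[of _ t]) auto
qed

text \<open>The maximum over the segment exists by compactness and is interior by the preceding
  lemma at both ends. Vanishing of the derivative equates two quotients, whose common value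
  \<open>L\<close> is the Lagrange multiplier; weighting by k and l and using a + b = r gives
  \<open>L = r * M\<close>. Homogeneity of degree r extends the bound from the segment to the
  quadrant.\<close>

lemma coupling_maximum:
  fixes \<mu>1 \<mu>2 \<gamma> a b r :: real
  assumes \<mu>: "\<mu>1 > 0" "\<mu>2 > 0" "\<gamma> > 0" and ab: "0 < a" "a < 1" "0 < b" "b < 1" "r = a + b" "r > 1"
  obtains k l M where "k > 0" "l > 0" "k + l = 1" "M > 0"
    "\<And>x y. 0 \<le> x \<Longrightarrow> 0 \<le> y \<Longrightarrow> \<mu>1 * x powr r + \<mu>2 * y powr r + \<gamma> * (x powr a * y powr b) \<le> M * (x + y) powr r"
    "\<mu>1 * k powr r + a / r * \<gamma> * (k powr a * l powr b) = M * k"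
    "\<mu>2 * l powr r + b / r * \<gamma> * (k powr a * l powr b) = M * l"
proof -
  define H where "H t = \<mu>1 * t powr r + \<mu>2 * (1 - t) powr r + \<gamma> * (t powr a * (1 - t) powr b)" for t
  have "continuous_on {0..1} H"
    unfolding H_def[abs_def] using ab by (intro continuous_intros continuous_on_powr') auto
  then obtain t where t: "t \<in> {0..1}" and mx: "\<And>s. s \<in> {0..1} \<Longrightarrow> H s \<le> H t"
    using continuous_attains_sup[of "{0..1::real}" H] by auto
  have "t \<noteq> 0"
  proof
    assume "t = 0"
    then have "H t = \<mu>2" using ab by (simp add: H_def)
    moreover obtain s where "s \<in> {0..1}" "\<mu>2 < H s"
      using coupling_not_maximal_at_0[OF \<mu> ab] by (auto simp: H_def)
    ultimately show False using mx[of s] by simp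
  qed
  moreover have "t \<noteq> 1"
  proof
    \<comment> \<open>Exchanging the two components reduces this endpoint to the other one.\<close>
    assume "t = 1"
    then have "H t = \<mu>1" using ab by (simp add: H_def)
    moreover obtain s where "s \<in> {0..1}" "\<mu>1 < \<mu>2 * s powr r + \<mu>1 * (1 - s) powr r + \<gamma> * (s powr b * (1 - s) powr a)"
      using coupling_not_maximal_at_0[OF \<mu>(2,1,3) ab(3,4,1,2)] ab by (auto simp: add.commute)
    then have "1 - s \<in> {0..1}" "\<mu>1 < H (1 - s)" by (auto simp: H_def mult.commute add.commute)
    ultimately show False using mx[of "1 - s"] by simp
  qed
  ultimately have t01: "0 < t" "t < 1" using t by auto
  define l where "l = 1 - t"
  define P where "P = \<mu>1 * t powr r"
  define Q where "Q = \<mu>2 * l powr r"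
  define R where "R = \<gamma> * (t powr a * l powr b)"
  define M where "M = H t"
  have l: "l > 0" using t01 by (simp add: l_def)
  have M: "M = P + Q + R" by (simp add: M_def H_def P_def Q_def R_def l_def)
  have PQR: "P > 0" "Q > 0" "R > 0" using \<mu> t01 l by (auto simp: P_def Q_def R_def)
  have r: "r > 0" using ab by simp
  have "(H has_real_derivative r * P / t - r * Q / l + (a * R / t - b * R / l)) (at t)"
  proof -
    have p: "((\<lambda>t. t powr c) has_real_derivative c * t powr c / t) (at t)" for c
      using has_real_derivative_powr[OF t01(1), of c] t01 by (simp add: powr_diff)
    have p': "((\<lambda>t. (1 - t) powr c) has_real_derivative - (c * l powr c / l)) (at t)" for c
    proof -
      have "((\<lambda>t. 1 - t) has_real_derivative - 1) (at t)" by (auto intro!: derivative_eq_intros)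
      from DERIV_fun_powr[OF this, of c] show ?thesis using l by (simp add: l_def powr_diff)
    qed
    show ?thesis unfolding H_def[abs_def] P_def Q_def R_def
      by (rule derivative_eq_intros p p' refl)+ (simp add: l_def algebra_simps)
  qed
  moreover have "H s \<le> H t" if "\<bar>t - s\<bar> < min t (1 - t)" for s
    using that by (intro mx) (auto simp: abs_less_iff)
  ultimately have "r * P / t - r * Q / l + (a * R / t - b * R / l) = 0"
    using t01 by (intro DERIV_local_max[where d = "min t (1 - t)"]) auto
  then have e: "(r * P + a * R) / t = (r * Q + b * R) / l" by (simp add: add_divide_distrib)
  define L where "L = (r * P + a * R) / t"
  have L1: "r * P + a * R = L * t" using t01 by (simp add: L_def)
  have L2: "r * Q + b * R = L * l" unfolding L_def e using l by simp
  have "L = L * t + L * l" by (simp add: l_def algebra_simps)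
  also have "\<dots> = r * M" unfolding L1[symmetric] L2[symmetric] M using ab by (simp add: algebra_simps)
  finally have LM: "L = r * M" .
  have hom: "\<mu>1 * x powr r + \<mu>2 * y powr r + \<gamma> * (x powr a * y powr b) \<le> M * (x + y) powr r"
    if "0 \<le> x" "0 \<le> y" for x y
  proof (cases "x + y = 0")
    case True
    then have "x = 0" "y = 0" using that by auto
    then show ?thesis using ab by simp
  next
    case False
    define s where "s = x / (x + y)"
    define z where "z = x + y"
    have z: "z > 0" using False that by (simp add: z_def)
    have s: "s \<in> {0..1}" using that False by (auto simp: s_def divide_le_eq)
    have xy: "x = z * s" "y = z * (1 - s)" using False by (auto simp: s_def z_def field_simps)
    have zr: "z powr r = z powr a * z powr b" using ab by (simp add: powr_add)
    have "\<mu>1 * x powr r + \<mu>2 * y powr r + \<gamma> * (x powr a * y powr b) = z powr r * H s"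
    proof -
      have pw: "(z * s) powr c = z powr c * s powr c" "(z * (1 - s)) powr c = z powr c * (1 - s) powr c" for c
        using z s by (simp_all add: powr_mult)
      have g: "z powr a * s powr a * (z powr b * (1 - s) powr b) = z powr r * (s powr a * (1 - s) powr b)"
        unfolding zr by (simp only: mult_ac)
      show ?thesis unfolding xy H_def pw g by (simp only: distrib_left mult_ac)
    qed
    also have "\<dots> \<le> z powr r * M" unfolding M_def using mx[OF s] by (intro mult_left_mono) auto
    finally show ?thesis by (simp add: z_def mult.commute)
  qed
  have 1: "\<mu>1 * t powr r + a / r * \<gamma> * (t powr a * l powr b) = M * t"
    using L1 LM r unfolding P_def R_def by (simp add: field_simps)
  have 2: "\<mu>2 * l powr r + b / r * \<gamma> * (t powr a * l powr b) = M * l"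
    using L2 LM r unfolding Q_def R_def by (simp add: field_simps)
  show ?thesis
    by (rule that[of t l M, OF t01(1) l _ _ hom 1 2]) (use M PQR in \<open>auto simp: l_def\<close>)
qed

section \<open>From the bubble and the maximum on the simplex to the ground state\<close>

lemma D1pD:
  fixes u :: "'a::euclidean_space \<Rightarrow> real"
  assumes "u \<in> D1p p"
  shows "u \<in> borel_measurable lebesgue" "integrable lebesgue (\<lambda>x. \<bar>u x\<bar> powr crit_exp DIM('a) p)"
    "has_weak_gradient u (weak_grad u)" "integrable lebesgue (\<lambda>x. norm (weak_grad u x) powr p)"
  using assms by (auto simp: D1p_def Lp_def)

text \<open>By uniqueness the chosen weak gradient agrees almost everywhere with the classical
  gradient, so its integral is explicit.\<close>

lemma bubble_multiple_D1p:
  fixes p c :: real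
  defines "N \<equiv> real DIM('a::euclidean_space)"
  defines "ps \<equiv> N * p / (N - p)"
  defines "u \<equiv> \<lambda>x::'a. c * bubble p x"
  assumes p: "1 < p" "p < N / 2" and c: "c > 0"
  shows "u \<in> D1p p"
    and "(\<integral>x. norm (weak_grad u x) powr p \<partial>lebesgue) = c powr p * (\<integral>(x::'a). norm (bubble_grad p x) powr p \<partial>lborel)"
proof -
  have b: "integrable lborel (\<lambda>x::'a. bubble p x powr ps)" "integrable lborel (\<lambda>x::'a. norm (bubble_grad p x) powr p)"
    using bubble_sobolev(1,2)[where 'a = 'a, of p] p unfolding N_def ps_def by auto
  have cu: "continuous_on UNIV (bubble p :: 'a \<Rightarrow> real)"
    using has_derivative_bubble[OF p(1)] by (meson continuous_at_imp_continuous_on has_derivative_continuous)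
  have [measurable]: "(bubble p :: 'a \<Rightarrow> real) \<in> borel_measurable borel" "(bubble_grad p :: 'a \<Rightarrow> 'a) \<in> borel_measurable borel"
    using cu continuous_bubble_grad[OF p(1)] borel_measurable_continuous_onI by auto
  have w: "has_weak_gradient u (\<lambda>x. c *\<^sub>R bubble_grad p x)"
    unfolding u_def by (rule has_weak_gradient_bubble[OF p(1)])
  then have w': "has_weak_gradient u (weak_grad u)" unfolding weak_grad_def by (rule someI[where P = "has_weak_gradient u"])
  have ae: "AE x in lborel. weak_grad u x = c *\<^sub>R bubble_grad p x" by (rule weak_gradient_unique[OF w' w])
  have gm: "weak_grad u \<in> borel_measurable lebesgue"
    using w' by (auto simp: has_weak_gradient_def locally_integrable_def)
  have ae': "AE x in lborel. norm (weak_grad u x) powr p = c powr p * norm (bubble_grad p x) powr p"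
    using ae by eventually_elim (use c in \<open>simp add: powr_mult\<close>)
  have gm': "(\<lambda>x. norm (weak_grad u x) powr p) \<in> borel_measurable lebesgue" using gm by measurable
  have bm: "(\<lambda>x::'a. c powr p * norm (bubble_grad p x) powr p) \<in> borel_measurable borel" by measurable
  have gi: "integrable lebesgue (\<lambda>x. norm (weak_grad u x) powr p)"
    using lebesgue_borel_version(2)[OF gm' bm ae'] b(2) by simp
  show "(\<integral>x. norm (weak_grad u x) powr p \<partial>lebesgue) = c powr p * (\<integral>(x::'a). norm (bubble_grad p x) powr p \<partial>lborel)"
    using lebesgue_borel_version(1)[OF gm' bm ae'] b(2) by simp
  have um: "u \<in> borel_measurable lebesgue" unfolding u_def by (rule measurable_completion) simp
  have "integrable lebesgue (\<lambda>x. norm (u x) powr ps)"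
  proof -
    have "norm (u x) powr ps = c powr ps * bubble p x powr ps" for x
      using c bubble_pos[of p x] by (simp add: u_def abs_mult powr_mult)
    then show ?thesis using b(1) by (subst integrable_completion) (auto simp: u_def)
  qed
  then have "u \<in> Lp (crit_exp DIM('a) p)" using um by (simp add: Lp_def crit_exp_def ps_def N_def)
  then show "u \<in> D1p p" using w' gm gi by (simp add: D1p_def Lp_def)
qed

text \<open>When the constraints are added, the coupling coefficients \<alpha>/ps and \<beta>/ps sum
  to 1, so the potential integral in the energy equals the total gradient integral. Hoelder with
  exponents ps/\<alpha> and ps/\<beta> also supplies integrability of the coupling term, which is
  what allows the integrals to be split.\<close>

lemma nehari_energy:
  fixes u v :: "'a::euclidean_space \<Rightarrow> real" and p \<alpha> \<beta> \<mu>1 \<mu>2 \<gamma> :: real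
  defines "N \<equiv> real DIM('a)"
  defines "ps \<equiv> N * p / (N - p)"
  assumes p: "1 < p" "p < N" and ab: "\<alpha> > 1" "\<beta> > 1" "\<alpha> + \<beta> = ps"
    and uv: "(u, v) \<in> nehari p \<alpha> \<beta> \<mu>1 \<mu>2 \<gamma>"
  defines "E \<equiv> (\<integral>x. norm (weak_grad u x) powr p \<partial>lebesgue) + (\<integral>x. norm (weak_grad v x) powr p \<partial>lebesgue)"
  shows "energy p \<alpha> \<beta> \<mu>1 \<mu>2 \<gamma> (u, v) = (1 / p - 1 / ps) * E"
    and "(\<integral>x. \<bar>u x\<bar> powr \<alpha> * \<bar>v x\<bar> powr \<beta> \<partial>lebesgue) \<le>
      (\<integral>x. \<bar>u x\<bar> powr ps \<partial>lebesgue) powr (\<alpha> / ps) * (\<integral>x. \<bar>v x\<bar> powr ps \<partial>lebesgue) powr (\<beta> / ps)"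
    and "E = \<mu>1 * (\<integral>x. \<bar>u x\<bar> powr ps \<partial>lebesgue) + \<mu>2 * (\<integral>x. \<bar>v x\<bar> powr ps \<partial>lebesgue) +
      \<gamma> * (\<integral>x. \<bar>u x\<bar> powr \<alpha> * \<bar>v x\<bar> powr \<beta> \<partial>lebesgue)"
proof -
  have ps: "ps > 0" using ab by simp
  have pc: "crit_exp DIM('a) p = ps" by (simp add: crit_exp_def ps_def N_def)
  have u: "u \<in> D1p p" and v: "v \<in> D1p p"
    and n1: "(\<integral>x. norm (weak_grad u x) powr p \<partial>lebesgue) =
          (\<integral>x. \<mu>1 * \<bar>u x\<bar> powr ps + \<alpha> * \<gamma> / ps * \<bar>u x\<bar> powr \<alpha> * \<bar>v x\<bar> powr \<beta> \<partial>lebesgue)"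
    and n2: "(\<integral>x. norm (weak_grad v x) powr p \<partial>lebesgue) =
          (\<integral>x. \<mu>2 * \<bar>v x\<bar> powr ps + \<beta> * \<gamma> / ps * \<bar>u x\<bar> powr \<alpha> * \<bar>v x\<bar> powr \<beta> \<partial>lebesgue)"
    using uv by (auto simp: nehari_def Let_def pc)
  note ud = D1pD[OF u, unfolded pc] and vd = D1pD[OF v, unfolded pc]
  have [measurable]: "u \<in> borel_measurable lebesgue" "v \<in> borel_measurable lebesgue" using ud vd by auto
  have q: "ps / \<alpha> > 1" "ps / \<beta> > 1" "1 / (ps / \<alpha>) + 1 / (ps / \<beta>) = 1"
    using ab ps by (auto simp: field_simps)
  have pw: "(\<bar>u x\<bar> powr \<alpha>) powr (ps / \<alpha>) = \<bar>u x\<bar> powr ps" "(\<bar>v x\<bar> powr \<beta>) powr (ps / \<beta>) = \<bar>v x\<bar> powr ps" for x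
    using ab by (simp_all add: powr_powr)
  have H: "integrable lebesgue (\<lambda>x. \<bar>u x\<bar> powr \<alpha> * \<bar>v x\<bar> powr \<beta>)"
    "(\<integral>x. \<bar>u x\<bar> powr \<alpha> * \<bar>v x\<bar> powr \<beta> \<partial>lebesgue) \<le>
      (\<integral>x. \<bar>u x\<bar> powr ps \<partial>lebesgue) powr (1 / (ps / \<alpha>)) * (\<integral>x. \<bar>v x\<bar> powr ps \<partial>lebesgue) powr (1 / (ps / \<beta>))"
    using Hoelder_integral[OF q, of "\<lambda>x. \<bar>u x\<bar> powr \<alpha>" lebesgue "\<lambda>x. \<bar>v x\<bar> powr \<beta>"] ud(2) vd(2) unfolding pw by auto
  then show "(\<integral>x. \<bar>u x\<bar> powr \<alpha> * \<bar>v x\<bar> powr \<beta> \<partial>lebesgue) \<le>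
      (\<integral>x. \<bar>u x\<bar> powr ps \<partial>lebesgue) powr (\<alpha> / ps) * (\<integral>x. \<bar>v x\<bar> powr ps \<partial>lebesgue) powr (\<beta> / ps)" by simp
  define X where "X = (\<integral>x. \<bar>u x\<bar> powr ps \<partial>lebesgue)"
  define Y where "Y = (\<integral>x. \<bar>v x\<bar> powr ps \<partial>lebesgue)"
  define Z where "Z = (\<integral>x. \<bar>u x\<bar> powr \<alpha> * \<bar>v x\<bar> powr \<beta> \<partial>lebesgue)"
  have 1: "(\<integral>x. \<mu>1 * \<bar>u x\<bar> powr ps + \<alpha> * \<gamma> / ps * \<bar>u x\<bar> powr \<alpha> * \<bar>v x\<bar> powr \<beta> \<partial>lebesgue) = \<mu>1 * X + \<alpha> * \<gamma> / ps * Z"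
    using ud(2) H(1) by (simp add: X_def Z_def mult.assoc)
  have 2: "(\<integral>x. \<mu>2 * \<bar>v x\<bar> powr ps + \<beta> * \<gamma> / ps * \<bar>u x\<bar> powr \<alpha> * \<bar>v x\<bar> powr \<beta> \<partial>lebesgue) = \<mu>2 * Y + \<beta> * \<gamma> / ps * Z"
    using vd(2) H(1) by (simp add: Y_def Z_def mult.assoc)
  have 3: "(\<integral>x. \<mu>1 * \<bar>u x\<bar> powr ps + \<mu>2 * \<bar>v x\<bar> powr ps + \<gamma> * \<bar>u x\<bar> powr \<alpha> * \<bar>v x\<bar> powr \<beta> \<partial>lebesgue) = \<mu>1 * X + \<mu>2 * Y + \<gamma> * Z"
    using ud(2) vd(2) H(1) by (simp add: X_def Y_def Z_def mult.assoc)
  have 4: "(\<integral>x. norm (weak_grad u x) powr p + norm (weak_grad v x) powr p \<partial>lebesgue) = E"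
    using ud(4) vd(4) by (simp add: E_def)
  have "\<alpha> * \<gamma> / ps * Z + \<beta> * \<gamma> / ps * Z = \<gamma> * Z * ((\<alpha> + \<beta>) / ps)"
    by (simp add: algebra_simps add_divide_distrib)
  also have "\<dots> = \<gamma> * Z" using ab ps by simp
  finally have E: "E = \<mu>1 * X + \<mu>2 * Y + \<gamma> * Z" unfolding E_def n1 n2 1 2 by simp
  then show "E = \<mu>1 * (\<integral>x. \<bar>u x\<bar> powr ps \<partial>lebesgue) + \<mu>2 * (\<integral>x. \<bar>v x\<bar> powr ps \<partial>lebesgue) +
      \<gamma> * (\<integral>x. \<bar>u x\<bar> powr \<alpha> * \<bar>v x\<bar> powr \<beta> \<partial>lebesgue)" by (simp add: X_def Y_def Z_def)
  show "energy p \<alpha> \<beta> \<mu>1 \<mu>2 \<gamma> (u, v) = (1 / p - 1 / ps) * E"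
    unfolding energy_def Let_def pc prod.case 3 4 E[symmetric] by (simp add: algebra_simps)
qed

text \<open>The estimates for a general pair become equalities for the constructed one, in which k
  and l are the shares of the total gradient energy in the two components.\<close>

lemma ground_state_exists:
  fixes p \<alpha> \<beta> \<mu>1 \<mu>2 \<gamma> :: real
  defines "N \<equiv> real DIM('a::euclidean_space)"
  defines "ps \<equiv> N * p / (N - p)"
  assumes p: "1 < p" "p < N / 2" and ab: "\<alpha> > 1" "\<beta> > 1" "\<alpha> + \<beta> = ps" "\<alpha> < p" "\<beta> < p"
    and \<mu>: "\<mu>1 > 0" "\<mu>2 > 0" "\<gamma> > 0"
  shows "\<exists>c1 c2. c1 > 0 \<and> c2 > 0 \<and>
    (\<lambda>x::'a. c1 * bubble p x, \<lambda>x. c2 * bubble p x) \<in> nehari p \<alpha> \<beta> \<mu>1 \<mu>2 \<gamma> \<and>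
    energy p \<alpha> \<beta> \<mu>1 \<mu>2 \<gamma> (\<lambda>x::'a. c1 * bubble p x, \<lambda>x. c2 * bubble p x) = ground_level TYPE('a) p \<alpha> \<beta> \<mu>1 \<mu>2 \<gamma>"
proof -
  have N: "N > 2" "N - p > 0" "p < N" using p by auto
  have pp: "p > 0" using p by simp
  have psp: "ps > p"
  proof -
    have "N - p < N" using p by simp
    then have "p * (N - p) < p * N" using pp by (intro mult_strict_left_mono) auto
    then show ?thesis unfolding ps_def using N by (simp add: less_divide_eq mult.commute)
  qed
  have ps: "ps > 0" using psp pp by simp
  have pc: "crit_exp DIM('a) p = ps" by (simp add: crit_exp_def ps_def N_def)
  define Mb where "Mb = (\<integral>(x::'a). bubble p x powr ps \<partial>lborel)"
  define A where "A = (\<integral>(x::'a). norm (bubble_grad p x) powr p \<partial>lborel)"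
  note bub = bubble_sobolev[where 'a = 'a, of p, folded N_def, folded ps_def, folded Mb_def A_def, OF p]
  define r where "r = ps / p"
  have r: "r > 1" "r = \<alpha> / p + \<beta> / p" using psp pp ab by (simp_all add: r_def add_divide_distrib[symmetric])
  have abp: "0 < \<alpha> / p" "\<alpha> / p < 1" "0 < \<beta> / p" "\<beta> / p < 1" using ab pp by auto
  obtain k l M where k: "k > 0" and l: "l > 0" and kl: "k + l = 1" and M: "M > 0"
    and hom: "\<And>x y. 0 \<le> x \<Longrightarrow> 0 \<le> y \<Longrightarrow> \<mu>1 * x powr r + \<mu>2 * y powr r + \<gamma> * (x powr (\<alpha> / p) * y powr (\<beta> / p)) \<le> M * (x + y) powr r"
    and c1: "\<mu>1 * k powr r + \<alpha> / p / r * \<gamma> * (k powr (\<alpha> / p) * l powr (\<beta> / p)) = M * k"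
    and c2: "\<mu>2 * l powr r + \<beta> / p / r * \<gamma> * (k powr (\<alpha> / p) * l powr (\<beta> / p)) = M * l"
    using coupling_maximum[OF \<mu> abp r(2,1)] by metis
  have apr: "\<alpha> / p / r = \<alpha> / ps" "\<beta> / p / r = \<beta> / ps" using pp by (simp_all add: r_def)
  \<comment> \<open>The solution of \<open>\<sigma> powr ps * M * Mb = \<sigma> powr p * A\<close>,
    the common scale at which both constraints hold.\<close>
  define \<sigma> where "\<sigma> = (A / (Mb * M)) powr (1 / (ps - p))"
  have \<sigma>: "\<sigma> > 0" using bub(3,4) M by (simp add: \<sigma>_def)
  have \<sigma>eq: "\<sigma> powr ps * M * Mb = \<sigma> powr p * A"
  proof -
    have "\<sigma> powr (ps - p) = A / (Mb * M)" using psp bub(3,4) M by (simp add: \<sigma>_def powr_powr)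
    moreover have "\<sigma> powr ps = \<sigma> powr p * \<sigma> powr (ps - p)" by (simp flip: powr_add)
    ultimately show ?thesis using bub(3) M by simp
  qed
  \<comment> \<open>The p-th roots appear because k and l divide the gradient energy, which is
    homogeneous of degree p.\<close>
  define d1 where "d1 = \<sigma> * k powr (1 / p)"
  define d2 where "d2 = \<sigma> * l powr (1 / p)"
  have d: "d1 > 0" "d2 > 0" using \<sigma> k l by (auto simp: d1_def d2_def)
  have d1p: "d1 powr s = \<sigma> powr s * k powr (s / p)" and d2p: "d2 powr s = \<sigma> powr s * l powr (s / p)" for s
    using \<sigma> k l by (simp_all add: d1_def d2_def powr_mult powr_powr)
  define U where "U = (\<lambda>x::'a. d1 * bubble p x)"
  define V where "V = (\<lambda>x::'a. d2 * bubble p x)"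
  note U = bubble_multiple_D1p[where 'a = 'a, of p d1, folded N_def, OF p d(1), folded U_def A_def]
  note V = bubble_multiple_D1p[where 'a = 'a, of p d2, folded N_def, OF p d(2), folded V_def A_def]
  have cb: "continuous_on UNIV (bubble p :: 'a \<Rightarrow> real)"
    using has_derivative_bubble[OF p(1)] by (meson continuous_at_imp_continuous_on has_derivative_continuous)
  have bm [measurable]: "(bubble p :: 'a \<Rightarrow> real) \<in> borel_measurable borel"
    using cb by (rule borel_measurable_continuous_onI)
  have coupled: "\<bar>U x\<bar> powr \<alpha> * \<bar>V x\<bar> powr \<beta> = (d1 powr \<alpha> * d2 powr \<beta>) * bubble p x powr ps"
    "\<bar>U x\<bar> powr ps = d1 powr ps * bubble p x powr ps" "\<bar>V x\<bar> powr ps = d2 powr ps * bubble p x powr ps" for x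
    using d bubble_pos[of p x] by (simp_all add: U_def V_def abs_mult powr_mult powr_add flip: ab(3))
  have int: "(\<integral>(x::'a). c * bubble p x powr ps \<partial>lebesgue) = c * Mb" for c
    using integral_completion[of "\<lambda>x::'a. c * bubble p x powr ps" lborel] bub(1) by (simp add: Mb_def)
  have dd: "d1 powr \<alpha> * d2 powr \<beta> = \<sigma> powr ps * (k powr (\<alpha> / p) * l powr (\<beta> / p))"
    unfolding d1p d2p by (simp add: powr_add flip: ab(3))
  have nz: "\<not> (AE x in lebesgue. c * bubble p (x::'a) = 0)" if "c > 0" for c
  proof
    assume "AE x in lebesgue. c * bubble p (x::'a) = 0"
    then have "AE x in (lebesgue :: 'a measure). False" by eventually_elim (metis bubble_pos less_irrefl mult_pos_pos that)
    then have "emeasure lebesgue (UNIV :: 'a set) = 0" by (simp add: AE_iff_measurable[OF _ refl])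
    then show False by simp
  qed
  have n1: "(\<integral>x. norm (weak_grad U x) powr p \<partial>lebesgue) =
      (\<integral>x. \<mu>1 * \<bar>U x\<bar> powr ps + \<alpha> * \<gamma> / ps * \<bar>U x\<bar> powr \<alpha> * \<bar>V x\<bar> powr \<beta> \<partial>lebesgue)"
  proof -
    have "\<mu>1 * \<bar>U x\<bar> powr ps + \<alpha> * \<gamma> / ps * \<bar>U x\<bar> powr \<alpha> * \<bar>V x\<bar> powr \<beta> = (\<sigma> powr ps * (M * k)) * bubble p x powr ps" for x
    proof -
      have "\<mu>1 * \<bar>U x\<bar> powr ps + \<alpha> * \<gamma> / ps * \<bar>U x\<bar> powr \<alpha> * \<bar>V x\<bar> powr \<beta> =
        \<mu>1 * \<bar>U x\<bar> powr ps + \<alpha> * \<gamma> / ps * (\<bar>U x\<bar> powr \<alpha> * \<bar>V x\<bar> powr \<beta>)" by simp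
      also have "\<dots> = (\<sigma> powr ps * (\<mu>1 * k powr r + \<alpha> / ps * \<gamma> * (k powr (\<alpha> / p) * l powr (\<beta> / p)))) * bubble p x powr ps"
        unfolding coupled dd unfolding d1p r_def by (simp add: algebra_simps)
      \<comment> \<open>The first Euler-Lagrange equation of the maximum, after \<alpha>/p divided
        by r is recognised as \<alpha>/ps.\<close>
      finally show ?thesis using c1 unfolding apr by simp
    qed
    then have "(\<integral>x. \<mu>1 * \<bar>U x\<bar> powr ps + \<alpha> * \<gamma> / ps * \<bar>U x\<bar> powr \<alpha> * \<bar>V x\<bar> powr \<beta> \<partial>lebesgue) = \<sigma> powr ps * (M * k) * Mb"
      by (simp only: int)
    also have "\<dots> = (\<sigma> powr ps * M * Mb) * k" by simp
    also have "\<dots> = d1 powr p * A" unfolding \<sigma>eq d1p using k pp by simp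
    finally show ?thesis using U(2) by simp
  qed
  have n2: "(\<integral>x. norm (weak_grad V x) powr p \<partial>lebesgue) =
      (\<integral>x. \<mu>2 * \<bar>V x\<bar> powr ps + \<beta> * \<gamma> / ps * \<bar>U x\<bar> powr \<alpha> * \<bar>V x\<bar> powr \<beta> \<partial>lebesgue)"
  proof -
    have "\<mu>2 * \<bar>V x\<bar> powr ps + \<beta> * \<gamma> / ps * \<bar>U x\<bar> powr \<alpha> * \<bar>V x\<bar> powr \<beta> = (\<sigma> powr ps * (M * l)) * bubble p x powr ps" for x
    proof -
      have "\<mu>2 * \<bar>V x\<bar> powr ps + \<beta> * \<gamma> / ps * \<bar>U x\<bar> powr \<alpha> * \<bar>V x\<bar> powr \<beta> =
        \<mu>2 * \<bar>V x\<bar> powr ps + \<beta> * \<gamma> / ps * (\<bar>U x\<bar> powr \<alpha> * \<bar>V x\<bar> powr \<beta>)" by simp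
      also have "\<dots> = (\<sigma> powr ps * (\<mu>2 * l powr r + \<beta> / ps * \<gamma> * (k powr (\<alpha> / p) * l powr (\<beta> / p)))) * bubble p x powr ps"
        unfolding coupled dd unfolding d2p r_def by (simp add: algebra_simps)
      finally show ?thesis using c2 unfolding apr by simp
    qed
    then have "(\<integral>x. \<mu>2 * \<bar>V x\<bar> powr ps + \<beta> * \<gamma> / ps * \<bar>U x\<bar> powr \<alpha> * \<bar>V x\<bar> powr \<beta> \<partial>lebesgue) = \<sigma> powr ps * (M * l) * Mb"
      by (simp only: int)
    also have "\<dots> = (\<sigma> powr ps * M * Mb) * l" by simp
    also have "\<dots> = d2 powr p * A" unfolding \<sigma>eq d2p using l pp by simp
    finally show ?thesis using V(2) by simp
  qed
  have UV: "(U, V) \<in> nehari p \<alpha> \<beta> \<mu>1 \<mu>2 \<gamma>"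
    unfolding nehari_def Let_def pc using U(1) V(1) nz[OF d(1)] nz[OF d(2)] n1 n2 by (simp add: U_def[symmetric] V_def[symmetric]) (simp add: U_def V_def)
  define S0 where "S0 = \<sigma> powr p * A"
  have S0: "(\<integral>x. norm (weak_grad U x) powr p \<partial>lebesgue) + (\<integral>x. norm (weak_grad V x) powr p \<partial>lebesgue) = S0"
  proof -
    have "d1 powr p + d2 powr p = \<sigma> powr p * (k + l)" unfolding d1p d2p using k l pp by (simp add: distrib_left)
    then show ?thesis unfolding U(2) V(2) S0_def using kl by (simp flip: distrib_right)
  qed
  have eU: "energy p \<alpha> \<beta> \<mu>1 \<mu>2 \<gamma> (U, V) = (1 / p - 1 / ps) * S0"
    using nehari_energy(1)[where u = U and v = V and p = p and \<alpha> = \<alpha> and \<beta> = \<beta>] p N ab UV S0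
    unfolding N_def[symmetric] ps_def[symmetric] by simp
  have pos: "1 / p - 1 / ps > 0" using psp pp by (simp add: frac_less2)
  have min: "S0 \<le> (\<integral>x. norm (weak_grad u x) powr p \<partial>lebesgue) + (\<integral>x. norm (weak_grad v x) powr p \<partial>lebesgue)"
    if uv: "(u, v) \<in> nehari p \<alpha> \<beta> \<mu>1 \<mu>2 \<gamma>" for u v :: "'a \<Rightarrow> real"
  proof -
    define e1 where "e1 = (\<integral>x. norm (weak_grad u x) powr p \<partial>lebesgue)"
    define e2 where "e2 = (\<integral>x. norm (weak_grad v x) powr p \<partial>lebesgue)"
    define X where "X = (\<integral>x. \<bar>u x\<bar> powr ps \<partial>lebesgue)"
    define Y where "Y = (\<integral>x. \<bar>v x\<bar> powr ps \<partial>lebesgue)"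
    define Z where "Z = (\<integral>x. \<bar>u x\<bar> powr \<alpha> * \<bar>v x\<bar> powr \<beta> \<partial>lebesgue)"
    have u: "u \<in> D1p p" and v: "v \<in> D1p p" and unz: "\<not> (AE x in lebesgue. u x = 0)"
      using uv by (auto simp: nehari_def Let_def)
    note ud = D1pD[OF u, unfolded pc] and vd = D1pD[OF v, unfolded pc]
    have nn: "e1 \<ge> 0" "e2 \<ge> 0" "X \<ge> 0" "Y \<ge> 0"
      unfolding e1_def e2_def X_def Y_def by (auto intro!: integral_nonneg_AE)
    have en: "Z \<le> X powr (\<alpha> / ps) * Y powr (\<beta> / ps)" "e1 + e2 = \<mu>1 * X + \<mu>2 * Y + \<gamma> * Z"
      using nehari_energy(2,3)[where u = u and v = v and p = p and \<alpha> = \<alpha> and \<beta> = \<beta>, OF p(1)] N ab uv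
      unfolding N_def[symmetric] ps_def[symmetric] e1_def e2_def X_def Y_def Z_def by auto
    have XM: "X \<le> Mb * (e1 / A) powr r" and YM: "Y \<le> Mb * (e2 / A) powr r"
      unfolding X_def e1_def Y_def e2_def r_def by (rule bub(5)[OF ud(3,2,4)] bub(5)[OF vd(3,2,4)])+
    \<comment> \<open>Nontriviality of \<open>u\<close> makes the total gradient energy positive, so
      that it can be cancelled below.\<close>
    have "X \<noteq> 0"
    proof
      assume "X = 0"
      then have "AE x in lebesgue. \<bar>u x\<bar> powr ps = 0"
        using integral_nonneg_eq_0_iff_AE[OF ud(2)] by (simp add: X_def)
      then have "AE x in lebesgue. u x = 0" by eventually_elim simp
      then show False using unz by simp
    qed
    then have "e1 \<noteq> 0" using XM nn ps r by auto
    then have e: "e1 + e2 > 0" using nn by simp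
    have "X powr (\<alpha> / ps) \<le> (Mb * (e1 / A) powr r) powr (\<alpha> / ps)"
      using XM nn ab ps by (intro powr_mono2) auto
    also have "\<dots> = Mb powr (\<alpha> / ps) * (e1 / A) powr (\<alpha> / p)"
      using bub(3) ps by (simp add: powr_mult powr_powr r_def)
    finally have X': "X powr (\<alpha> / ps) \<le> Mb powr (\<alpha> / ps) * (e1 / A) powr (\<alpha> / p)" .
    have "Y powr (\<beta> / ps) \<le> (Mb * (e2 / A) powr r) powr (\<beta> / ps)"
      using YM nn ab ps by (intro powr_mono2) auto
    also have "\<dots> = Mb powr (\<beta> / ps) * (e2 / A) powr (\<beta> / p)"
      using bub(3) ps by (simp add: powr_mult powr_powr r_def)
    finally have Y': "Y powr (\<beta> / ps) \<le> Mb powr (\<beta> / ps) * (e2 / A) powr (\<beta> / p)" .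
    have Mbs: "Mb powr (\<alpha> / ps) * Mb powr (\<beta> / ps) = Mb"
    proof -
      have "\<alpha> / ps + \<beta> / ps = 1" using ab ps by (simp add: add_divide_distrib[symmetric])
      then show ?thesis using bub(3) by (simp flip: powr_add)
    qed
    have "Z \<le> (Mb powr (\<alpha> / ps) * (e1 / A) powr (\<alpha> / p)) * (Mb powr (\<beta> / ps) * (e2 / A) powr (\<beta> / p))"
      using en(1) mult_mono[OF X' Y'] by simp
    also have "\<dots> = (Mb powr (\<alpha> / ps) * Mb powr (\<beta> / ps)) * ((e1 / A) powr (\<alpha> / p) * (e2 / A) powr (\<beta> / p))"
      by (simp only: mult_ac)
    finally have Z': "Z \<le> Mb * ((e1 / A) powr (\<alpha> / p) * (e2 / A) powr (\<beta> / p))" unfolding Mbs .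
    have "e1 + e2 \<le> \<mu>1 * (Mb * (e1 / A) powr r) + \<mu>2 * (Mb * (e2 / A) powr r) + \<gamma> * (Mb * ((e1 / A) powr (\<alpha> / p) * (e2 / A) powr (\<beta> / p)))"
      unfolding en(2) using XM YM Z' \<mu> by (intro add_mono mult_left_mono) auto
    also have "\<dots> = Mb * (\<mu>1 * (e1 / A) powr r + \<mu>2 * (e2 / A) powr r + \<gamma> * ((e1 / A) powr (\<alpha> / p) * (e2 / A) powr (\<beta> / p)))"
      by (simp add: algebra_simps)
    \<comment> \<open>The maximum on the simplex enters in its homogeneous form, at the normalised
      energies \<open>e1 / A\<close> and \<open>e2 / A\<close>.\<close>
    also have "\<dots> \<le> Mb * (M * (e1 / A + e2 / A) powr r)"
      using bub(3,4) nn by (intro mult_left_mono hom) auto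
    also have "\<dots> = Mb * M * ((e1 + e2) powr r / A powr r)"
      using bub(4) nn by (simp add: add_divide_distrib[symmetric] powr_divide)
    finally have le: "e1 + e2 \<le> Mb * M * ((e1 + e2) powr r / A powr r)" .
    \<comment> \<open>The constructed pair attains equality in the bound just proved, by the choice
      of \<open>\<sigma>\<close>.\<close>
    have S0eq: "S0 = Mb * M * (S0 powr r / A powr r)"
    proof -
      have "S0 powr r = \<sigma> powr ps * A powr r"
        unfolding S0_def using bub(4) \<sigma> pp by (simp add: powr_mult powr_powr r_def)
      then show ?thesis using \<sigma>eq bub(4) by (simp add: S0_def mult_ac)
    qed
    show ?thesis unfolding e1_def[symmetric] e2_def[symmetric]
    proof (rule ccontr)
      assume "\<not> S0 \<le> e1 + e2"
      then have lt: "e1 + e2 < S0" by simp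
      define K where "K = Mb * M / A powr r"
      have K: "K > 0" using bub(3,4) M by (simp add: K_def)
      \<comment> \<open>Cancelling one power leaves \<open>x powr (r - 1)\<close>, which is strictly
        increasing, so an energy below \<open>S0\<close> would violate the bound.\<close>
      have split: "x powr r = x * x powr (r - 1)" if "x > 0" for x using that powr_add[of x 1 "r - 1"] by simp
      have S0p: "S0 > 0" using e lt by simp
      have "(e1 + e2) * 1 \<le> (e1 + e2) * (K * (e1 + e2) powr (r - 1))" using le split[OF e] by (simp add: K_def mult_ac)
      then have 1: "1 \<le> K * (e1 + e2) powr (r - 1)" using e by (simp only: mult_le_cancel_left_pos)
      have "S0 * 1 = S0 * (K * S0 powr (r - 1))" using S0eq split[OF S0p] by (simp add: K_def mult_ac)
      then have 2: "K * S0 powr (r - 1) = 1" using S0p by simp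
      have "(e1 + e2) powr (r - 1) < S0 powr (r - 1)" using e lt r by (intro powr_less_mono2) auto
      then show False using 1 2 K by (smt (verit) mult_less_cancel_left_pos)
    qed
  qed
  have "energy p \<alpha> \<beta> \<mu>1 \<mu>2 \<gamma> (U, V) \<le> energy p \<alpha> \<beta> \<mu>1 \<mu>2 \<gamma> w" if w: "w \<in> nehari p \<alpha> \<beta> \<mu>1 \<mu>2 \<gamma>" for w :: "('a \<Rightarrow> real) \<times> ('a \<Rightarrow> real)"
  proof -
    obtain u v where wuv: "w = (u, v)" by (cases w)
    then have uv: "(u, v) \<in> nehari p \<alpha> \<beta> \<mu>1 \<mu>2 \<gamma>" using w by simp
    have "energy p \<alpha> \<beta> \<mu>1 \<mu>2 \<gamma> (u, v) = (1 / p - 1 / ps) * ((\<integral>x. norm (weak_grad u x) powr p \<partial>lebesgue) + (\<integral>x. norm (weak_grad v x) powr p \<partial>lebesgue))"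
      using nehari_energy(1)[where u = u and v = v and p = p and \<alpha> = \<alpha> and \<beta> = \<beta>] p N ab uv
      unfolding N_def[symmetric] ps_def[symmetric] by simp
    then show ?thesis unfolding wuv eU using min[OF uv] pos by (simp add: mult_left_mono)
  qed
  then have "ground_level TYPE('a) p \<alpha> \<beta> \<mu>1 \<mu>2 \<gamma> = energy p \<alpha> \<beta> \<mu>1 \<mu>2 \<gamma> (U, V)"
    unfolding ground_level_def using UV by (intro cInf_eq_minimum) auto
  then show ?thesis using UV d unfolding U_def V_def by metis
qed

text \<open>Strict decrease comes from the negative power -(N - p)/p of a strictly increasing
  function of the norm.\<close>

lemma bubble_radial:
  assumes "1 < p" "p < real DIM('a::euclidean_space)" "c > 0"
  shows "radially_symmetric (\<lambda>x::'a. c * bubble p x)" "radially_decreasing (\<lambda>x::'a. c * bubble p x)"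
proof -
  show "radially_symmetric (\<lambda>x::'a. c * bubble p x)" by (simp add: radially_symmetric_def bubble_def)
  have "bubble p y < bubble p x" if "norm x < norm y" for x y :: 'a
    unfolding bubble_def
  proof (rule powr_less_mono2_neg)
    show "- ((real DIM('a) - p) / p) < 0" using assms by simp
    show "1 + norm x powr (p / (p - 1)) < 1 + norm y powr (p / (p - 1))"
      using that assms by (auto intro!: powr_less_mono2)
  qed (simp add: add_pos_nonneg)
  then show "radially_decreasing (\<lambda>x::'a. c * bubble p x)" using assms(3) by (simp add: radially_decreasing_def)
qed

theorem theorem1p3:
  fixes N :: nat and p \<alpha> \<beta> \<mu>1 \<mu>2 \<gamma> :: real
  assumes "N = CARD('n::finite)" and "N \<ge> 3"
    and "2 * real N / (real N + 2) < p" and "p < real N / 2" and "p > 1"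
    and "\<alpha> > 1" and "\<beta> > 1" and "\<alpha> + \<beta> = crit_exp N p"
    and "\<alpha> < p" and "\<beta> < p"
    and "\<mu>1 > 0" and "\<mu>2 > 0" and "\<gamma> > 0"
  shows "\<exists>U V :: real ^ 'n \<Rightarrow> real.
    (U, V) \<in> nehari p \<alpha> \<beta> \<mu>1 \<mu>2 \<gamma> \<and>
    energy p \<alpha> \<beta> \<mu>1 \<mu>2 \<gamma> (U, V) = ground_level TYPE(real ^ 'n) p \<alpha> \<beta> \<mu>1 \<mu>2 \<gamma> \<and>
    (\<forall>x. U x > 0) \<and> (\<forall>x. V x > 0) \<and>
    radially_symmetric U \<and> radially_symmetric V \<and>
    radially_decreasing U \<and> radially_decreasing V"
proof -
  have N: "DIM(real ^ 'n) = N" using assms(1) by simp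
  have p: "1 < p" "p < real DIM(real ^ 'n) / 2" "p < real DIM(real ^ 'n)" using assms(4,5) unfolding N by auto
  have ab: "\<alpha> + \<beta> = real DIM(real ^ 'n) * p / (real DIM(real ^ 'n) - p)"
    using assms(8) unfolding N crit_exp_def .
  obtain c1 c2 where c: "c1 > 0" "c2 > 0"
    "(\<lambda>x::real ^ 'n. c1 * bubble p x, \<lambda>x. c2 * bubble p x) \<in> nehari p \<alpha> \<beta> \<mu>1 \<mu>2 \<gamma>"
    "energy p \<alpha> \<beta> \<mu>1 \<mu>2 \<gamma> (\<lambda>x::real ^ 'n. c1 * bubble p x, \<lambda>x. c2 * bubble p x) = ground_level TYPE(real ^ 'n) p \<alpha> \<beta> \<mu>1 \<mu>2 \<gamma>"
    using ground_state_exists[OF p(1,2) assms(6,7) ab assms(9-13)] by blast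
  show ?thesis
    by (intro exI[of _ "\<lambda>x. c1 * bubble p x"] exI[of _ "\<lambda>x. c2 * bubble p x"] conjI allI c(3,4) mult_pos_pos
        bubble_pos bubble_radial[OF p(1,3)] c(1,2))
qed

end
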